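(* Let $k\ge0$ be an integer. The transform $\mathcal B_{2,k}$ defined by $$[\mathcal B_{2,k}\phi](q)=\Big(\frac1\pi\Big)^{3/4}\frac1{\sqrt{2^kk!}}\int_{\mathbb R}e^{-\frac{t^2+q^2}2+\sqrt2\,qt}\,H_k\Big(\frac{q+\overline q}{\sqrt2}-t\Big)\phi(t)\,dt,\qquad q\in\mathbb H,$$ is a Hilbert space isomorphism from $L^2_{\mathbb H}(\mathbb R;dt)$ onto $\mathcal{SR}^2_{2,k}$.
   Context: $\mathbb H$ is the algebra of quaternions, $\mathbb S=\{I\in\mathbb H:I^2=-1\}$, $\mathbb C_I=\mathbb R+\mathbb R I$ with Lebesgue measure $d\lambda_I$. $L^2_{\mathbb H}(\mathbb R;dt)$ is the right quaternionic Hilbert space of $\mathbb H$-valued square integrable functions on $\mathbb R$ with inner product $\langle f,g\rangle_{\mathbb R}=\int_{\mathbb R}\overline{f(t)}g(t)\,dt$. $H_k$ is the real (physicists') Hermite polynomial, $H_k(t)=(-1)^ke^{t^2}\frac{d^k}{dt^k}(e^{-t^2})$. Quaternionic Hermite polynomials: $H^Q_{m,n}(q,\overline q)=m!n!\sum_{j=0}^{\min(m,n)}\frac{(-1)^j}{j!}\frac{q^{m-j}\overline q^{\,n-j}}{(m-j)!(n-j)!}$. $\mathcal{SR}^2_{2,k}=\Big\{\sum_{j=0}^{\infty}H^Q_{j,k}(q,\overline q)c_j:\ c_j\in\mathbb H,\ \sum_{j=0}^\infty j!|c_j|^2<\infty\Big\}$, a space of functions on $\mathbb H$, endowed with the inner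 product $\langle f,g\rangle_{\mathbb C_I}=\int_{\mathbb C_I}\overline{f(q)}g(q)e^{-|q|^2}d\lambda_I(q)$, for which $\langle H^Q_{m,k},H^Q_{j,k}\rangle_{\mathbb C_I}=\pi m!k!\,\delta_{m,j}$ (so it does not depend on $I\in\mathbb S$). A Hilbert space isomorphism is a right $\mathbb H$-linear bijection preserving inner products. *)

theory Defs
  imports "HOL-Analysis.Analysis"
begin

section \<open>Quaternions\<close>

datatype quat = Quat (qRe: real) (qIm1: real) (qIm2: real) (qIm3: real)

lemma quat_eq_iff:
  "p = q \<longleftrightarrow> qRe p = qRe q \<and> qIm1 p = qIm1 q \<and> qIm2 p = qIm2 q \<and> qIm3 p = qIm3 q"
  by (cases p; cases q) simp

instantiation quat :: division_ring
begin

definition "0 = Quat 0 0 0 0"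

definition "1 = Quat 1 0 0 0"

definition "p + q = Quat (qRe p + qRe q) (qIm1 p + qIm1 q) (qIm2 p + qIm2 q) (qIm3 p + qIm3 q)"

definition "- q = Quat (- qRe q) (- qIm1 q) (- qIm2 q) (- qIm3 q)"

definition "p - q = Quat (qRe p - qRe q) (qIm1 p - qIm1 q) (qIm2 p - qIm2 q) (qIm3 p - qIm3 q)"

definition "p * q = Quat
  (qRe p * qRe q - qIm1 p * qIm1 q - qIm2 p * qIm2 q - qIm3 p * qIm3 q)
  (qRe p * qIm1 q + qIm1 p * qRe q + qIm2 p * qIm3 q - qIm3 p * qIm2 q)
  (qRe p * qIm2 q - qIm1 p * qIm3 q + qIm2 p * qRe q + qIm3 p * qIm1 q)
  (qRe p * qIm3 q + qIm1 p * qIm2 q - qIm2 p * qIm1 q + qIm3 p * qRe q)"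

definition "inverse q =
  (let d = (qRe q)\<^sup>2 + (qIm1 q)\<^sup>2 + (qIm2 q)\<^sup>2 + (qIm3 q)\<^sup>2
   in Quat (qRe q / d) (- qIm1 q / d) (- qIm2 q / d) (- qIm3 q / d))"

definition "p div q = p * inverse q" for p q :: quat

lemma quat_sel [simp]:
  "qRe 0 = 0" "qIm1 0 = 0" "qIm2 0 = 0" "qIm3 0 = 0"
  "qRe 1 = 1" "qIm1 1 = 0" "qIm2 1 = 0" "qIm3 1 = 0"
  "qRe (p + q) = qRe p + qRe q" "qIm1 (p + q) = qIm1 p + qIm1 q"
  "qIm2 (p + q) = qIm2 p + qIm2 q" "qIm3 (p + q) = qIm3 p + qIm3 q"
  "qRe (- q) = - qRe q" "qIm1 (- q) = - qIm1 q" "qIm2 (- q) = - qIm2 q" "qIm3 (- q) = - qIm3 q"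
  "qRe (p - q) = qRe p - qRe q" "qIm1 (p - q) = qIm1 p - qIm1 q"
  "qIm2 (p - q) = qIm2 p - qIm2 q" "qIm3 (p - q) = qIm3 p - qIm3 q"
  by (simp_all add: zero_quat_def one_quat_def plus_quat_def uminus_quat_def minus_quat_def)

lemma quat_sel_mult:
  "qRe (p * q) = qRe p * qRe q - qIm1 p * qIm1 q - qIm2 p * qIm2 q - qIm3 p * qIm3 q"
  "qIm1 (p * q) = qRe p * qIm1 q + qIm1 p * qRe q + qIm2 p * qIm3 q - qIm3 p * qIm2 q"
  "qIm2 (p * q) = qRe p * qIm2 q - qIm1 p * qIm3 q + qIm2 p * qRe q + qIm3 p * qIm1 q"
  "qIm3 (p * q) = qRe p * qIm3 q + qIm1 p * qIm2 q - qIm2 p * qIm1 q + qIm3 p * qRe q"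
  by (simp_all add: times_quat_def)

lemma quat_sum_squares_pos:
  "q \<noteq> 0 \<Longrightarrow> (qRe q)\<^sup>2 + (qIm1 q)\<^sup>2 + (qIm2 q)\<^sup>2 + (qIm3 q)\<^sup>2 > 0"
  by (auto simp: quat_eq_iff add_nonneg_pos add_pos_nonneg)

instance
proof
  fix p q r :: quat
  show "p * q * r = p * (q * r)" "(p + q) * r = p * r + q * r" "p * (q + r) = p * q + p * r"
    by (simp_all add: quat_eq_iff quat_sel_mult algebra_simps)
  have eqs: "a / d * a + b / d * b + c / d * c + e / d * e = 1"
    if "d = a\<^sup>2 + b\<^sup>2 + c\<^sup>2 + e\<^sup>2" "d > 0" for a b c d e :: real
    using that by (simp add: power2_eq_square flip: add_divide_distrib)
  show "inverse q * q = 1" "q * inverse q = 1" if "q \<noteq> 0"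
    using eqs[OF refl quat_sum_squares_pos[OF that]]
    by (simp_all add: quat_eq_iff quat_sel_mult inverse_quat_def Let_def mult.commute)
qed (simp_all add: quat_eq_iff quat_sel_mult inverse_quat_def divide_quat_def)

end

instantiation quat :: real_vector
begin

definition "r *\<^sub>R q = Quat (r * qRe q) (r * qIm1 q) (r * qIm2 q) (r * qIm3 q)"

lemma quat_sel_scaleR [simp]:
  "qRe (r *\<^sub>R q) = r * qRe q" "qIm1 (r *\<^sub>R q) = r * qIm1 q"
  "qIm2 (r *\<^sub>R q) = r * qIm2 q" "qIm3 (r *\<^sub>R q) = r * qIm3 q"
  by (simp_all add: scaleR_quat_def)

instance
  by standard (simp_all add: quat_eq_iff algebra_simps)

end

instantiation quat :: real_inner
begin

definition "p \<bullet> q = qRe p * qRe q + qIm1 p * qIm1 q + qIm2 p * qIm2 q + qIm3 p * qIm3 q"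

definition "norm q = sqrt ((qRe q)\<^sup>2 + (qIm1 q)\<^sup>2 + (qIm2 q)\<^sup>2 + (qIm3 q)\<^sup>2)"

definition "sgn q = q /\<^sub>R norm q" for q :: quat

definition "dist p q = norm (p - q)" for p q :: quat

definition [code del]:
  "(uniformity :: (quat \<times> quat) filter) = (INF e\<in>{0<..}. principal {(x, y). dist x y < e})"

definition [code del]:
  "open (U :: quat set) \<longleftrightarrow> (\<forall>x\<in>U. eventually (\<lambda>(x', y). x' = x \<longrightarrow> y \<in> U) uniformity)"

instance
proof
  fix p q r :: quat and a b :: real
  show "0 \<le> q \<bullet> q"
    by (simp add: inner_quat_def)
  show "q \<bullet> q = 0 \<longleftrightarrow> q = 0"
    by (cases "q = 0") (use quat_sum_squares_pos[of q] in \<open>simp_all add: inner_quat_def power2_eq_square\<close>)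
qed (auto simp: inner_quat_def norm_quat_def sgn_quat_def dist_quat_def
      uniformity_quat_def open_quat_def algebra_simps power2_eq_square)

end

instance quat :: real_normed_div_algebra
proof
  fix p q :: quat and r :: real
  show "r *\<^sub>R p * q = r *\<^sub>R (p * q)" "p * r *\<^sub>R q = r *\<^sub>R (p * q)"
    by (simp_all add: quat_eq_iff quat_sel_mult algebra_simps)
  show "norm (p * q) = norm p * norm q"
    unfolding norm_quat_def real_sqrt_mult[symmetric]
    unfolding quat_sel_mult by (rule arg_cong[where f = sqrt]) algebra
qed

instantiation quat :: euclidean_space
begin

definition "Basis = {Quat 1 0 0 0, Quat 0 1 0 0, Quat 0 0 1 0, Quat 0 0 0 1}"

instance
proof
  fix p q :: quat
  show "(Basis :: quat set) \<noteq> {}" "finite (Basis :: quat set)"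
    by (simp_all add: Basis_quat_def)
  show "p \<bullet> q = (if p = q then 1 else 0)" if "p \<in> Basis" "q \<in> Basis"
    using that unfolding Basis_quat_def by (elim insertE emptyE) (simp_all add: inner_quat_def)
  show "(\<forall>u\<in>Basis. q \<bullet> u = 0) \<longleftrightarrow> q = 0"
    unfolding Basis_quat_def ball_simps by (simp add: inner_quat_def quat_eq_iff[of q])
qed

end

definition qcnj :: "quat \<Rightarrow> quat" where
  "qcnj q = Quat (qRe q) (- qIm1 q) (- qIm2 q) (- qIm3 q)"

lemma quat_sel_cnj [simp]:
  "qRe (qcnj q) = qRe q" "qIm1 (qcnj q) = - qIm1 q"
  "qIm2 (qcnj q) = - qIm2 q" "qIm3 (qcnj q) = - qIm3 q"
  by (simp_all add: qcnj_def)

lemma qcnj_add: "qcnj (p + q) = qcnj p + qcnj q"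
  by (simp add: quat_eq_iff)

lemma qcnj_scaleR: "qcnj (r *\<^sub>R q) = r *\<^sub>R qcnj q"
  by (simp add: quat_eq_iff)

lemma qcnj_mult: "qcnj (p * q) = qcnj q * qcnj p"
  by (simp add: quat_eq_iff quat_sel_mult)

lemma norm_qcnj [simp]: "norm (qcnj q) = norm q"
  by (simp add: norm_quat_def)

lemma mult_qcnj: "q * qcnj q = of_real ((norm q)\<^sup>2)"
  by (simp add: quat_eq_iff quat_sel_mult norm_quat_def of_real_def power2_eq_square)

lemma bounded_linear_qcnj: "bounded_linear qcnj"
  by (rule bounded_linear_intro[where K = 1]) (simp_all add: qcnj_add qcnj_scaleR)

lemma qcnj_measurable [measurable]: "qcnj \<in> borel_measurable borel"
  by (intro borel_measurable_continuous_onI linear_continuous_on bounded_linear_qcnj)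

definition imag_units :: "quat set" where
  "imag_units = {I. I ^ 2 = - 1}"


section \<open>Right quaternionic inner product spaces\<close>

record 'v rq_space =
  vectors :: "'v set"
  vadd :: "'v \<Rightarrow> 'v \<Rightarrow> 'v"
  vscale :: "'v \<Rightarrow> quat \<Rightarrow> 'v"
  vinner :: "'v \<Rightarrow> 'v \<Rightarrow> quat"

definition hilbert_space_iso :: "'v rq_space \<Rightarrow> 'w rq_space \<Rightarrow> ('v \<Rightarrow> 'w) \<Rightarrow> bool" where
  "hilbert_space_iso V W T \<longleftrightarrow>
     bij_betw T (vectors V) (vectors W) \<and>
     (\<forall>x\<in>vectors V. \<forall>y\<in>vectors V. T (vadd V x y) = vadd W (T x) (T y)) \<and>
     (\<forall>x\<in>vectors V. \<forall>c. T (vscale V x c) = vscale W (T x) c) \<and>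
     (\<forall>x\<in>vectors V. \<forall>y\<in>vectors V. vinner W (T x) (T y) = vinner V x y)"


section \<open>The space of square integrable functions on the real line\<close>

definition square_integrable :: "(real \<Rightarrow> quat) \<Rightarrow> bool" where
  "square_integrable \<phi> \<longleftrightarrow>
     \<phi> \<in> borel_measurable lborel \<and> integrable lborel (\<lambda>t. (norm (\<phi> t))\<^sup>2)"

lemma square_integrable_add:
  assumes "square_integrable \<phi>" "square_integrable \<psi>"
  shows "square_integrable (\<lambda>t. \<phi> t + \<psi> t)"
proof -
  have [measurable]: "\<phi> \<in> borel_measurable lborel" "\<psi> \<in> borel_measurable lborel"
    using assms by (auto simp: square_integrable_def)
  have le: "(norm (p + q))\<^sup>2 \<le> 2 * (norm p)\<^sup>2 + 2 * (norm q)\<^sup>2" for p q :: quat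
  proof -
    have "(norm (p + q))\<^sup>2 \<le> (norm p + norm q)\<^sup>2"
      by (intro power_mono norm_triangle_ineq) simp
    also have "\<dots> \<le> 2 * (norm p)\<^sup>2 + 2 * (norm q)\<^sup>2"
      using zero_le_power2[of "norm p - norm q"] by (simp add: power2_eq_square algebra_simps)
    finally show ?thesis .
  qed
  have "integrable lborel (\<lambda>t. 2 * (norm (\<phi> t))\<^sup>2 + 2 * (norm (\<psi> t))\<^sup>2)"
    using assms by (auto simp: square_integrable_def)
  then have "integrable lborel (\<lambda>t. (norm (\<phi> t + \<psi> t))\<^sup>2)"
    by (rule Bochner_Integration.integrable_bound) (use le in \<open>auto intro!: AE_I2\<close>)
  then show ?thesis
    by (simp add: square_integrable_def)
qed

lemma square_integrable_scale:
  assumes "square_integrable \<phi>"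
  shows "square_integrable (\<lambda>t. \<phi> t * c)"
  using assms by (auto simp: square_integrable_def norm_mult power_mult_distrib)

quotient_type L2_quat = "real \<Rightarrow> quat" / partial:
  "\<lambda>\<phi> \<psi>. square_integrable \<phi> \<and> square_integrable \<psi> \<and> (AE t in lborel. \<phi> t = \<psi> t)"
proof (rule part_equivpI)
  show "\<exists>\<phi>. square_integrable \<phi> \<and> square_integrable \<phi> \<and> (AE t in lborel. \<phi> t = \<phi> t)"
    by (rule exI[of _ "\<lambda>_. 0"]) (simp add: square_integrable_def)
next
  show "symp (\<lambda>\<phi> \<psi>. square_integrable \<phi> \<and> square_integrable \<psi> \<and> (AE t in lborel. \<phi> t = \<psi> t))"
    by (auto simp: symp_def elim: eventually_mono)
next
  show "transp (\<lambda>\<phi> \<psi>. square_integrable \<phi> \<and> square_integrable \<psi> \<and> (AE t in lborel. \<phi> t = \<psi> t))"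
  proof (rule transpI, elim conjE, intro conjI)
    fix \<phi> \<psi> \<xi> :: "real \<Rightarrow> quat"
    assume "AE t in lborel. \<phi> t = \<psi> t" "AE t in lborel. \<psi> t = \<xi> t"
    then show "AE t in lborel. \<phi> t = \<xi> t"
      by eventually_elim simp
  qed
qed

lift_definition L2_add :: "L2_quat \<Rightarrow> L2_quat \<Rightarrow> L2_quat" is
  "\<lambda>\<phi> \<psi> t. \<phi> t + \<psi> t"
proof (elim conjE, intro conjI square_integrable_add)
  fix f f' g g' :: "real \<Rightarrow> quat"
  assume "AE t in lborel. f t = f' t" "AE t in lborel. g t = g' t"
  then show "AE t in lborel. f t + g t = f' t + g' t"
    by eventually_elim simp
qed

lift_definition L2_scale :: "L2_quat \<Rightarrow> quat \<Rightarrow> L2_quat" is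
  "\<lambda>\<phi> c t. \<phi> t * c"
  by (auto intro: square_integrable_scale elim: eventually_mono)

lift_definition L2_inner :: "L2_quat \<Rightarrow> L2_quat \<Rightarrow> quat" is
  "\<lambda>\<phi> \<psi>. \<integral>t. qcnj (\<phi> t) * \<psi> t \<partial>lborel"
proof (elim conjE)
  fix f f' g g' :: "real \<Rightarrow> quat"
  assume "square_integrable f" "square_integrable f'" "square_integrable g" "square_integrable g'"
  then have [measurable]: "f \<in> borel_measurable lborel" "f' \<in> borel_measurable lborel"
      "g \<in> borel_measurable lborel" "g' \<in> borel_measurable lborel"
    by (auto simp: square_integrable_def)
  assume "AE t in lborel. f t = f' t" "AE t in lborel. g t = g' t"
  then have "AE t in lborel. qcnj (f t) * g t = qcnj (f' t) * g' t"
    by eventually_elim simp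
  then show "(\<integral>t. qcnj (f t) * g t \<partial>lborel) = (\<integral>t. qcnj (f' t) * g' t \<partial>lborel)"
    by (intro integral_cong_AE) measurable
qed

definition L2_space :: "L2_quat rq_space" where
  "L2_space = \<lparr>vectors = UNIV, vadd = L2_add, vscale = L2_scale, vinner = L2_inner\<rparr>"


section \<open>Quaternionic Hermite polynomials and the target space\<close>

definition quat_hermite :: "nat \<Rightarrow> nat \<Rightarrow> quat \<Rightarrow> quat" where
  "quat_hermite m n q =
     (fact m * fact n) *\<^sub>R
       (\<Sum>j\<le>min m n. ((-1) ^ j / fact j) *\<^sub>R
          (q ^ (m - j) * qcnj q ^ (n - j) /\<^sub>R (fact (m - j) * fact (n - j))))"

definition SR2 :: "nat \<Rightarrow> (quat \<Rightarrow> quat) set" where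
  "SR2 k = {f. \<exists>c :: nat \<Rightarrow> quat. summable (\<lambda>j. fact j * (norm (c j))\<^sup>2) \<and>
                 (\<forall>q. (\<lambda>j. quat_hermite j k q * c j) sums f q)}"

text \<open>Lebesgue measure on the slice \<open>\<real> + \<real> I\<close>, transported from the complex plane and
  regarded as a measure on all quaternions that is concentrated on the slice.\<close>

definition slice_measure :: "quat \<Rightarrow> quat measure" where
  "slice_measure I = distr lborel borel (\<lambda>z :: complex. of_real (Re z) + of_real (Im z) * I)"

lemma slice_embedding_measurable:
  "(\<lambda>z. of_real (Re z) + of_real (Im z) * I :: quat) \<in> borel_measurable lborel"
proof -
  have "continuous_on UNIV (\<lambda>z. of_real (Re z) + of_real (Im z) * I :: quat)"
    unfolding of_real_def by (intro continuous_intros)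
  then show ?thesis
    using borel_measurable_continuous_onI by simp
qed

definition slice_inner :: "quat \<Rightarrow> (quat \<Rightarrow> quat) \<Rightarrow> (quat \<Rightarrow> quat) \<Rightarrow> quat" where
  "slice_inner I f g =
     (\<integral>q. qcnj (f q) * g q * of_real (exp (- (norm q)\<^sup>2)) \<partial>slice_measure I)"

definition SR2_space :: "nat \<Rightarrow> quat \<Rightarrow> (quat \<Rightarrow> quat) rq_space" where
  "SR2_space k I =
     \<lparr>vectors = SR2 k, vadd = (\<lambda>f g q. f q + g q), vscale = (\<lambda>f c q. f q * c),
      vinner = slice_inner I\<rparr>"


section \<open>The transform\<close>

definition hermite :: "nat \<Rightarrow> real \<Rightarrow> real" where
  "hermite k t = (-1) ^ k * exp (t\<^sup>2) * (deriv ^^ k) (\<lambda>s. exp (- s\<^sup>2)) t"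

text \<open>The quaternion \<open>(q + qcnj q) / sqrt 2\<close> is real, and the real Hermite polynomial
  is applied to it through its real part.\<close>

definition transform_integrand :: "nat \<Rightarrow> (real \<Rightarrow> quat) \<Rightarrow> quat \<Rightarrow> real \<Rightarrow> quat" where
  "transform_integrand k \<phi> q t =
     exp (- ((of_real t)\<^sup>2 + q\<^sup>2) / 2 + of_real (sqrt 2) * q * of_real t)
       * of_real (hermite k (qRe ((q + qcnj q) /\<^sub>R sqrt 2) - t)) * \<phi> t"

lemma continuous_hermite: "continuous_on UNIV (hermite k)"
proof -
  have "\<exists>p :: real poly. (deriv ^^ k) (\<lambda>s. exp (- s\<^sup>2)) = (\<lambda>s. poly p s * exp (- s\<^sup>2))"
  proof (induction k)
    case 0
    show ?case by (rule exI[of _ 1]) simp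
  next
    case (Suc k)
    then obtain p :: "real poly"
      where p: "(deriv ^^ k) (\<lambda>s. exp (- s\<^sup>2)) = (\<lambda>s. poly p s * exp (- s\<^sup>2))"
      by blast
    have "deriv (\<lambda>s. poly p s * exp (- s\<^sup>2)) x
        = poly (pderiv p - [:0, 2:] * p) x * exp (- x\<^sup>2)" for x
      by (rule DERIV_imp_deriv)
        (auto intro!: derivative_eq_intros poly_DERIV simp: algebra_simps)
    then show ?case
      by (intro exI[of _ "pderiv p - [:0, 2:] * p"]) (simp only: funpow.simps o_def p)
  qed
  then obtain p :: "real poly"
    where p: "(deriv ^^ k) (\<lambda>s. exp (- s\<^sup>2)) = (\<lambda>s. poly p s * exp (- s\<^sup>2))"
    by blast
  show ?thesis
    unfolding hermite_def p by (intro continuous_intros)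
qed

lemma exp_kernel_split:
  "exp (- ((of_real t)\<^sup>2 + q\<^sup>2) / 2 + of_real (sqrt 2) * q * of_real t)
     = exp (- t\<^sup>2 / 2) *\<^sub>R (exp (- (1 / 2) *\<^sub>R q\<^sup>2) * exp (t *\<^sub>R (sqrt 2 *\<^sub>R q)))"
  for q :: quat
proof -
  have half: "x / 2 = (1 / 2) *\<^sub>R x" for x :: quat
  proof -
    have "x / 2 = x * of_real (1 / 2)"
      unfolding divide_inverse mult_1_left of_real_inverse of_real_numeral ..
    then show ?thesis
      by (simp only: of_real_def mult_scaleR_right mult_1_right)
  qed
  have "- ((of_real t)\<^sup>2 + q\<^sup>2) / 2 + of_real (sqrt 2) * q * of_real t
      = of_real (- t\<^sup>2 / 2) + (- (1 / 2) *\<^sub>R q\<^sup>2 + t *\<^sub>R (sqrt 2 *\<^sub>R q))"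
    unfolding half of_real_power[symmetric] by (simp add: of_real_def algebra_simps)
  moreover have "exp (of_real (- t\<^sup>2 / 2) + (- (1 / 2) *\<^sub>R q\<^sup>2 + t *\<^sub>R (sqrt 2 *\<^sub>R q)))
      = exp (of_real (- t\<^sup>2 / 2)) * exp (- (1 / 2) *\<^sub>R q\<^sup>2 + t *\<^sub>R (sqrt 2 *\<^sub>R q))"
    by (rule exp_add_commuting) (simp only: of_real_def mult_scaleR_left mult_scaleR_right mult_1_left mult_1_right)
  moreover have "exp (- (1 / 2) *\<^sub>R q\<^sup>2 + t *\<^sub>R (sqrt 2 *\<^sub>R q))
      = exp (- (1 / 2) *\<^sub>R q\<^sup>2) * exp (t *\<^sub>R (sqrt 2 *\<^sub>R q))"
    by (rule exp_add_commuting) (simp add: power2_eq_square mult.assoc)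
  moreover have "exp (of_real (- t\<^sup>2 / 2)) = (of_real (exp (- t\<^sup>2 / 2)) :: quat)"
    by (rule exp_of_real)
  ultimately show ?thesis
    by (simp add: scaleR_conv_of_real)
qed

lemma transform_integrand_measurable:
  assumes [measurable]: "\<phi> \<in> borel_measurable lborel"
  shows "transform_integrand k \<phi> q \<in> borel_measurable lborel"
proof -
  have [measurable]: "hermite k \<in> borel_measurable borel"
    by (rule borel_measurable_continuous_onI[OF continuous_hermite])
  have [measurable]: "(\<lambda>t. exp (t *\<^sub>R (sqrt 2 *\<^sub>R q))) \<in> borel_measurable borel"
    by (intro borel_measurable_continuous_onI continuous_at_imp_continuous_on ballI
        has_vector_derivative_continuous[OF exp_scaleR_has_vector_derivative_right])
  show ?thesis
    unfolding transform_integrand_def exp_kernel_split by measurable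
qed

lift_definition segal_bargmann :: "nat \<Rightarrow> L2_quat \<Rightarrow> quat \<Rightarrow> quat" is
  "\<lambda>k \<phi> q. ((1 / pi) powr (3 / 4) * (1 / sqrt (2 ^ k * fact k))) *\<^sub>R
     (\<integral>t. transform_integrand k \<phi> q t \<partial>lborel)"
proof (elim conjE, rule ext)
  fix k q and f g :: "real \<Rightarrow> quat"
  assume "square_integrable f" "square_integrable g" and eq: "AE t in lborel. f t = g t"
  then have "transform_integrand k f q \<in> borel_measurable lborel"
      "transform_integrand k g q \<in> borel_measurable lborel"
    unfolding square_integrable_def by (blast intro: transform_integrand_measurable)+
  moreover have "AE t in lborel. transform_integrand k f q t = transform_integrand k g q t"
    using eq by eventually_elim (simp add: transform_integrand_def)
  ultimately have "(\<integral>t. transform_integrand k f q t \<partial>lborel)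
      = (\<integral>t. transform_integrand k g q t \<partial>lborel)"
    by (rule integral_cong_AE)
  then show "((1 / pi) powr (3 / 4) * (1 / sqrt (2 ^ k * fact k))) *\<^sub>R
        (\<integral>t. transform_integrand k f q t \<partial>lborel)
      = ((1 / pi) powr (3 / 4) * (1 / sqrt (2 ^ k * fact k))) *\<^sub>R
        (\<integral>t. transform_integrand k g q t \<partial>lborel)"
    by simp
qed

end

theory Submission
  imports Defs "HOL-Probability.Probability"
begin

text \<open>
  The Hermite functions \<open>h j\<close> form a complete orthonormal system of the space of square integrable
  functions on the line, and by the Ito orthogonality relations the functions
  \<open>H j k / sqrt (pi j! k!)\<close> are orthonormal on every slice. Integration by parts against the Gaussian
  weight gives both Hermite families the same recurrence, so the transform sends \<open>h j\<close> to
  \<open>H j k / sqrt (pi j! k!)\<close>. Expanding the kernel in the Hermite functions (Parseval) turns this into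
  a pointwise convergent series for the transform of an arbitrary \<open>\<phi>\<close>, whose coefficients are the
  Hermite coefficients of \<open>\<phi>\<close>; both inner products are therefore the inner product of square
  summable coefficient sequences, and surjectivity is the Riesz-Fischer theorem.
  Completeness of the Hermite functions follows from the uniqueness of characteristic functions:
  if \<open>\<phi>\<close> is orthogonal to every \<open>h j\<close>, all moments of \<open>exp (- t\<^sup>2 / 2) \<phi> t\<close> vanish, hence so does its
  Fourier transform.
\<close>

section \<open>Square integrable quaternionic functions\<close>

text \<open>Noncommutativity is kept under control by two facts. Every quaternion lies on a slice
  that is a copy of the complex plane, and the kernel and \<open>quat_hermite\<close> take values in
  the slice of their argument, so their analysis is purely complex. The function \<phi> and the
  coefficients, which leave the slice, enter as right factors and are never commuted with slice
  values. The other obstacle is that elements of the target space are pointwise convergent series,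
  while the inner product sees one slice only up to null sets. Fatou's lemma bridges this: a
  pointwise limit of partial sums with square summable coefficients is also their limit in the mean.
  On a slice this does the work of completeness, which fails there for a fixed \<open>k\<close>. The
  theory of orthonormal sequences is set up over an arbitrary measure because it is used twice, for
  \<open>lborel\<close> and for \<open>slice_measure\<close>.\<close>

definition qL2 :: "'a measure \<Rightarrow> ('a \<Rightarrow> quat) \<Rightarrow> bool" where
  "qL2 M f \<longleftrightarrow> f \<in> borel_measurable M \<and> integrable M (\<lambda>x. (norm (f x))\<^sup>2)"

definition qinner :: "'a measure \<Rightarrow> ('a \<Rightarrow> quat) \<Rightarrow> ('a \<Rightarrow> quat) \<Rightarrow> quat" where
  "qinner M f g = (\<integral>x. qcnj (f x) * g x \<partial>M)"

definition qsqnorm :: "'a measure \<Rightarrow> ('a \<Rightarrow> quat) \<Rightarrow> real" where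
  "qsqnorm M f = (\<integral>x. (norm (f x))\<^sup>2 \<partial>M)"

lemma qcnj_simps [simp]: "qcnj (qcnj q) = q" "qcnj 0 = 0" "qcnj 1 = 1" "qcnj (of_real r) = of_real r"
  by (simp_all add: quat_eq_iff of_real_def)

lemma quat_of_real_sel [simp]:
  "qRe (of_real r) = r" "qIm1 (of_real r) = 0" "qIm2 (of_real r) = 0" "qIm3 (of_real r) = 0"
  by (simp_all add: of_real_def)

lemma qcnj_diff: "qcnj (p - q) = qcnj p - qcnj q"
  by (simp add: quat_eq_iff)

lemma qcnj_mult_self: "qcnj q * q = of_real ((norm q)\<^sup>2)"
  using mult_qcnj[of "qcnj q"] by simp

lemma norm_quat_squared: "(norm q)\<^sup>2 = (qRe q)\<^sup>2 + (qIm1 q)\<^sup>2 + (qIm2 q)\<^sup>2 + (qIm3 q)\<^sup>2"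
  by (simp add: norm_quat_def)

lemma bounded_linear_qRe: "bounded_linear qRe"
  by (rule bounded_linear_intro[where K = 1]) (auto simp: norm_quat_def intro!: real_le_rsqrt)

lemma qL2_measurable: "qL2 M f \<Longrightarrow> f \<in> borel_measurable M"
  by (simp add: qL2_def)

lemma norm_mult_le_sum_squares: "norm (p * q) \<le> (norm p)\<^sup>2 + (norm q)\<^sup>2" for p q :: quat
proof -
  have "norm p * norm q \<le> (norm p)\<^sup>2 + (norm q)\<^sup>2"
    using sum_squares_bound[of "norm p" "norm q"] mult_nonneg_nonneg[OF norm_ge_zero norm_ge_zero, of p q]
    by linarith
  then show ?thesis by (simp add: norm_mult)
qed

lemma integrable_norm_mult:
  assumes "qL2 M f" "qL2 M g"
  shows "integrable M (\<lambda>x. norm (f x) * norm (g x))"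
proof (rule Bochner_Integration.integrable_bound)
  show "integrable M (\<lambda>x. (norm (f x))\<^sup>2 + (norm (g x))\<^sup>2)"
    using assms by (simp add: qL2_def)
  show "(\<lambda>x. norm (f x) * norm (g x)) \<in> borel_measurable M"
    using assms by (auto simp: qL2_def)
  show "AE x in M. norm (norm (f x) * norm (g x)) \<le> norm ((norm (f x))\<^sup>2 + (norm (g x))\<^sup>2)"
    using norm_mult_le_sum_squares by (auto simp: norm_mult intro!: AE_I2)
qed

lemma integrable_qinner:
  assumes "qL2 M f" "qL2 M g"
  shows "integrable M (\<lambda>x. qcnj (f x) * g x)"
proof (rule Bochner_Integration.integrable_bound[OF integrable_norm_mult[OF assms]])
  show "(\<lambda>x. qcnj (f x) * g x) \<in> borel_measurable M"
    using assms[THEN qL2_measurable] by measurable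
qed (simp add: norm_mult)

lemma qL2_add:
  assumes "qL2 M f" "qL2 M g"
  shows "qL2 M (\<lambda>x. f x + g x)"
  unfolding qL2_def
proof (intro conjI)
  show m: "(\<lambda>x. f x + g x) \<in> borel_measurable M"
    using assms by (auto simp: qL2_def)
  have le: "(norm (p + q))\<^sup>2 \<le> 2 * (norm p)\<^sup>2 + 2 * (norm q)\<^sup>2" for p q :: quat
  proof -
    have "(norm (p + q))\<^sup>2 \<le> (norm p + norm q)\<^sup>2"
      by (intro power_mono norm_triangle_ineq) simp
    also have "\<dots> \<le> 2 * (norm p)\<^sup>2 + 2 * (norm q)\<^sup>2"
      using zero_le_power2[of "norm p - norm q"] by (simp add: power2_eq_square algebra_simps)
    finally show ?thesis .
  qed
  have "integrable M (\<lambda>x. 2 * (norm (f x))\<^sup>2 + 2 * (norm (g x))\<^sup>2)"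
    using assms by (auto simp: qL2_def)
  then show "integrable M (\<lambda>x. (norm (f x + g x))\<^sup>2)"
    by (rule Bochner_Integration.integrable_bound) (use le m in \<open>auto intro!: AE_I2\<close>)
qed

lemma qL2_mult_right: "qL2 M f \<Longrightarrow> qL2 M (\<lambda>x. f x * c)"
  by (auto simp: qL2_def norm_mult power_mult_distrib)

lemma qL2_diff: "qL2 M f \<Longrightarrow> qL2 M g \<Longrightarrow> qL2 M (\<lambda>x. f x - g x)"
  using qL2_add[of M f "\<lambda>x. g x * (-1)"] qL2_mult_right[of M g "-1"] by simp

lemma qL2_zero: "qL2 M (\<lambda>x. 0)"
  by (simp add: qL2_def)

lemma qL2_sum: "(\<And>i. i \<in> A \<Longrightarrow> qL2 M (f i)) \<Longrightarrow> qL2 M (\<lambda>x. \<Sum>i\<in>A. f i x)"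
  by (induction A rule: infinite_finite_induct) (auto intro: qL2_zero qL2_add)

lemma qinner_add_right:
  "qL2 M f \<Longrightarrow> qL2 M g \<Longrightarrow> qL2 M h \<Longrightarrow> qinner M f (\<lambda>x. g x + h x) = qinner M f g + qinner M f h"
  unfolding qinner_def by (subst Bochner_Integration.integral_add[symmetric]) (auto intro!: integrable_qinner simp: algebra_simps)

lemma qinner_diff_right:
  "qL2 M f \<Longrightarrow> qL2 M g \<Longrightarrow> qL2 M h \<Longrightarrow> qinner M f (\<lambda>x. g x - h x) = qinner M f g - qinner M f h"
  unfolding qinner_def by (subst Bochner_Integration.integral_diff[symmetric]) (auto intro!: integrable_qinner simp: algebra_simps)

lemma qinner_scale_right:
  "qL2 M f \<Longrightarrow> qL2 M g \<Longrightarrow> qinner M f (\<lambda>x. g x * c) = qinner M f g * c"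
  unfolding qinner_def mult.assoc[symmetric]
  by (rule Bochner_Integration.integral_mult_left) (rule integrable_qinner)

lemma qinner_sym: "qL2 M f \<Longrightarrow> qL2 M g \<Longrightarrow> qinner M g f = qcnj (qinner M f g)"
  unfolding qinner_def
  by (subst integral_bounded_linear[OF bounded_linear_qcnj, symmetric])
     (auto intro!: integrable_qinner simp: qcnj_mult)

lemma qinner_self: "qL2 M f \<Longrightarrow> qinner M f f = of_real (qsqnorm M f)"
  unfolding qinner_def qsqnorm_def qcnj_mult_self
  by (rule integral_bounded_linear[OF bounded_linear_of_real]) (simp add: qL2_def)

lemma qinner_scale_left:
  "qL2 M f \<Longrightarrow> qL2 M g \<Longrightarrow> qinner M (\<lambda>x. f x * c) g = qcnj c * qinner M f g"
  by (subst qinner_sym) (auto intro: qL2_mult_right simp: qinner_scale_right qcnj_mult qinner_sym[of M f g])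

lemma qsqnorm_nonneg: "0 \<le> qsqnorm M f"
  unfolding qsqnorm_def by simp

lemma qsqnorm_diff:
  assumes "qL2 M f" "qL2 M g"
  shows "qsqnorm M (\<lambda>x. f x - g x) = qsqnorm M f + qsqnorm M g - 2 * qRe (qinner M g f)"
proof -
  have *: "(norm (p - q))\<^sup>2 = (norm p)\<^sup>2 + (norm q)\<^sup>2 - 2 * qRe (qcnj q * p)" for p q :: quat
    by (simp add: norm_quat_squared quat_sel_mult) (simp add: power2_eq_square algebra_simps)
  have "qRe (qinner M g f) = (\<integral>x. qRe (qcnj (g x) * f x) \<partial>M)"
    unfolding qinner_def
    by (rule integral_bounded_linear[OF bounded_linear_qRe, symmetric]) (rule integrable_qinner[OF assms(2,1)])
  moreover have "integrable M (\<lambda>x. qRe (qcnj (g x) * f x))"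
    by (rule integrable_bounded_linear[OF bounded_linear_qRe integrable_qinner[OF assms(2,1)]])
  ultimately show ?thesis
    using assms unfolding qsqnorm_def * by (simp add: qL2_def)
qed

text \<open>Discriminant argument for the quadratic polynomial in \<open>s\<close> that arises by
  integrating \<open>(s * norm (f x) - norm (g x))\<^sup>2\<close>. Passing to norms first keeps all
  factors real.\<close>

lemma qinner_Cauchy_Schwarz:
  assumes "qL2 M f" "qL2 M g"
  shows "(norm (qinner M f g))\<^sup>2 \<le> qsqnorm M f * qsqnorm M g"
proof -
  define X where "X = (\<integral>x. norm (f x) * norm (g x) \<partial>M)"
  have "norm (qinner M f g) \<le> (\<integral>x. norm (qcnj (f x) * g x) \<partial>M)"
    unfolding qinner_def by (rule integral_norm_bound)
  then have le: "norm (qinner M f g) \<le> X"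
    by (simp add: X_def norm_mult)
  have quad: "0 \<le> s\<^sup>2 * qsqnorm M f - 2 * s * X + qsqnorm M g" for s
  proof -
    have "0 \<le> (\<integral>x. (s * norm (f x) - norm (g x))\<^sup>2 \<partial>M)"
      by simp
    also have "\<dots> = (\<integral>x. s\<^sup>2 * (norm (f x))\<^sup>2 - 2 * s * (norm (f x) * norm (g x)) + (norm (g x))\<^sup>2 \<partial>M)"
      by (intro Bochner_Integration.integral_cong) (auto simp: power2_eq_square algebra_simps)
    also have "\<dots> = s\<^sup>2 * qsqnorm M f - 2 * s * X + qsqnorm M g"
      unfolding qsqnorm_def X_def using assms integrable_norm_mult[OF assms]
      by (simp add: qL2_def)
    finally show ?thesis .
  qed
  have "X\<^sup>2 \<le> qsqnorm M f * qsqnorm M g"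
  proof (cases "qsqnorm M f = 0")
    case True
    have "X = 0"
    proof (rule ccontr)
      assume "X \<noteq> 0"
      then show False
        \<comment> \<open>The polynomial is affine here, and this \<open>s\<close> gives it the
          value -1.\<close>
        using quad[of "(qsqnorm M g + 1) / (2 * X)"] True by simp
    qed
    with True show ?thesis by simp
  next
    case False
    then have "qsqnorm M f > 0" using qsqnorm_nonneg[of M f] by simp
    \<comment> \<open>This \<open>s\<close> is the minimiser of the polynomial.\<close>
    moreover have "0 \<le> (X / qsqnorm M f)\<^sup>2 * qsqnorm M f - 2 * (X / qsqnorm M f) * X + qsqnorm M g"
      by (rule quad)
    ultimately show ?thesis
      by (simp add: power2_eq_square field_simps)
  qed
  moreover have "(norm (qinner M f g))\<^sup>2 \<le> X\<^sup>2"
    using le by (intro power_mono) auto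
  ultimately show ?thesis by simp
qed

lemma qinner_tendsto_zero:
  assumes "\<And>n. qL2 M (f n)" "qL2 M g" "(\<lambda>n. qsqnorm M (f n)) \<longlonglongrightarrow> 0"
  shows "(\<lambda>n. qinner M (f n) g) \<longlonglongrightarrow> 0"
proof -
  have "(\<lambda>n. (norm (qinner M (f n) g))\<^sup>2) \<longlonglongrightarrow> 0"
  proof (rule tendsto_sandwich[OF _ _ tendsto_const])
    show "(\<lambda>n. qsqnorm M (f n) * qsqnorm M g) \<longlonglongrightarrow> 0"
      using tendsto_mult_right[OF assms(3), of "qsqnorm M g"] by simp
  qed (use assms in \<open>auto intro!: always_eventually qinner_Cauchy_Schwarz\<close>)
  then have "(\<lambda>n. norm (qinner M (f n) g)) \<longlonglongrightarrow> 0"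
    using tendsto_real_sqrt by fastforce
  then show ?thesis by (rule tendsto_norm_zero_cancel)
qed

text \<open>Fatou's lemma yields membership and the bound at once, so nothing but measurability has
  to be known about the limit beforehand.\<close>

lemma qL2_Fatou:
  assumes g: "\<And>n. qL2 M (g n)" and h [measurable]: "h \<in> borel_measurable M"
    and lim: "AE x in M. (\<lambda>n. g n x) \<longlonglongrightarrow> h x" and B: "\<And>n. qsqnorm M (g n) \<le> B"
  shows "qL2 M h" "qsqnorm M h \<le> B"
proof -
  have [measurable]: "\<And>n. g n \<in> borel_measurable M" using g by (simp add: qL2_def)
  have "0 \<le> B" using B[of 0] qsqnorm_nonneg[of M "g 0"] by simp
  have "(\<integral>\<^sup>+x. ennreal ((norm (h x))\<^sup>2) \<partial>M) = (\<integral>\<^sup>+x. liminf (\<lambda>n. ennreal ((norm (g n x))\<^sup>2)) \<partial>M)"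
  proof (rule nn_integral_cong_AE)
    show "AE x in M. ennreal ((norm (h x))\<^sup>2) = liminf (\<lambda>n. ennreal ((norm (g n x))\<^sup>2))"
      using lim
    proof eventually_elim
      case (elim x)
      have "(\<lambda>n. ennreal ((norm (g n x))\<^sup>2)) \<longlonglongrightarrow> ennreal ((norm (h x))\<^sup>2)"
        by (intro tendsto_ennrealI tendsto_power tendsto_norm elim)
      then show ?case
        by (rule lim_imp_Liminf[OF trivial_limit_sequentially, symmetric])
    qed
  qed
  also have "\<dots> \<le> liminf (\<lambda>n. \<integral>\<^sup>+x. ennreal ((norm (g n x))\<^sup>2) \<partial>M)"
    by (rule nn_integral_liminf) measurable
  also have "\<dots> = liminf (\<lambda>n. ennreal (qsqnorm M (g n)))"
    using g unfolding qL2_def qsqnorm_def by (subst nn_integral_eq_integral) auto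
  also have "\<dots> \<le> liminf (\<lambda>n. ennreal B)"
    by (intro Liminf_mono always_eventually allI ennreal_leI B)
  also have "\<dots> = ennreal B"
    by (simp add: Liminf_const)
  finally have le: "(\<integral>\<^sup>+x. ennreal ((norm (h x))\<^sup>2) \<partial>M) \<le> ennreal B" .
  have int: "integrable M (\<lambda>x. (norm (h x))\<^sup>2)"
    by (rule integrableI_nonneg) (use le in \<open>auto simp: ennreal_less_top intro: le_less_trans\<close>)
  then show "qL2 M h" by (simp add: qL2_def)
  show "qsqnorm M h \<le> B"
    using le int \<open>0 \<le> B\<close> unfolding qsqnorm_def by (subst (asm) nn_integral_eq_integral) auto
qed

section \<open>Orthonormal sequences: Bessel, Riesz-Fischer, Parseval\<close>

locale orthonormal_sequence =
  fixes M :: "'a measure" and e :: "nat \<Rightarrow> 'a \<Rightarrow> quat"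
  assumes e_L2: "\<And>j. qL2 M (e j)"
    and e_orthonormal: "\<And>i j. qinner M (e i) (e j) = (if i = j then 1 else 0)"
begin

definition partial_sum :: "(nat \<Rightarrow> quat) \<Rightarrow> nat \<Rightarrow> 'a \<Rightarrow> quat" where
  "partial_sum a n x = (\<Sum>j<n. e j x * a j)"

lemma partial_sum_0: "partial_sum a 0 = (\<lambda>x. 0)"
  by (simp add: partial_sum_def fun_eq_iff)

lemma partial_sum_Suc: "partial_sum a (Suc n) = (\<lambda>x. partial_sum a n x + e n x * a n)"
  by (simp add: partial_sum_def fun_eq_iff)

lemma qL2_partial_sum: "qL2 M (partial_sum a n)"
  unfolding partial_sum_def by (intro qL2_sum qL2_mult_right e_L2)

lemma qinner_partial_sum: "qinner M (e i) (partial_sum a n) = (if i < n then a i else 0)"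
proof (induction n)
  case 0
  then show ?case by (simp add: partial_sum_0 qinner_def)
next
  case (Suc n)
  then show ?case
    unfolding partial_sum_Suc
    by (subst qinner_add_right)
      (auto simp: qinner_scale_right e_L2 qL2_partial_sum qL2_mult_right e_orthonormal less_Suc_eq)
qed

lemma qsqnorm_basis: "qsqnorm M (\<lambda>x. e n x * c) = (norm c)\<^sup>2"
proof -
  have "of_real (qsqnorm M (\<lambda>x. e n x * c)) = (of_real ((norm c)\<^sup>2) :: quat)"
    unfolding qinner_self[OF qL2_mult_right[OF e_L2], symmetric]
    by (simp add: qinner_scale_left qinner_scale_right e_L2 qL2_mult_right e_orthonormal qcnj_mult_self)
  then show ?thesis by (simp only: of_real_eq_iff)
qed

text \<open>With \<open>f = 0\<close> this also computes the norm of a partial sum.\<close>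

lemma qsqnorm_residual:
  assumes f: "qL2 M f"
  shows "qsqnorm M (\<lambda>x. f x - (partial_sum a (m + n) x - partial_sum a m x)) =
    qsqnorm M f + (\<Sum>j\<in>{m..<m+n}. (norm (a j))\<^sup>2 - 2 * qRe (qcnj (a j) * qinner M (e j) f))"
proof (induction n)
  case 0
  then show ?case by simp
next
  case (Suc n)
  let ?R = "\<lambda>x. f x - (partial_sum a (m + n) x - partial_sum a m x)"
  have R: "qL2 M ?R" by (intro qL2_diff f qL2_partial_sum)
  have "qsqnorm M (\<lambda>x. f x - (partial_sum a (m + Suc n) x - partial_sum a m x)) =
        qsqnorm M (\<lambda>x. ?R x - e (m + n) x * a (m + n))"
    by (rule arg_cong[where f = "qsqnorm M"]) (auto simp: partial_sum_Suc fun_eq_iff)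
  also have "\<dots> = qsqnorm M ?R + (norm (a (m+n)))\<^sup>2 - 2 * qRe (qcnj (a (m+n)) * qinner M (e (m+n)) ?R)"
    by (subst qsqnorm_diff[OF R qL2_mult_right[OF e_L2]])
      (simp add: qsqnorm_basis qinner_scale_left[OF e_L2 R])
  \<comment> \<open>\<open>e (m + n)\<close> is orthogonal to both partial sums, so the residual has
    the same coefficient as \<open>f\<close>.\<close>
  also have "qinner M (e (m+n)) ?R = qinner M (e (m+n)) f"
    by (simp add: qinner_diff_right e_L2 f qL2_diff qL2_partial_sum qinner_partial_sum)
  finally show ?case using Suc by simp
qed

lemma qsqnorm_partial_sum_diff:
  "qsqnorm M (\<lambda>x. partial_sum a (m + n) x - partial_sum a m x) = (\<Sum>j\<in>{m..<m+n}. (norm (a j))\<^sup>2)"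
proof -
  have "qsqnorm M (\<lambda>x. partial_sum a (m + n) x - partial_sum a m x) =
        qsqnorm M (\<lambda>x. 0 - (partial_sum a (m + n) x - partial_sum a m x))"
    unfolding qsqnorm_def by (simp add: norm_minus_commute)
  also have "\<dots> = (\<Sum>j\<in>{m..<m+n}. (norm (a j))\<^sup>2)"
    by (subst qsqnorm_residual[OF qL2_zero]) (simp add: qsqnorm_def qinner_def)
  finally show ?thesis .
qed

text \<open>For \<open>a j = qinner M (e j) f\<close> each summand of
  \<open>qsqnorm_residual\<close> collapses to \<open>- (norm (a j))\<^sup>2\<close>, and the left
  side there is nonnegative.\<close>

lemma Bessel_summable:
  assumes f: "qL2 M f"
  shows "summable (\<lambda>j. (norm (qinner M (e j) f))\<^sup>2)"
proof (rule bounded_imp_summable)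
  fix n
  let ?a = "\<lambda>j. qinner M (e j) f"
  have "0 \<le> qsqnorm M (\<lambda>x. f x - (partial_sum ?a (0 + Suc n) x - partial_sum ?a 0 x))"
    by (rule qsqnorm_nonneg)
  also have "\<dots> = qsqnorm M f - (\<Sum>j\<le>n. (norm (?a j))\<^sup>2)"
    unfolding qsqnorm_residual[OF f] qcnj_mult_self
    by (simp add: sum_negf lessThan_Suc_atMost atLeast0LessThan del: sum.lessThan_Suc of_real_power)
  finally show "(\<Sum>j\<le>n. (norm (?a j))\<^sup>2) \<le> qsqnorm M f" by simp
qed simp

text \<open>Pointwise convergence along a subsequence already forces convergence of the whole
  sequence in the mean, since Fatou bounds each residual by the tail of the coefficient series. A
  proper subsequence occurs in \<open>Riesz_Fischer\<close>, the identity in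
  \<open>slice_inner_sums\<close>.\<close>

lemma qL2_limit_of_partial_sums:
  assumes a: "summable (\<lambda>j. (norm (a j))\<^sup>2)" and r: "strict_mono r"
    and f [measurable]: "f \<in> borel_measurable M"
    and lim: "AE x in M. (\<lambda>i. partial_sum a (r i) x) \<longlonglongrightarrow> f x"
  shows "qL2 M f" "(\<lambda>n. qsqnorm M (\<lambda>x. f x - partial_sum a n x)) \<longlonglongrightarrow> 0"
proof -
  define tail where "tail n = (\<Sum>j. (norm (a j))\<^sup>2) - (\<Sum>j<n. (norm (a j))\<^sup>2)" for n
  have F: "qL2 M (\<lambda>x. f x - partial_sum a n x) \<and> qsqnorm M (\<lambda>x. f x - partial_sum a n x) \<le> tail n" for n
  proof -
    \<comment> \<open>The shift by \<open>n\<close> guarantees \<open>n \<le> r (i + n)\<close>, so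
      that \<open>?g i\<close> is a block of terms from index \<open>n\<close> on.\<close>
    let ?g = "\<lambda>i x. partial_sum a (r (i + n)) x - partial_sum a n x"
    have 1: "qL2 M (?g i)" for i
      by (intro qL2_diff qL2_partial_sum)
    have 2: "(\<lambda>x. f x - partial_sum a n x) \<in> borel_measurable M"
      using qL2_partial_sum[of a n] by (auto simp: qL2_def)
    have 3: "AE x in M. (\<lambda>i. ?g i x) \<longlonglongrightarrow> f x - partial_sum a n x"
      using lim
    proof eventually_elim
      case (elim x)
      show ?case by (intro tendsto_diff LIMSEQ_ignore_initial_segment[OF elim] tendsto_const)
    qed
    have 4: "qsqnorm M (?g i) \<le> tail n" for i
    proof -
      have "n \<le> r (i + n)"
        using strict_mono_imp_increasing[OF r, of "i + n"] by simp
      then obtain d where d: "r (i + n) = n + d" using le_Suc_ex by blast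
      have "(\<Sum>j<n. (norm (a j))\<^sup>2) + (\<Sum>j\<in>{n..<n+d}. (norm (a j))\<^sup>2) = (\<Sum>j<n+d. (norm (a j))\<^sup>2)"
        using sum.atLeastLessThan_concat[of 0 n "n + d" "\<lambda>j. (norm (a j))\<^sup>2"] by (simp add: atLeast0LessThan)
      moreover have "(\<Sum>j<n+d. (norm (a j))\<^sup>2) \<le> (\<Sum>j. (norm (a j))\<^sup>2)"
        by (rule sum_le_suminf[OF a]) auto
      ultimately show ?thesis
        unfolding d qsqnorm_partial_sum_diff tail_def by simp
    qed
    show ?thesis
      using qL2_Fatou[OF 1 2 3 4] by blast
  qed
  show "qL2 M f" using F[of 0] by (simp add: partial_sum_0)
  have "tail \<longlonglongrightarrow> (\<Sum>j. (norm (a j))\<^sup>2) - (\<Sum>j. (norm (a j))\<^sup>2)"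
    unfolding tail_def by (intro tendsto_diff tendsto_const summable_LIMSEQ a)
  then have "tail \<longlonglongrightarrow> 0" by simp
  then show "(\<lambda>n. qsqnorm M (\<lambda>x. f x - partial_sum a n x)) \<longlonglongrightarrow> 0"
    by (rule tendsto_sandwich[OF _ _ tendsto_const, rotated 2])
      (use F in \<open>auto simp: qsqnorm_nonneg\<close>)
qed

text \<open>Along a sparse subsequence the blocks are so small that the partial sums converge almost
  everywhere; the preceding lemma turns that limit into a limit in the mean.\<close>

theorem Riesz_Fischer:
  assumes a: "summable (\<lambda>j. (norm (a j))\<^sup>2)"
  obtains f where "qL2 M f" "(\<lambda>n. qsqnorm M (\<lambda>x. f x - partial_sum a n x)) \<longlonglongrightarrow> 0"
proof -
  \<comment> \<open>Squared norms below \<open>(1/4)^i\<close> leave room for the weight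
    \<open>2^i\<close> used below: the weighted series is still dominated by a geometric
    one.\<close>
  have "\<exists>N. \<forall>m\<ge>N. \<forall>n. (\<Sum>j\<in>{m..<n}. (norm (a j))\<^sup>2) < (1/4)^i" for i :: nat
    using a[unfolded summable_Cauchy, rule_format, of "(1/4)^i"] by (auto simp: abs_less_iff)
  then obtain N where N: "\<And>i m n. m \<ge> N i \<Longrightarrow> (\<Sum>j\<in>{m..<n}. (norm (a j))\<^sup>2) < (1/4)^i"
    by metis
  \<comment> \<open>Summing the successors makes \<open>r\<close> strictly increasing while staying
    above \<open>N\<close>.\<close>
  define r where "r i = (\<Sum>m\<le>i. Suc (N m))" for i
  have r: "strict_mono r"
    unfolding strict_mono_Suc_iff r_def by simp
  have rN: "N i \<le> r i" for i
    unfolding r_def by (cases i) auto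
  define D where "D i x = partial_sum a (r (Suc i)) x - partial_sum a (r i) x" for i x
  have D_L2: "qL2 M (D i)" for i
    unfolding D_def by (intro qL2_diff qL2_partial_sum)
  have [measurable]: "D i \<in> borel_measurable M" "partial_sum a i \<in> borel_measurable M" for i
    using D_L2 qL2_partial_sum by (auto simp: qL2_def)
  have D: "qsqnorm M (D i) \<le> (1/4)^i" for i
  proof -
    obtain d where d: "r (Suc i) = r i + d"
      using le_Suc_ex strict_mono_leD[OF r, of i "Suc i"] by auto
    show ?thesis
      unfolding D_def d qsqnorm_partial_sum_diff using N[OF rN] less_imp_le by blast
  qed
  have "(\<integral>\<^sup>+x. (\<Sum>i. ennreal (2^i * (norm (D i x))\<^sup>2)) \<partial>M) = (\<Sum>i. \<integral>\<^sup>+x. ennreal (2^i * (norm (D i x))\<^sup>2) \<partial>M)"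
    by (rule nn_integral_suminf) measurable
  also have "\<dots> = (\<Sum>i. ennreal (2^i * qsqnorm M (D i)))"
    using D_L2 unfolding qL2_def qsqnorm_def by (subst nn_integral_eq_integral) auto
  also have "\<dots> \<le> (\<Sum>i. ennreal ((1/2)^i))"
  proof (intro suminf_le summableI ennreal_leI)
    fix i
    have "2 ^ i * qsqnorm M (D i) \<le> 2 ^ i * (1/4)^i" by (intro mult_left_mono D) simp
    also have "\<dots> = (1/2)^i" by (simp add: power_mult_distrib[symmetric])
    finally show "2 ^ i * qsqnorm M (D i) \<le> (1/2)^i" .
  qed
  also have "\<dots> = ennreal (\<Sum>i. (1/2)^i)"
    by (rule suminf_ennreal2) (auto intro: summable_geometric)
  also have "\<dots> < \<infinity>" by simp
  finally have "AE x in M. (\<Sum>i. ennreal (2^i * (norm (D i x))\<^sup>2)) \<noteq> \<infinity>"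
    by (intro nn_integral_PInf_AE) auto
  then have lim: "AE x in M. (\<lambda>i. partial_sum a (r i) x) \<longlonglongrightarrow> lim (\<lambda>i. partial_sum a (r i) x)"
  proof eventually_elim
    case (elim x)
    have s: "summable (\<lambda>i. 2^i * (norm (D i x))\<^sup>2)"
      by (rule summable_suminf_not_top) (use elim in auto)
    \<comment> \<open>Either the norm is at most \<open>(1/2)^i\<close>, or
      \<open>2^i * norm (D i x)\<close> is at least 1 and one more factor costs nothing. Summability
      of weighted squares thus becomes absolute summability.\<close>
    have le: "norm (D i x) \<le> (1/2)^i + 2^i * (norm (D i x))\<^sup>2" for i
    proof (cases "norm (D i x) \<le> (1/2)^i")
      case True
      then show ?thesis by (auto intro: add_increasing2)
    next
      case False
      then have "1 \<le> 2^i * norm (D i x)" by (simp add: field_simps)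
      then have "1 * norm (D i x) \<le> (2^i * norm (D i x)) * norm (D i x)"
        by (intro mult_right_mono) auto
      then have "norm (D i x) \<le> 2^i * (norm (D i x))\<^sup>2"
        by (simp add: power2_eq_square mult.assoc)
      then show ?thesis by (auto intro: add_increasing)
    qed
    have "summable (\<lambda>i. (1/2)^i + 2^i * (norm (D i x))\<^sup>2)"
      by (intro summable_add s summable_geometric) simp
    then have "summable (\<lambda>i. D i x)"
      by (rule summable_comparison_test') (rule le)
    then have "(\<lambda>n. \<Sum>i<n. D i x) \<longlonglongrightarrow> (\<Sum>i. D i x)"
      by (rule summable_LIMSEQ)
    moreover have "(\<Sum>i<n. D i x) = partial_sum a (r n) x - partial_sum a (r 0) x" for n
      unfolding D_def by (rule sum_lessThan_telescope)
    ultimately have "(\<lambda>n. partial_sum a (r n) x - partial_sum a (r 0) x + partial_sum a (r 0) x)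
        \<longlonglongrightarrow> (\<Sum>i. D i x) + partial_sum a (r 0) x"
      by (intro tendsto_add tendsto_const) simp
    then show ?case
      unfolding convergent_LIMSEQ_iff[symmetric] by (auto simp: convergent_def)
  qed
  \<comment> \<open>As \<open>lim\<close> is total, this candidate is measurable on the whole space,
    including the null set without convergence.\<close>
  have "(\<lambda>x. lim (\<lambda>i. partial_sum a (r i) x)) \<in> borel_measurable M"
    by measurable
  from qL2_limit_of_partial_sums[OF a r this lim] show ?thesis by (rule that)
qed

text \<open>The error after \<open>n\<close> terms is the inner product of the residual of
  \<open>f\<close> with \<open>g\<close>, which vanishes in the limit by Cauchy-Schwarz. Asking
  \<open>f\<close> to be a limit of partial sums, instead of asking for completeness, is what makes
  this applicable on slices.\<close>

lemma Parseval_sums: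
  assumes f: "qL2 M f" and lim: "(\<lambda>n. qsqnorm M (\<lambda>x. f x - partial_sum a n x)) \<longlonglongrightarrow> 0"
    and g: "qL2 M g"
  shows "(\<lambda>j. qcnj (a j) * qinner M (e j) g) sums qinner M f g"
proof -
  have "qinner M (\<lambda>x. f x - partial_sum a n x) g = qinner M f g - qinner M (partial_sum a n) g" for n
    by (simp add: qinner_sym[OF g] f qL2_diff qL2_partial_sum qinner_diff_right g qcnj_diff)
  moreover have "qinner M (partial_sum a n) g = (\<Sum>j<n. qcnj (a j) * qinner M (e j) g)" for n
  proof (induction n)
    case 0
    then show ?case by (simp add: partial_sum_0 qinner_def)
  next
    case (Suc n)
    have "qinner M (partial_sum a (Suc n)) g = qcnj (qinner M g (partial_sum a n) + qinner M g (\<lambda>x. e n x * a n))"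
      unfolding partial_sum_Suc
      by (subst qinner_sym[OF g]) (auto simp: qinner_add_right g e_L2 qL2_partial_sum qL2_mult_right qL2_add)
    also have "\<dots> = qinner M (partial_sum a n) g + qinner M (\<lambda>x. e n x * a n) g"
      by (simp add: qcnj_add qinner_sym[OF g] e_L2 qL2_partial_sum qL2_mult_right)
    finally show ?case using Suc by (simp add: qinner_scale_left e_L2 g)
  qed
  ultimately have "(\<lambda>n. qinner M f g - (\<Sum>j<n. qcnj (a j) * qinner M (e j) g)) \<longlonglongrightarrow> 0"
    using qinner_tendsto_zero[OF _ g lim] by (simp add: f qL2_diff qL2_partial_sum)
  from tendsto_diff[OF tendsto_const[of "qinner M f g"] this] show ?thesis
    by (simp add: sums_def)
qed

text \<open>Parseval against \<open>e j\<close>, where a single term survives.\<close>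

lemma coefficient_unique:
  assumes f: "qL2 M f" and lim: "(\<lambda>n. qsqnorm M (\<lambda>x. f x - partial_sum a n x)) \<longlonglongrightarrow> 0"
  shows "qinner M (e j) f = a j"
proof -
  have "(\<lambda>i. qcnj (a i) * qinner M (e i) (e j)) sums qinner M f (e j)"
    by (rule Parseval_sums[OF f lim e_L2])
  moreover have "(\<lambda>i. qcnj (a i) * qinner M (e i) (e j)) sums (qcnj (a j))"
    using sums_single[of j "\<lambda>i. qcnj (a i)"] by (rule sums_cong[THEN iffD1, rotated]) (simp add: e_orthonormal)
  ultimately have "qinner M f (e j) = qcnj (a j)" by (rule sums_unique2)
  then show ?thesis by (simp add: qinner_sym[OF f e_L2])
qed

text \<open>The function and the Riesz-Fischer sum of its coefficients have equal coefficients, so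
  completeness identifies them. Completeness is a hypothesis here and not a locale axiom, because
  for fixed \<open>k\<close> the slice system \<open>weighted_hermite k\<close> is not
  complete.\<close>

lemma expansion_if_complete:
  assumes complete: "\<And>g. qL2 M g \<Longrightarrow> (\<And>j. qinner M (e j) g = 0) \<Longrightarrow> AE x in M. g x = 0"
    and f: "qL2 M f"
  shows "(\<lambda>n. qsqnorm M (\<lambda>x. f x - partial_sum (\<lambda>j. qinner M (e j) f) n x)) \<longlonglongrightarrow> 0"
proof -
  let ?a = "\<lambda>j. qinner M (e j) f"
  obtain g where g: "qL2 M g" "(\<lambda>n. qsqnorm M (\<lambda>x. g x - partial_sum ?a n x)) \<longlonglongrightarrow> 0"
    using Riesz_Fischer[OF Bessel_summable[OF f]] by blast
  have "AE x in M. f x - g x = 0"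
    by (rule complete) (auto simp: f g qL2_diff qinner_diff_right e_L2 coefficient_unique[OF g])
  then have "AE x in M. (norm (g x - partial_sum ?a n x))\<^sup>2 = (norm (f x - partial_sum ?a n x))\<^sup>2" for n
    by eventually_elim simp
  then have "qsqnorm M (\<lambda>x. g x - partial_sum ?a n x) = qsqnorm M (\<lambda>x. f x - partial_sum ?a n x)" for n
    unfolding qsqnorm_def using f g(1) qL2_partial_sum[of ?a n]
    by (intro integral_cong_AE) (auto simp: qL2_def)
  with g(2) show ?thesis by simp
qed

end

section \<open>Gaussian integrals and Hermite polynomials on the real line\<close>

text \<open>At most exponential growth: a class stable under the ring operations that contains the
  Hermite polynomials and the exponential kernel and is still dominated by the Gaussian.
  Integrability and vanishing boundary terms thereby become syntactic, via
  \<open>exp_bounded_intros\<close>.\<close>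

definition exp_bounded :: "('a::real_normed_vector \<Rightarrow> 'b::real_normed_vector) \<Rightarrow> bool" where
  "exp_bounded f \<longleftrightarrow> (\<exists>C c. \<forall>x. norm (f x) \<le> C * exp (c * norm x))"

lemma exp_boundedE:
  assumes "exp_bounded f"
  obtains C c where "C \<ge> 0" "c \<ge> 0" "\<And>x. norm (f x) \<le> C * exp (c * norm x)"
proof -
  from assms obtain C c where *: "\<And>x. norm (f x) \<le> C * exp (c * norm x)"
    by (auto simp: exp_bounded_def)
  have "norm (f x) \<le> \<bar>C\<bar> * exp (\<bar>c\<bar> * norm x)" for x
    by (rule order_trans[OF *]) (auto intro!: mult_mono mult_right_mono)
  then show ?thesis by (intro that[of "\<bar>C\<bar>" "\<bar>c\<bar>"]) auto
qed

lemma exp_boundedI: "(\<And>x. norm (f x) \<le> C * exp (c * norm x)) \<Longrightarrow> exp_bounded f"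
  by (auto simp: exp_bounded_def)

named_theorems exp_bounded_intros

lemma exp_bounded_const [exp_bounded_intros]: "exp_bounded (\<lambda>x. k)"
  by (rule exp_boundedI[of _ "norm k" 0]) simp

lemma exp_bounded_norm_le:
  assumes "exp_bounded f" "\<And>x. norm (g x) \<le> norm (f x)"
  shows "exp_bounded g"
  using assms unfolding exp_bounded_def by (meson order_trans)

lemma exp_bounded_ident [exp_bounded_intros]: "exp_bounded (\<lambda>x. x)"
proof (rule exp_boundedI[of _ 1 1])
  show "norm x \<le> 1 * exp (1 * norm x)" for x :: 'a
    using exp_ge_add_one_self[of "norm x"] unfolding mult_1 by linarith
qed

lemma exp_bounded_add [exp_bounded_intros]:
  assumes "exp_bounded f" "exp_bounded g"
  shows "exp_bounded (\<lambda>x. f x + g x)"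
proof -
  obtain C c where 1: "C \<ge> 0" "c \<ge> 0" "\<And>x. norm (f x) \<le> C * exp (c * norm x)"
    using exp_boundedE[OF assms(1)] by blast
  obtain D d where 2: "D \<ge> 0" "d \<ge> 0" "\<And>x. norm (g x) \<le> D * exp (d * norm x)"
    using exp_boundedE[OF assms(2)] by blast
  show ?thesis
  proof (rule exp_boundedI)
    fix x
    have "norm (f x + g x) \<le> C * exp (c * norm x) + D * exp (d * norm x)"
      by (rule norm_triangle_le) (intro add_mono 1 2)
    also have "\<dots> \<le> C * exp ((c + d) * norm x) + D * exp ((c + d) * norm x)"
      using 1 2 by (intro add_mono mult_left_mono) (auto intro!: mult_right_mono)
    finally show "norm (f x + g x) \<le> (C + D) * exp ((c + d) * norm x)"
      by (simp add: algebra_simps)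
  qed
qed

lemma exp_bounded_mult [exp_bounded_intros]:
  fixes f g :: "'a::real_normed_vector \<Rightarrow> 'b::real_normed_algebra"
  assumes "exp_bounded f" "exp_bounded g"
  shows "exp_bounded (\<lambda>x. f x * g x)"
proof -
  obtain C c where 1: "C \<ge> 0" "c \<ge> 0" "\<And>x. norm (f x) \<le> C * exp (c * norm x)"
    using exp_boundedE[OF assms(1)] by blast
  obtain D d where 2: "D \<ge> 0" "d \<ge> 0" "\<And>x. norm (g x) \<le> D * exp (d * norm x)"
    using exp_boundedE[OF assms(2)] by blast
  show ?thesis
  proof (rule exp_boundedI)
    fix x
    have "norm (f x * g x) \<le> norm (f x) * norm (g x)"
      by (rule norm_mult_ineq)
    also have "\<dots> \<le> (C * exp (c * norm x)) * (D * exp (d * norm x))"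
      by (intro mult_mono 1 2) (auto simp: 1)
    finally show "norm (f x * g x) \<le> (C * D) * exp ((c + d) * norm x)"
      by (simp add: algebra_simps exp_add)
  qed
qed

lemma exp_bounded_minus [exp_bounded_intros]: "exp_bounded f \<Longrightarrow> exp_bounded (\<lambda>x. - f x)"
  by (simp add: exp_bounded_def)

lemma exp_bounded_diff [exp_bounded_intros]:
  "exp_bounded f \<Longrightarrow> exp_bounded g \<Longrightarrow> exp_bounded (\<lambda>x. f x - g x)"
  using exp_bounded_add[of f "\<lambda>x. - g x"] exp_bounded_minus[of g] by simp

lemma exp_bounded_power [exp_bounded_intros]:
  "exp_bounded f \<Longrightarrow> exp_bounded (\<lambda>x. f x ^ n)" for f :: "'a::real_normed_vector \<Rightarrow> 'b::real_normed_algebra_1"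
  by (induction n) (auto intro: exp_bounded_intros)

lemma exp_bounded_norm [exp_bounded_intros]: "exp_bounded f \<Longrightarrow> exp_bounded (\<lambda>x. norm (f x))"
  by (simp add: exp_bounded_def)

lemma exp_bounded_of_real [exp_bounded_intros]:
  "exp_bounded f \<Longrightarrow> exp_bounded (\<lambda>x. of_real (f x) :: 'b::real_normed_algebra_1)"
  by (simp add: exp_bounded_def)

lemma exp_bounded_exp [exp_bounded_intros]:
  "exp_bounded (\<lambda>x. exp (a * x) :: 'a::{real_normed_algebra_1,banach})"
proof (rule exp_boundedI[of _ 1 "norm a"])
  fix x :: 'a
  have "norm (exp (a * x)) \<le> exp (norm (a * x))" by (rule norm_exp)
  also have "\<dots> \<le> exp (norm a * norm x)" by (simp add: norm_mult_ineq)
  finally show "norm (exp (a * x)) \<le> 1 * exp (norm a * norm x)" by simp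
qed

lemma exp_bounded_reflect [exp_bounded_intros]:
  assumes "exp_bounded f"
  shows "exp_bounded (\<lambda>x. f (a - x))"
proof -
  obtain C c where 1: "C \<ge> 0" "c \<ge> 0" "\<And>x. norm (f x) \<le> C * exp (c * norm x)"
    using exp_boundedE[OF assms] by blast
  show ?thesis
  proof (rule exp_boundedI)
    fix x
    have "norm (f (a - x)) \<le> C * exp (c * norm (a - x))" by (rule 1)
    also have "\<dots> \<le> C * exp (c * (norm a + norm x))"
      using 1 by (intro mult_left_mono) (auto intro!: mult_left_mono norm_triangle_ineq4)
    finally show "norm (f (a - x)) \<le> (C * exp (c * norm a)) * exp (c * norm x)"
      by (simp add: algebra_simps exp_add)
  qed
qed

lemma exp_bounded_compose_of_real [exp_bounded_intros]:
  fixes f :: "'a::real_normed_algebra_1 \<Rightarrow> 'b::real_normed_vector"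
  assumes "exp_bounded f"
  shows "exp_bounded (\<lambda>x. f (of_real x))"
proof -
  obtain C c where 1: "\<And>x. norm (f x) \<le> C * exp (c * norm x)"
    using exp_boundedE[OF assms] by blast
  show ?thesis
    by (rule exp_boundedI[of _ C c]) (use 1[of "of_real x" for x] in simp)
qed

text \<open>Completing the square spends half of the Gaussian on the exponential and keeps the other
  half for integrability.\<close>

lemma gauss_exp_le: "exp (- t\<^sup>2) * exp (c * \<bar>t\<bar>) \<le> exp (c\<^sup>2 / 2) * exp (- t\<^sup>2 / 2)" for t c :: real
proof -
  have "- t\<^sup>2 + c * \<bar>t\<bar> \<le> c\<^sup>2 / 2 + (- t\<^sup>2 / 2)"
    using sum_squares_bound[of c "\<bar>t\<bar>"] by simp
  then show ?thesis by (simp flip: exp_add)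
qed

lemma integrable_half_gauss: "integrable lborel (\<lambda>t::real. exp (- t\<^sup>2 / 2))"
proof -
  have "integrable lborel (\<lambda>t. sqrt (2 * pi) * std_normal_density t)"
    by (intro integrable_mult_right integrable_normal_density) simp
  then show ?thesis by (simp add: std_normal_density_def)
qed

lemma integrable_gauss:
  fixes f :: "real \<Rightarrow> 'a::{banach, second_countable_topology}"
  assumes "exp_bounded f" and [measurable]: "f \<in> borel_measurable borel"
  shows "integrable lborel (\<lambda>t. exp (- t\<^sup>2) *\<^sub>R f t)"
proof -
  obtain C c where 1: "C \<ge> 0" "c \<ge> 0" "\<And>x. norm (f x) \<le> C * exp (c * norm x)"
    using exp_boundedE[OF assms(1)] by blast
  show ?thesis
  proof (rule Bochner_Integration.integrable_bound)
    show "integrable lborel (\<lambda>t. (C * exp (c\<^sup>2 / 2)) * exp (- t\<^sup>2 / 2))"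
      by (intro integrable_mult_right integrable_half_gauss)
    have "norm (exp (- t\<^sup>2) *\<^sub>R f t) \<le> norm (C * exp (c\<^sup>2 / 2) * exp (- t\<^sup>2 / 2))" for t
    proof -
      have "exp (- t\<^sup>2) * norm (f t) \<le> exp (- t\<^sup>2) * (C * exp (c * \<bar>t\<bar>))"
        using 1(3)[of t] by (intro mult_left_mono) auto
      also have "\<dots> \<le> C * (exp (c\<^sup>2 / 2) * exp (- t\<^sup>2 / 2))"
        using mult_left_mono[OF gauss_exp_le[of t c] 1(1)] by (simp add: mult_ac)
      finally show ?thesis using 1(1) by (simp add: mult_ac)
    qed
    then show "AE t in lborel. norm (exp (- t\<^sup>2) *\<^sub>R f t) \<le> norm (C * exp (c\<^sup>2 / 2) * exp (- t\<^sup>2 / 2))"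
      by simp
  qed simp
qed

lemma half_gauss_tendsto_0:
  "((\<lambda>t::real. exp (- t\<^sup>2 / 2)) \<longlongrightarrow> 0) at_top" "((\<lambda>t::real. exp (- t\<^sup>2 / 2)) \<longlongrightarrow> 0) at_bot"
proof -
  show *: "((\<lambda>t::real. exp (- t\<^sup>2 / 2)) \<longlongrightarrow> 0) at_top"
    by real_asymp
  show "((\<lambda>t::real. exp (- t\<^sup>2 / 2)) \<longlongrightarrow> 0) at_bot"
    unfolding filterlim_at_bot_mirror using * by simp
qed

lemma gauss_times_exp_bounded_tendsto_0:
  assumes "exp_bounded f"
  shows "((\<lambda>t. exp (- t\<^sup>2) *\<^sub>R f t) \<longlongrightarrow> 0) at_top" "((\<lambda>t. exp (- t\<^sup>2) *\<^sub>R f t) \<longlongrightarrow> 0) at_bot"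
proof -
  obtain C c where 1: "C \<ge> 0" "c \<ge> 0" "\<And>x. norm (f x) \<le> C * exp (c * norm x)"
    using exp_boundedE[OF assms(1)] by blast
  have le: "norm (exp (- t\<^sup>2) *\<^sub>R f t) \<le> exp (- t\<^sup>2 / 2) * (C * exp (c\<^sup>2 / 2))" for t
  proof -
    have "exp (- t\<^sup>2) * norm (f t) \<le> exp (- t\<^sup>2) * (C * exp (c * \<bar>t\<bar>))"
      using 1(3)[of t] by (intro mult_left_mono) auto
    also have "\<dots> \<le> C * (exp (c\<^sup>2 / 2) * exp (- t\<^sup>2 / 2))"
      using mult_left_mono[OF gauss_exp_le[of t c] 1(1)] by (simp add: mult_ac)
    finally show ?thesis using 1(1) by (simp add: mult_ac)
  qed
  show "((\<lambda>t. exp (- t\<^sup>2) *\<^sub>R f t) \<longlongrightarrow> 0) at_top"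
    by (rule tendsto_0_le[OF half_gauss_tendsto_0(1), where K = "C * exp (c\<^sup>2 / 2)"]) (use le in auto)
  show "((\<lambda>t. exp (- t\<^sup>2) *\<^sub>R f t) \<longlongrightarrow> 0) at_bot"
    by (rule tendsto_0_le[OF half_gauss_tendsto_0(2), where K = "C * exp (c\<^sup>2 / 2)"]) (use le in auto)
qed

text \<open>The integrand is the derivative of \<open>exp (- t\<^sup>2) *\<^sub>R G t\<close>, which
  tends to 0 at both ends.\<close>

lemma gauss_integration_by_parts:
  fixes G :: "real \<Rightarrow> 'a::euclidean_space"
  assumes G: "exp_bounded G" and G': "exp_bounded G'" "continuous_on UNIV G'"
    and deriv: "\<And>t. (G has_vector_derivative G' t) (at t)"
  shows "(\<integral>t. exp (- t\<^sup>2) *\<^sub>R (G' t - (2 * t) *\<^sub>R G t) \<partial>lborel) = 0"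
proof -
  let ?F = "\<lambda>t. exp (- t\<^sup>2) *\<^sub>R G t" and ?f = "\<lambda>t. exp (- t\<^sup>2) *\<^sub>R (G' t - (2 * t) *\<^sub>R G t)"
  have contG: "continuous_on UNIV G"
    using deriv by (intro continuous_at_imp_continuous_on ballI has_vector_derivative_continuous)
  have cont: "continuous_on UNIV ?f"
    by (intro continuous_intros G' contG)
  have "exp_bounded (\<lambda>t. (2 * t) *\<^sub>R G t)"
  proof -
    have "exp_bounded (\<lambda>t. (2 * t) * norm (G t))"
      by (intro exp_bounded_intros G)
    then show ?thesis by (rule exp_bounded_norm_le) (simp add: abs_mult)
  qed
  then have int: "integrable lborel ?f"
    by (intro integrable_gauss exp_bounded_intros G' borel_measurable_continuous_onI continuous_intros contG)
  have "(LBINT x=-\<infinity>..\<infinity>. ?f x) = 0 - 0"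
  proof (rule interval_integral_FTC_integrable)
    show "(?F has_vector_derivative ?f x) (at x)" for x
      by (auto intro!: derivative_eq_intros deriv simp: algebra_simps)
    show "isCont ?f x" for x
      using cont by (simp add: continuous_on_eq_continuous_at)
    show "set_integrable lborel (einterval (- \<infinity>) \<infinity>) ?f"
      using int by (simp add: set_integrable_def)
    show "((?F \<circ> real_of_ereal) \<longlongrightarrow> 0) (at_right (- \<infinity>))" "((?F \<circ> real_of_ereal) \<longlongrightarrow> 0) (at_left \<infinity>)"
      using gauss_times_exp_bounded_tendsto_0[OF G] by (simp_all only: ereal_tendsto_simps1)
  qed simp
  then show ?thesis
    by (simp add: interval_lebesgue_integral_def set_lebesgue_integral_def)
qed

text \<open>The recursion is what one differentiation does to the polynomial factor in the Rodrigues
  formula, with the sign absorbed.\<close>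

primrec hermite_poly :: "nat \<Rightarrow> real poly" where
  "hermite_poly 0 = 1"
| "hermite_poly (Suc n) = [:0, 2:] * hermite_poly n - pderiv (hermite_poly n)"

lemma hermite_eq_poly: "hermite n t = poly (hermite_poly n) t"
proof -
  have "(deriv ^^ n) (\<lambda>s. exp (- s\<^sup>2)) = (\<lambda>s. (-1) ^ n * poly (hermite_poly n) s * exp (- s\<^sup>2))"
  proof (induction n)
    case 0
    show ?case by simp
  next
    case (Suc n)
    have "deriv (\<lambda>s. (-1) ^ n * poly (hermite_poly n) s * exp (- s\<^sup>2)) x
        = (-1) ^ Suc n * poly (hermite_poly (Suc n)) x * exp (- x\<^sup>2)" for x
      by (rule DERIV_imp_deriv)
        (auto intro!: derivative_eq_intros poly_DERIV simp: algebra_simps)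
    then show ?case by (simp only: funpow.simps o_def Suc.IH)
  qed
  moreover have "(-1) ^ n * ((-1) ^ n * x) = x" for x :: real
    by (simp flip: mult.assoc power_mult_distrib)
  moreover have "exp (t\<^sup>2) * exp (- t\<^sup>2) = 1"
    by (simp flip: exp_add)
  ultimately show ?thesis
    by (simp add: hermite_def mult_ac)
qed

text \<open>Differentiating the recursion leaves the derivatives of \<open>hermite_poly n\<close>;
  the induction hypothesis writes them through index \<open>n - 1\<close>, where they reassemble to
  a multiple of \<open>hermite_poly n\<close>.\<close>

lemma pderiv_hermite_poly: "pderiv (hermite_poly n) = smult (of_nat (2 * n)) (hermite_poly (n - 1))"
proof (induction n)
  case 0
  show ?case by (simp add: pderiv_1)
next
  case (Suc n)
  show ?case
  proof (cases n)
    case 0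
    then show ?thesis by (simp add: pderiv_pCons)
  next
    case (Suc m)
    have "pderiv (hermite_poly (Suc n)) = smult 2 (hermite_poly n)
        + [:0, 2:] * pderiv (hermite_poly n) - pderiv (pderiv (hermite_poly n))"
      by (simp add: pderiv_diff pderiv_mult pderiv_pCons pderiv_smult algebra_simps)
    also have "\<dots> = smult 2 (hermite_poly n)
        + smult (of_nat (2 * n)) ([:0, 2:] * hermite_poly m - pderiv (hermite_poly m))"
      unfolding Suc.IH by (simp add: Suc pderiv_smult smult_diff_right algebra_simps)
    also have "\<dots> = smult (of_nat (2 * Suc n)) (hermite_poly n)"
      unfolding hermite_poly.simps(2)[of m, folded Suc, symmetric] smult_add_left[symmetric] by simp
    finally show ?thesis by simp
  qed
qed

lemma hermite_0 [simp]: "hermite 0 t = 1"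
  by (simp add: hermite_eq_poly)

text \<open>At \<open>n = 0\<close> the truncated index \<open>n - 1\<close> is cancelled by its
  factor \<open>real n\<close>; all recurrences below rely on the same convention.\<close>

lemma hermite_Suc: "hermite (Suc n) t = 2 * t * hermite n t - 2 * real n * hermite (n - 1) t"
  by (simp add: hermite_eq_poly pderiv_hermite_poly)

lemma DERIV_hermite [derivative_intros]:
  "(hermite n has_real_derivative 2 * real n * hermite (n - 1) t) (at t)"
proof -
  have "(poly (hermite_poly n) has_real_derivative poly (pderiv (hermite_poly n)) t) (at t)"
    by (rule poly_DERIV)
  then show ?thesis
    by (simp add: pderiv_hermite_poly hermite_eq_poly[abs_def])
qed

lemma exp_bounded_hermite [exp_bounded_intros]: "exp_bounded (hermite n)"
proof (induction n rule: less_induct)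
  case (less n)
  show ?case
  proof (cases n)
    case 0
    then have "hermite n = (\<lambda>t. 1)" by auto
    then show ?thesis by (simp add: exp_bounded_intros)
  next
    case (Suc m)
    then have "exp_bounded (hermite m)" "exp_bounded (hermite (m - 1))"
      using less by auto
    moreover have "hermite n = (\<lambda>t. 2 * t * hermite m t - 2 * real m * hermite (m - 1) t)"
      by (auto simp: Suc hermite_Suc)
    ultimately show ?thesis by (simp only:) (intro exp_bounded_intros)
  qed
qed

lemma hermite_has_vector_derivative:
  "((\<lambda>t. complex_of_real (hermite n t)) has_vector_derivative complex_of_real (2 * real n * hermite (n - 1) t)) (at t)"
  by (intro has_vector_derivative_of_real) (rule DERIV_hermite)

lemma continuous_on_hermite [continuous_intros]:
  "continuous_on A f \<Longrightarrow> continuous_on A (\<lambda>x. hermite n (f x))"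
  by (rule continuous_on_compose2[OF continuous_hermite]) auto

definition gauss_integral :: "(real \<Rightarrow> complex) \<Rightarrow> complex" where
  "gauss_integral f = (\<integral>t. exp (- t\<^sup>2) *\<^sub>R f t \<partial>lborel)"

lemma gauss_integral_mult: "gauss_integral (\<lambda>t. c * f t) = c * gauss_integral f"
  unfolding gauss_integral_def by (simp flip: mult_scaleR_right)

lemma gauss_integral_diff:
  assumes "exp_bounded f" "exp_bounded g" "continuous_on UNIV f" "continuous_on UNIV g"
  shows "gauss_integral (\<lambda>t. f t - g t) = gauss_integral f - gauss_integral g"
  unfolding gauss_integral_def scaleR_diff_right using assms
  by (intro Bochner_Integration.integral_diff integrable_gauss borel_measurable_continuous_onI)

text \<open>With respect to the Gaussian weight, raising the Hermite index is adjoint to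
  differentiation: by \<open>hermite_Suc\<close>, integration by parts applied to
  \<open>hermite n\<close> times \<open>G\<close> leaves exactly these two terms.\<close>

lemma gauss_integral_hermite_Suc:
  assumes G: "exp_bounded G" and G': "exp_bounded G'" "continuous_on UNIV G'"
    and deriv: "\<And>t. (G has_vector_derivative G' t) (at t)"
  shows "gauss_integral (\<lambda>t. of_real (hermite (Suc n) t) * G t) = gauss_integral (\<lambda>t. of_real (hermite n t) * G' t)"
proof -
  have contG: "continuous_on UNIV G"
    using deriv by (intro continuous_at_imp_continuous_on ballI has_vector_derivative_continuous)
  have "0 = (\<integral>t. exp (- t\<^sup>2) *\<^sub>R ((of_real (hermite n t) * G' t + of_real (2 * real n * hermite (n - 1) t) * G t)
      - (2 * t) *\<^sub>R (of_real (hermite n t) * G t)) \<partial>lborel)"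
  proof (rule gauss_integration_by_parts[symmetric])
    show "((\<lambda>t. of_real (hermite n t) * G t) has_vector_derivative
        of_real (hermite n t) * G' t + of_real (2 * real n * hermite (n - 1) t) * G t) (at t)" for t
      by (rule has_vector_derivative_mult[OF hermite_has_vector_derivative deriv])
  qed (intro exp_bounded_intros G G' continuous_intros contG)+
  also have "\<dots> = gauss_integral (\<lambda>t. of_real (hermite n t) * G' t - of_real (hermite (Suc n) t) * G t)"
    unfolding gauss_integral_def hermite_Suc
    by (intro Bochner_Integration.integral_cong) (auto simp: scaleR_conv_of_real algebra_simps)
  also have "\<dots> = gauss_integral (\<lambda>t. of_real (hermite n t) * G' t) - gauss_integral (\<lambda>t. of_real (hermite (Suc n) t) * G t)"
    by (intro gauss_integral_diff exp_bounded_intros G G' continuous_intros contG)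
  finally show ?thesis by simp
qed

text \<open>Obtained from the characteristic function of the normal distribution: the imaginary part
  of \<open>w\<close> is the frequency, the real part a translation of the Gaussian.\<close>

lemma gauss_integral_exp: "gauss_integral (\<lambda>t. exp (w * of_real t)) = of_real (sqrt pi) * exp (w\<^sup>2 / 4)"
proof -
  \<comment> \<open>The scalings are chosen so that \<open>w = 2 * a + \<i> * sqrt 2 * b\<close>,
    which matches the substitution \<open>x = sqrt 2 * (t - a)\<close> made below.\<close>
  define a where "a = Re w / 2"
  define b where "b = Im w / sqrt 2"
  have w: "w = 2 * of_real a + \<i> * of_real (sqrt 2 * b)"
    by (simp add: a_def b_def complex_eq_iff)
  have "exp (complex_of_real (- (b\<^sup>2) / 2)) = char std_normal_distribution b"
    by (simp only: char_std_normal_distribution exp_of_real)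
  also have "\<dots> = (\<integral>x. std_normal_density x *\<^sub>R iexp (b * x) \<partial>lborel)"
    unfolding char_def by (subst integral_density) (auto simp: normal_density_nonneg)
  also have "\<dots> = \<bar>sqrt 2\<bar> *\<^sub>R (\<integral>t. std_normal_density (- sqrt 2 * a + sqrt 2 * t) *\<^sub>R iexp (b * (- sqrt 2 * a + sqrt 2 * t)) \<partial>lborel)"
    by (rule lborel_integral_real_affine) simp
  also have "(\<lambda>t. std_normal_density (- sqrt 2 * a + sqrt 2 * t) *\<^sub>R iexp (b * (- sqrt 2 * a + sqrt 2 * t)))
     = (\<lambda>t. (exp (- of_real (a\<^sup>2) - \<i> * of_real (sqrt 2 * a * b)) / of_real (sqrt (2 * pi))) * (exp (- t\<^sup>2) *\<^sub>R exp (w * of_real t)))"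
  proof
    fix t
    have "(- sqrt 2 * a + sqrt 2 * t)\<^sup>2 / 2 = (t - a)\<^sup>2"
      using real_sqrt_pow2[of 2] by (simp add: power2_eq_square field_simps)
    then have "- ((- sqrt 2 * a + sqrt 2 * t)\<^sup>2) / 2 = - (t - a)\<^sup>2" by simp
    then have "std_normal_density (- sqrt 2 * a + sqrt 2 * t) *\<^sub>R iexp (b * (- sqrt 2 * a + sqrt 2 * t))
      = exp (of_real (- (t - a)\<^sup>2)) * iexp (b * (- sqrt 2 * a + sqrt 2 * t)) / of_real (sqrt (2 * pi))"
      unfolding std_normal_density_def by (simp add: scaleR_conv_of_real flip: exp_of_real)
    also have "exp (of_real (- (t - a)\<^sup>2)) * iexp (b * (- sqrt 2 * a + sqrt 2 * t))
       = exp (- of_real (a\<^sup>2) - \<i> * of_real (sqrt 2 * a * b)) * (exp (of_real (- t\<^sup>2)) * exp (w * of_real t))"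
      unfolding exp_add[symmetric] w by (simp add: power2_eq_square algebra_simps)
    finally show "std_normal_density (- sqrt 2 * a + sqrt 2 * t) *\<^sub>R iexp (b * (- sqrt 2 * a + sqrt 2 * t)) =
      (exp (- of_real (a\<^sup>2) - \<i> * of_real (sqrt 2 * a * b)) / of_real (sqrt (2 * pi))) * (exp (- t\<^sup>2) *\<^sub>R exp (w * of_real t))"
      by (simp add: scaleR_conv_of_real flip: exp_of_real)
  qed
  also have "\<bar>sqrt 2\<bar> *\<^sub>R (\<integral>t. (exp (- of_real (a\<^sup>2) - \<i> * of_real (sqrt 2 * a * b)) / of_real (sqrt (2 * pi))) * (exp (- t\<^sup>2) *\<^sub>R exp (w * of_real t)) \<partial>lborel)
     = exp (- of_real (a\<^sup>2) - \<i> * of_real (sqrt 2 * a * b)) / of_real (sqrt pi) * gauss_integral (\<lambda>t. exp (w * of_real t))"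
    unfolding gauss_integral_def
    by (subst integral_mult_right_zero) (simp add: scaleR_conv_of_real real_sqrt_mult)
  finally have "gauss_integral (\<lambda>t. exp (w * of_real t)) =
      of_real (sqrt pi) * (exp (of_real (- b\<^sup>2 / 2)) * exp (of_real (a\<^sup>2) + \<i> * of_real (sqrt 2 * a * b)))"
    by (simp add: exp_diff exp_minus exp_add field_simps)
  also have "exp (of_real (- b\<^sup>2 / 2)) * exp (of_real (a\<^sup>2) + \<i> * of_real (sqrt 2 * a * b)) = exp (w\<^sup>2 / 4)"
  proof -
    have "of_real (- b\<^sup>2 / 2) + (of_real (a\<^sup>2) + \<i> * of_real (sqrt 2 * a * b)) = w\<^sup>2 / 4"
      unfolding w by (simp add: power2_eq_square algebra_simps complex_eq_iff)
    then show ?thesis by (simp only: exp_add[symmetric])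
  qed
  finally show ?thesis .
qed

lemma gauss_integral_1: "gauss_integral (\<lambda>t. 1) = of_real (sqrt pi)"
  using gauss_integral_exp[of 0] by simp

lemma gauss_integral_0: "gauss_integral (\<lambda>t. 0) = 0"
  by (simp add: gauss_integral_def)

text \<open>Each application of the adjointness lowers both indices by one, the second because
  differentiation lowers the Hermite index, until one of them is 0.\<close>

lemma hermite_orthogonal_complex:
  "gauss_integral (\<lambda>t. of_real (hermite m t) * of_real (hermite n t)) =
     (if m = n then of_real (2 ^ n * fact n * sqrt pi) else 0)"
proof (induction m arbitrary: n)
  case 0
  show ?case
  proof (cases n)
    case 0
    then show ?thesis by (simp add: gauss_integral_1)
  next
    case (Suc k)
    have "gauss_integral (\<lambda>t. of_real (hermite (Suc k) t) * 1) = gauss_integral (\<lambda>t. of_real (hermite k t) * 0)"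
      by (rule gauss_integral_hermite_Suc) (auto intro!: exp_bounded_intros continuous_intros)
    then show ?thesis using Suc by (simp add: gauss_integral_0)
  qed
next
  case (Suc m)
  have "gauss_integral (\<lambda>t. of_real (hermite (Suc m) t) * of_real (hermite n t)) =
      gauss_integral (\<lambda>t. of_real (hermite m t) * of_real (2 * real n * hermite (n - 1) t))"
    by (intro gauss_integral_hermite_Suc exp_bounded_intros continuous_intros hermite_has_vector_derivative)
  also have "(\<lambda>t. of_real (hermite m t) * of_real (2 * real n * hermite (n - 1) t))
      = (\<lambda>t. of_real (2 * real n) * (of_real (hermite m t) * complex_of_real (hermite (n - 1) t)))"
    by (auto simp: mult_ac)
  also have "gauss_integral \<dots> = of_real (2 * real n) * (if m = n - 1 then of_real (2 ^ (n - 1) * fact (n - 1) * sqrt pi) else 0)"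
    unfolding gauss_integral_mult Suc.IH ..
  also have "\<dots> = (if Suc m = n then of_real (2 ^ n * fact n * sqrt pi) else 0)"
    by (cases n) (auto simp: mult_ac)
  finally show ?case .
qed

section \<open>Complex Hermite polynomials and the transform of Hermite functions\<close>

text \<open>Summands of the complex Hermite polynomials of Ito, in binomial form so that they vanish
  beyond \<open>min m n\<close> and the summation bound can be chosen freely. The letter
  \<open>w\<close> stands for \<open>cnj z\<close>.\<close>

definition ito_term :: "nat \<Rightarrow> nat \<Rightarrow> complex \<Rightarrow> complex \<Rightarrow> nat \<Rightarrow> complex" where
  "ito_term m n z w j =
     (-1) ^ j * of_nat (m choose j) * (of_nat (n choose j) * fact j) * z ^ (m - j) * w ^ (n - j)"

definition ito_hermite :: "nat \<Rightarrow> nat \<Rightarrow> complex \<Rightarrow> complex" where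
  "ito_hermite m n z = (\<Sum>j\<le>n. ito_term m n z (cnj z) j)"

lemma ito_hermite_eq_sum: "N \<ge> min m n \<Longrightarrow> ito_hermite m n z = (\<Sum>j\<le>N. ito_term m n z (cnj z) j)"
proof -
  have *: "(\<Sum>j\<le>K. ito_term m n z (cnj z) j) = (\<Sum>j\<le>min m n. ito_term m n z (cnj z) j)" if "K \<ge> min m n" for K
    by (rule sum.mono_neutral_right) (use that in \<open>auto simp: ito_term_def\<close>)
  show "N \<ge> min m n \<Longrightarrow> ?thesis"
    unfolding ito_hermite_def using *[of n] *[of N] by simp
qed

text \<open>Conjugation exchanges the two powers, and the coefficient is symmetric. Later the
  conjugate in an inner product is therefore just an exchange of indices.\<close>

lemma cnj_ito_hermite: "cnj (ito_hermite m n z) = ito_hermite n m z"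
  unfolding ito_hermite_def[of m] ito_hermite_eq_sum[of n m n z, OF min.cobounded1]
  by (auto simp: ito_term_def mult_ac intro!: sum.cong)

lemma ito_hermite_0_left: "ito_hermite 0 n z = cnj z ^ n"
  by (subst ito_hermite_eq_sum[of _ _ 0]) (auto simp: ito_term_def)

lemma ito_hermite_0_right: "ito_hermite m 0 z = z ^ m"
  by (simp add: ito_hermite_def ito_term_def)

text \<open>Pascal's rule splits the first binomial coefficient, and the absorption identity for the
  second shifts the summation index by one.\<close>

lemma ito_term_Suc:
  "ito_term (Suc m) n z w j =
     z * ito_term m n z w j - (case j of 0 \<Rightarrow> 0 | Suc i \<Rightarrow> of_nat n * ito_term m (n - 1) z w i)"
proof (cases j)
  case 0
  then show ?thesis by (simp add: ito_term_def)
next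
  case (Suc i)
  \<comment> \<open>If \<open>Suc i\<close> exceeds \<open>m\<close>, the exponents do not match,
    but the binomial coefficient is 0.\<close>
  have 1: "of_nat (m choose Suc i) * z ^ (m - i) = z * (of_nat (m choose Suc i) * z ^ (m - Suc i))"
  proof (cases "Suc i \<le> m")
    case True
    then have "m - i = Suc (m - Suc i)" by simp
    then show ?thesis by simp
  qed simp
  have "of_nat (n choose Suc i) * fact (Suc i) = (of_nat (Suc i * (n choose Suc i)) * fact i :: complex)"
    by (simp add: algebra_simps)
  also have "\<dots> = of_nat n * (of_nat ((n - 1) choose i) * fact i)"
    by (subst binomial_absorption) simp
  finally have 2: "of_nat (n choose Suc i) * fact (Suc i) = (of_nat n * (of_nat ((n - 1) choose i) * fact i) :: complex)" .
  have "ito_term (Suc m) n z w j = (-1) ^ Suc i * (of_nat (n choose Suc i) * fact (Suc i)) * w ^ (n - Suc i)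
      * (of_nat (m choose Suc i) * z ^ (m - i)) +
      (-1) ^ Suc i * of_nat (m choose i) * (of_nat (n choose Suc i) * fact (Suc i)) * w ^ (n - Suc i) * z ^ (m - i)"
    by (simp add: ito_term_def Suc algebra_simps del: fact_Suc)
  also have "\<dots> = z * ito_term m n z w j +
      (-1) ^ Suc i * of_nat (m choose i) * (of_nat n * (of_nat ((n - 1) choose i) * fact i)) * w ^ (n - 1 - i) * z ^ (m - i)"
    unfolding 1 by (simp only: 2[symmetric]) (simp add: ito_term_def Suc algebra_simps del: fact_Suc)
  also have "\<dots> = z * ito_term m n z w j - of_nat n * ito_term m (n - 1) z w i"
    by (simp add: ito_term_def)
  finally show ?thesis by (simp add: Suc)
qed

text \<open>The creation operator: multiplication by \<open>z\<close> minus the derivative with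
  respect to \<open>cnj z\<close>, compare \<open>ito_hermite_has_derivative\<close>.\<close>

lemma ito_hermite_Suc:
  "ito_hermite (Suc m) n z = z * ito_hermite m n z - of_nat n * ito_hermite m (n - 1) z"
proof (cases n)
  case 0
  then show ?thesis by (simp add: ito_hermite_0_right)
next
  case (Suc k)
  have "ito_hermite (Suc m) n z = (\<Sum>j\<le>Suc k. z * ito_term m n z (cnj z) j)
      - (\<Sum>j\<le>Suc k. case j of 0 \<Rightarrow> 0 | Suc i \<Rightarrow> of_nat n * ito_term m (n - 1) z (cnj z) i)"
    unfolding ito_hermite_def ito_term_Suc sum_subtractf Suc ..
  also have "(\<Sum>j\<le>Suc k. case j of 0 \<Rightarrow> 0 | Suc i \<Rightarrow> of_nat n * ito_term m (n - 1) z (cnj z) i)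
      = (\<Sum>i\<le>k. of_nat n * ito_term m (n - 1) z (cnj z) i)"
    by (subst sum.atMost_Suc_shift) simp
  finally show ?thesis
    by (simp add: ito_hermite_def Suc sum_distrib_left del: sum.atMost_Suc)
qed

text \<open>The kernel on a slice without \<open>exp (- t\<^sup>2 / 2)\<close> and
  \<open>exp (- z\<^sup>2 / 2)\<close>. The first joins the half Gaussian of a Hermite function to
  form the weight of \<open>gauss_integral\<close>; the second cancels the exponential produced by
  the integral. The shift \<open>sqrt 2 * Re z\<close> is
  \<open>(z + cnj z) / sqrt 2\<close>.\<close>

definition shifted_kernel :: "nat \<Rightarrow> complex \<Rightarrow> real \<Rightarrow> complex" where
  "shifted_kernel k z t = exp (of_real (sqrt 2) * z * of_real t) * of_real (hermite k (sqrt 2 * Re z - t))"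

lemma shifted_kernel_has_vector_derivative:
  "(shifted_kernel k z has_vector_derivative
     (of_real (sqrt 2) * z * shifted_kernel k z t - of_real (2 * real k) * shifted_kernel (k - 1) z t)) (at t)"
proof -
  have "((\<lambda>t. hermite k (sqrt 2 * Re z - t)) has_real_derivative
      (2 * real k * hermite (k - 1) (sqrt 2 * Re z - t)) * (0 - 1)) (at t)"
    by (rule DERIV_chain2[OF DERIV_hermite]) (intro derivative_intros)
  then have 1: "((\<lambda>t. complex_of_real (hermite k (sqrt 2 * Re z - t))) has_vector_derivative
      of_real ((2 * real k * hermite (k - 1) (sqrt 2 * Re z - t)) * (0 - 1))) (at t)"
    by (rule has_vector_derivative_of_real)
  have 2: "((\<lambda>t. exp (of_real (sqrt 2) * z * of_real t)) has_vector_derivative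
      (exp (of_real (sqrt 2) * z * of_real t) * (of_real (sqrt 2) * z))) (at t)"
    by (rule has_vector_derivative_real_field) (auto intro!: derivative_eq_intros)
  show ?thesis
    unfolding shifted_kernel_def[abs_def]
    by (rule has_vector_derivative_eq_rhs[OF has_vector_derivative_mult[OF 2 1]]) (simp add: algebra_simps)
qed

lemma exp_bounded_shifted_kernel [exp_bounded_intros]: "exp_bounded (shifted_kernel k z)"
  unfolding shifted_kernel_def[abs_def]
  by (intro exp_bounded_mult exp_bounded_of_real exp_bounded_reflect exp_bounded_hermite
      exp_bounded_compose_of_real[where f = "\<lambda>x. exp (of_real (sqrt 2) * z * x)"] exp_bounded_exp)

lemma continuous_on_shifted_kernel [continuous_intros]: "continuous_on A (shifted_kernel k z)"
  unfolding shifted_kernel_def[abs_def] by (intro continuous_intros)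

text \<open>The recurrence for \<open>hermite (Suc k)\<close> brings in a factor
  \<open>2 * t\<close>, which integration by parts trades for a derivative of the kernel. The terms
  with \<open>k - 1\<close> cancel, and \<open>2 * Re z - z = cnj z\<close> remains up to
  \<open>sqrt 2\<close>.\<close>

lemma gauss_integral_shifted_kernel:
  "gauss_integral (shifted_kernel k z) = of_real (sqrt pi) * of_real (sqrt 2) ^ k * exp (z\<^sup>2 / 2) * cnj z ^ k"
proof (induction k)
  case 0
  have "gauss_integral (shifted_kernel 0 z) = gauss_integral (\<lambda>t. exp (of_real (sqrt 2) * z * of_real t))"
    by (simp add: shifted_kernel_def[abs_def])
  also have "\<dots> = of_real (sqrt pi) * exp ((of_real (sqrt 2) * z)\<^sup>2 / 4)"
    by (rule gauss_integral_exp)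
  also have "(of_real (sqrt 2) * z)\<^sup>2 / 4 = z\<^sup>2 / 2"
    by (simp add: power_mult_distrib flip: of_real_power)
  finally show ?case by simp
next
  case (Suc k)
  let ?s = "of_real (sqrt 2) :: complex"
  \<comment> \<open>The factor \<open>2 * t\<close> is read as the Hermite polynomial of index
    1.\<close>
  have "gauss_integral (\<lambda>t. of_real (hermite (Suc 0) t) * shifted_kernel k z t) = gauss_integral (\<lambda>t. of_real (hermite 0 t) *
      (?s * z * shifted_kernel k z t - of_real (2 * real k) * shifted_kernel (k - 1) z t))"
    by (rule gauss_integral_hermite_Suc)
      (intro exp_bounded_intros continuous_intros shifted_kernel_has_vector_derivative)+
  then have 1: "gauss_integral (\<lambda>t. of_real (2 * t) * shifted_kernel k z t) = gauss_integral (\<lambda>t.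
      ?s * z * shifted_kernel k z t - of_real (2 * real k) * shifted_kernel (k - 1) z t)"
    by (simp add: hermite_Suc)
  have "shifted_kernel (Suc k) z = (\<lambda>t. (of_real (2 * sqrt 2 * Re z) * shifted_kernel k z t
      - of_real (2 * t) * shifted_kernel k z t) - of_real (2 * real k) * shifted_kernel (k - 1) z t)"
    by (auto simp: shifted_kernel_def hermite_Suc algebra_simps)
  then have "gauss_integral (shifted_kernel (Suc k) z) = gauss_integral (\<lambda>t. (of_real (2 * sqrt 2 * Re z) * shifted_kernel k z t
      - of_real (2 * t) * shifted_kernel k z t) - of_real (2 * real k) * shifted_kernel (k - 1) z t)"
    by (rule arg_cong)
  also have "\<dots> = gauss_integral (\<lambda>t. of_real (2 * sqrt 2 * Re z) * shifted_kernel k z t)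
     - gauss_integral (\<lambda>t. of_real (2 * t) * shifted_kernel k z t) - gauss_integral (\<lambda>t. of_real (2 * real k) * shifted_kernel (k - 1) z t)"
  proof -
    have 1: "exp_bounded (\<lambda>t. of_real (2 * sqrt 2 * Re z) * shifted_kernel k z t)"
        "exp_bounded (\<lambda>t. of_real (2 * t) * shifted_kernel k z t)"
        "exp_bounded (\<lambda>t. of_real (2 * real k) * shifted_kernel (k - 1) z t)"
      by (intro exp_bounded_intros)+
    have 2: "continuous_on UNIV (\<lambda>t. of_real (2 * sqrt 2 * Re z) * shifted_kernel k z t)"
        "continuous_on UNIV (\<lambda>t. of_real (2 * t) * shifted_kernel k z t)"
        "continuous_on UNIV (\<lambda>t. of_real (2 * real k) * shifted_kernel (k - 1) z t)"
      by (intro continuous_intros)+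
    show ?thesis
      unfolding gauss_integral_diff[OF exp_bounded_diff[OF 1(1,2)] 1(3) continuous_on_diff[OF 2(1,2)] 2(3)]
        gauss_integral_diff[OF 1(1,2) 2(1,2)] ..
  qed
  finally have 2: "gauss_integral (shifted_kernel (Suc k) z) = gauss_integral (\<lambda>t. of_real (2 * sqrt 2 * Re z) * shifted_kernel k z t)
     - gauss_integral (\<lambda>t. of_real (2 * t) * shifted_kernel k z t) - gauss_integral (\<lambda>t. of_real (2 * real k) * shifted_kernel (k - 1) z t)" .
  have 3: "gauss_integral (\<lambda>t. of_real (2 * t) * shifted_kernel k z t) =
      gauss_integral (\<lambda>t. ?s * z * shifted_kernel k z t) - gauss_integral (\<lambda>t. of_real (2 * real k) * shifted_kernel (k - 1) z t)"
  proof -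
    have "exp_bounded (\<lambda>t. ?s * z * shifted_kernel k z t)" "exp_bounded (\<lambda>t. of_real (2 * real k) * shifted_kernel (k - 1) z t)"
      by (intro exp_bounded_intros)+
    moreover have "continuous_on UNIV (\<lambda>t. ?s * z * shifted_kernel k z t)"
        "continuous_on UNIV (\<lambda>t. of_real (2 * real k) * shifted_kernel (k - 1) z t)"
      by (intro continuous_intros)+
    ultimately show ?thesis
      by (rule trans[OF 1 gauss_integral_diff])
  qed
  have "gauss_integral (shifted_kernel (Suc k) z) =
      (of_real (2 * sqrt 2 * Re z) - ?s * z) * gauss_integral (shifted_kernel k z)"
    unfolding 2 3 gauss_integral_mult by (simp add: algebra_simps)
  also have "of_real (2 * sqrt 2 * Re z) - ?s * z = ?s * cnj z"
    by (simp add: complex_eq_iff)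
  finally show ?case unfolding Suc.IH by simp
qed

text \<open>One degree of \<open>hermite (Suc j)\<close> moves onto the kernel as a derivative, and
  the resulting recurrence is \<open>ito_hermite_Suc\<close> up to powers of
  \<open>sqrt 2\<close>.\<close>

lemma gauss_integral_hermite_shifted_kernel:
  "gauss_integral (\<lambda>t. of_real (hermite j t) * shifted_kernel k z t) =
     of_real (sqrt pi) * of_real (sqrt 2) ^ (j + k) * exp (z\<^sup>2 / 2) * ito_hermite j k z"
proof (induction j arbitrary: k)
  case 0
  then show ?case by (simp add: gauss_integral_shifted_kernel ito_hermite_0_left)
next
  case (Suc j)
  let ?s = "of_real (sqrt 2) :: complex"
  have "gauss_integral (\<lambda>t. of_real (hermite (Suc j) t) * shifted_kernel k z t) = gauss_integral (\<lambda>t. of_real (hermite j t) *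
      (?s * z * shifted_kernel k z t - of_real (2 * real k) * shifted_kernel (k - 1) z t))"
    by (rule gauss_integral_hermite_Suc)
      (intro exp_bounded_intros continuous_intros shifted_kernel_has_vector_derivative)+
  also have "\<dots> = gauss_integral (\<lambda>t. ?s * z * (of_real (hermite j t) * shifted_kernel k z t)
      - of_real (2 * real k) * (of_real (hermite j t) * shifted_kernel (k - 1) z t))"
    by (simp add: algebra_simps)
  also have "\<dots> = gauss_integral (\<lambda>t. ?s * z * (of_real (hermite j t) * shifted_kernel k z t))
      - gauss_integral (\<lambda>t. of_real (2 * real k) * (of_real (hermite j t) * shifted_kernel (k - 1) z t))"
    by (rule gauss_integral_diff; intro exp_bounded_intros continuous_intros)
  also have "\<dots> = of_real (sqrt pi) * exp (z\<^sup>2 / 2) * (?s * z * ?s ^ (j + k) * ito_hermite j k z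
      - of_real (2 * real k) * ?s ^ (j + (k - 1)) * ito_hermite j (k - 1) z)"
    unfolding gauss_integral_mult Suc.IH by (simp add: algebra_simps)
  \<comment> \<open>The factor 2 is the square of \<open>sqrt 2\<close> and makes up for the lower
    exponent; for \<open>k = 0\<close> both sides vanish.\<close>
  also have "of_real (2 * real k) * ?s ^ (j + (k - 1)) = ?s ^ (Suc j + k) * of_nat k"
  proof (cases k)
    case (Suc i)
    have "?s * ?s = 2" by (simp flip: of_real_mult)
    then show ?thesis by (simp add: Suc flip: mult.assoc)
  qed simp
  finally show ?case
    by (simp add: ito_hermite_Suc algebra_simps)
qed

section \<open>Orthogonality on the complex plane\<close>

lemma measurable_Complex [measurable]: "(\<lambda>(x, y). Complex x y) \<in> borel_measurable (lborel \<Otimes>\<^sub>M lborel)"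
  unfolding lborel_prod Complex_eq split_beta measurable_lborel2
  by (intro borel_measurable_continuous_onI continuous_intros)

text \<open>Boxes determine Lebesgue measure, and a complex box is a product of intervals. This
  opens the way to Fubini in real and imaginary part.\<close>

lemma lborel_complex: "lborel = distr (lborel \<Otimes>\<^sub>M lborel) borel (\<lambda>(x, y). Complex x y)"
proof (rule lborel_eqI)
  fix l u :: complex
  assume lu: "\<And>b. b \<in> Basis \<Longrightarrow> l \<bullet> b \<le> u \<bullet> b"
  then have le: "Re l \<le> Re u" "Im l \<le> Im u"
    using lu[of 1] lu[of \<i>] by (simp_all add: Basis_complex_def inner_complex_def)
  have "(\<lambda>(x, y). Complex x y) -` box l u \<inter> space (lborel \<Otimes>\<^sub>M lborel) = {Re l<..<Re u} \<times> {Im l<..<Im u}"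
    by (auto simp: box_def Basis_complex_def inner_complex_def space_pair_measure)
  then have "emeasure (distr (lborel \<Otimes>\<^sub>M lborel) borel (\<lambda>(x, y). Complex x y)) (box l u)
      = emeasure (lborel \<Otimes>\<^sub>M lborel) ({Re l<..<Re u} \<times> {Im l<..<Im u})"
    by (subst emeasure_distr) auto
  also have "\<dots> = ennreal ((Re u - Re l) * (Im u - Im l))"
    using le by (subst lborel.emeasure_pair_measure_Times) (auto simp: ennreal_mult)
  also have "(Re u - Re l) * (Im u - Im l) = (\<Prod>b\<in>Basis. (u - l) \<bullet> b)"
    by (simp add: Basis_complex_def inner_complex_def)
  finally show "emeasure (distr (lborel \<Otimes>\<^sub>M lborel) borel (\<lambda>(x, y). Complex x y)) (box l u) = (\<Prod>b\<in>Basis. (u - l) \<bullet> b)" .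
qed simp

lemma integrable_half_gauss_plane: "integrable lborel (\<lambda>z::complex. exp (- (norm z)\<^sup>2 / 2))"
proof -
  have "integrable (lborel \<Otimes>\<^sub>M lborel) (\<lambda>(x::real, y::real). exp (- x\<^sup>2 / 2) * exp (- y\<^sup>2 / 2))"
  proof (rule lborel_pair.Fubini_integrable)
    show "integrable lborel (\<lambda>x. \<integral>y. norm (case (x, y) of (x::real, y::real) \<Rightarrow> exp (- x\<^sup>2 / 2) * exp (- y\<^sup>2 / 2)) \<partial>lborel)"
      by (simp add: integrable_half_gauss[unfolded minus_divide_left[symmetric]])
    show "AE x in lborel. integrable lborel (\<lambda>y. case (x, y) of (x::real, y::real) \<Rightarrow> exp (- x\<^sup>2 / 2) * exp (- y\<^sup>2 / 2))"
      by (simp add: integrable_half_gauss[unfolded minus_divide_left[symmetric]])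
  qed measurable
  also have "(\<lambda>(x::real, y::real). exp (- x\<^sup>2 / 2) * exp (- y\<^sup>2 / 2)) =
      (\<lambda>p. exp (- (norm (case p of (x, y) \<Rightarrow> Complex x y))\<^sup>2 / 2))"
    by (auto simp: fun_eq_iff cmod_power2 add_divide_distrib simp flip: exp_add)
  finally show ?thesis
    unfolding lborel_complex by (subst integrable_distr_eq) auto
qed

lemma integrable_gauss_plane:
  fixes f :: "complex \<Rightarrow> 'a::{banach, second_countable_topology}"
  assumes "exp_bounded f" and [measurable]: "f \<in> borel_measurable borel"
  shows "integrable lborel (\<lambda>z. exp (- (norm z)\<^sup>2) *\<^sub>R f z)"
proof -
  obtain C c where 1: "C \<ge> 0" "c \<ge> 0" "\<And>x. norm (f x) \<le> C * exp (c * norm x)"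
    using exp_boundedE[OF assms(1)] by blast
  show ?thesis
  proof (rule Bochner_Integration.integrable_bound)
    show "integrable lborel (\<lambda>z::complex. (C * exp (c\<^sup>2 / 2)) * exp (- (norm z)\<^sup>2 / 2))"
      by (intro integrable_mult_right integrable_half_gauss_plane)
    have "norm (exp (- (norm z)\<^sup>2) *\<^sub>R f z) \<le> norm (C * exp (c\<^sup>2 / 2) * exp (- (norm z)\<^sup>2 / 2))" for z
    proof -
      have "exp (- (norm z)\<^sup>2) * norm (f z) \<le> exp (- (norm z)\<^sup>2) * (C * exp (c * norm z))"
        using 1(3)[of z] by (intro mult_left_mono) auto
      also have "\<dots> \<le> C * (exp (c\<^sup>2 / 2) * exp (- (norm z)\<^sup>2 / 2))"
        using mult_left_mono[OF gauss_exp_le[of "norm z" c] 1(1)] by (simp add: mult_ac)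
      finally show ?thesis using 1(1) by (simp add: mult_ac)
    qed
    then show "AE z in lborel. norm (exp (- (norm z)\<^sup>2) *\<^sub>R f z) \<le> norm (C * exp (c\<^sup>2 / 2) * exp (- (norm z)\<^sup>2 / 2))"
      by simp
  qed simp
qed

definition plane_integral :: "(complex \<Rightarrow> complex) \<Rightarrow> complex" where
  "plane_integral f = (\<integral>z. exp (- (norm z)\<^sup>2) *\<^sub>R f z \<partial>lborel)"

text \<open>Both orders are wanted, since integration by parts in a variable needs that variable in
  the inner integral.\<close>

lemma plane_integral_iterated:
  assumes "exp_bounded f" "continuous_on UNIV f"
  shows "plane_integral f = (\<integral>x. \<integral>y. exp (- x\<^sup>2 - y\<^sup>2) *\<^sub>R f (Complex x y) \<partial>lborel \<partial>lborel)" (is "_ = ?I1")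
    and "plane_integral f = (\<integral>y. \<integral>x. exp (- x\<^sup>2 - y\<^sup>2) *\<^sub>R f (Complex x y) \<partial>lborel \<partial>lborel)" (is "_ = ?I2")
proof -
  have [measurable]: "f \<in> borel_measurable borel"
    using assms(2) by (rule borel_measurable_continuous_onI)
  let ?g = "\<lambda>(x, y). exp (- x\<^sup>2 - y\<^sup>2) *\<^sub>R f (Complex x y)"
  have int: "integrable (lborel \<Otimes>\<^sub>M lborel) ?g"
  proof -
    have "integrable (lborel \<Otimes>\<^sub>M lborel) (\<lambda>p. exp (- (norm (case p of (x, y) \<Rightarrow> Complex x y))\<^sup>2) *\<^sub>R f (case p of (x, y) \<Rightarrow> Complex x y))"
      using integrable_gauss_plane[OF assms(1) \<open>f \<in> borel_measurable borel\<close>] unfolding lborel_complex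
      by (rule integrable_distr[OF measurable_Complex])
    also have "(\<lambda>p. exp (- (norm (case p of (x, y) \<Rightarrow> Complex x y))\<^sup>2) *\<^sub>R f (case p of (x, y) \<Rightarrow> Complex x y)) = ?g"
      by (auto simp: fun_eq_iff cmod_power2)
    finally show ?thesis .
  qed
  have "plane_integral f = integral\<^sup>L (lborel \<Otimes>\<^sub>M lborel) ?g"
    unfolding plane_integral_def lborel_complex
    by (subst integral_distr) (auto simp: case_prod_unfold cmod_power2)
  then show "plane_integral f = ?I1" "plane_integral f = ?I2"
    using lborel_pair.integral_fst'[OF int] lborel_pair.integral_snd[OF int] by simp_all
qed

lemma plane_integral_mult: "plane_integral (\<lambda>z. c * f z) = c * plane_integral f"
  unfolding plane_integral_def by (simp flip: mult_scaleR_right)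

lemma plane_integral_cnj: "plane_integral (\<lambda>z. cnj (f z)) = cnj (plane_integral f)"
  unfolding plane_integral_def by (subst Bochner_Integration.integral_cnj[symmetric]) simp

lemma plane_integral_add:
  assumes "exp_bounded f" "exp_bounded g" "continuous_on UNIV f" "continuous_on UNIV g"
  shows "plane_integral (\<lambda>z. f z + g z) = plane_integral f + plane_integral g"
  unfolding plane_integral_def scaleR_add_right using assms
  by (intro Bochner_Integration.integral_add integrable_gauss_plane borel_measurable_continuous_onI)

lemma plane_integral_diff:
  assumes "exp_bounded f" "exp_bounded g" "continuous_on UNIV f" "continuous_on UNIV g"
  shows "plane_integral (\<lambda>z. f z - g z) = plane_integral f - plane_integral g"
  unfolding plane_integral_def scaleR_diff_right using assms
  by (intro Bochner_Integration.integral_diff integrable_gauss_plane borel_measurable_continuous_onI)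

lemma exp_bounded_cnj [exp_bounded_intros]: "exp_bounded f \<Longrightarrow> exp_bounded (\<lambda>x. cnj (f x))"
  by (simp add: exp_bounded_def)

lemma exp_bounded_Re_Im [exp_bounded_intros]:
  "exp_bounded f \<Longrightarrow> exp_bounded (\<lambda>x. Re (f x))" "exp_bounded f \<Longrightarrow> exp_bounded (\<lambda>x. Im (f x))"
  by (rule exp_bounded_norm_le, assumption, simp add: abs_Re_le_cmod abs_Im_le_cmod)+

lemma exp_bounded_slice:
  assumes "exp_bounded f"
  shows "exp_bounded (\<lambda>x. f (Complex x y))" "exp_bounded (\<lambda>y. f (Complex x y))"
proof -
  obtain C c where 1: "C \<ge> 0" "c \<ge> 0" "\<And>x. norm (f x) \<le> C * exp (c * norm x)"
    using exp_boundedE[OF assms] by blast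
  have le: "norm (f (Complex x y)) \<le> C * exp (c * (\<bar>x\<bar> + \<bar>y\<bar>))" for x y
    using 1 cmod_le[of "Complex x y"] by (intro order_trans[OF 1(3)] mult_left_mono) (auto intro!: mult_left_mono)
  show "exp_bounded (\<lambda>x. f (Complex x y))"
    by (rule exp_boundedI[of _ "C * exp (c * \<bar>y\<bar>)" c]) (use le[of _ y] in \<open>simp add: distrib_left exp_add mult_ac\<close>)
  show "exp_bounded (\<lambda>y. f (Complex x y))"
    by (rule exp_boundedI[of _ "C * exp (c * \<bar>x\<bar>)" c]) (use le[of x] in \<open>simp add: distrib_left exp_add mult_ac\<close>)
qed

text \<open>\<open>A\<close> and \<open>B\<close> are the Wirtinger derivatives of \<open>F\<close> with respect to \<open>z\<close> and \<open>cnj z\<close>.\<close>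

definition wirtinger :: "(complex \<Rightarrow> complex) \<Rightarrow> (complex \<Rightarrow> complex) \<Rightarrow> (complex \<Rightarrow> complex) \<Rightarrow> bool" where
  "wirtinger F A B \<longleftrightarrow> (\<forall>z. (F has_derivative (\<lambda>h. A z * h + B z * cnj h)) (at z))
     \<and> exp_bounded F \<and> exp_bounded A \<and> exp_bounded B \<and> continuous_on UNIV A \<and> continuous_on UNIV B"

lemma wirtinger_continuous: "wirtinger F A B \<Longrightarrow> continuous_on UNIV F"
  unfolding wirtinger_def by (blast intro: continuous_at_imp_continuous_on has_derivative_continuous)

text \<open>The partial derivatives are \<open>A + B\<close> in the real and
  \<open>\<i> * (A - B)\<close> in the imaginary direction, and each direction is a Gaussian
  integration by parts.\<close>

lemma wirtinger_integration_by_parts: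
  assumes w: "wirtinger F A B"
  shows "plane_integral (\<lambda>z. z * F z) = plane_integral B"
proof -
  have d: "\<And>z. (F has_derivative (\<lambda>h. A z * h + B z * cnj h)) (at z)"
    and b: "exp_bounded F" "exp_bounded A" "exp_bounded B"
    and c: "continuous_on UNIV F" "continuous_on UNIV A" "continuous_on UNIV B"
    using w wirtinger_continuous[OF w] by (auto simp: wirtinger_def)
  have cC: "continuous_on UNIV (\<lambda>x. f (Complex x y))" "continuous_on UNIV (\<lambda>y. f (Complex x y))"
    if "continuous_on UNIV f" for f :: "complex \<Rightarrow> complex" and x y
    unfolding Complex_eq by (auto intro!: continuous_on_compose2[OF that] continuous_intros)
  have dx: "((\<lambda>x. F (Complex x y)) has_vector_derivative (A (Complex x y) + B (Complex x y))) (at x)" for x y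
  proof -
    have "((\<lambda>x. Complex x y) has_derivative (\<lambda>h. of_real h)) (at x)"
      unfolding Complex_eq by (auto intro!: derivative_eq_intros)
    from has_derivative_compose[OF this d] show ?thesis
      by (simp add: has_vector_derivative_def scaleR_conv_of_real algebra_simps)
  qed
  have dy: "((\<lambda>y. F (Complex x y)) has_vector_derivative (\<i> * (A (Complex x y) - B (Complex x y)))) (at y)" for x y
  proof -
    have "((\<lambda>y. Complex x y) has_derivative (\<lambda>h. \<i> * of_real h)) (at y)"
      unfolding Complex_eq by (auto intro!: derivative_eq_intros)
    from has_derivative_compose[OF this d] show ?thesis
      by (simp add: has_vector_derivative_def scaleR_conv_of_real algebra_simps)
  qed
  have X: "plane_integral (\<lambda>z. (A z + B z) - of_real (2 * Re z) * F z) = 0"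
  proof -
    have "(\<integral>x. exp (- x\<^sup>2) *\<^sub>R ((A (Complex x y) + B (Complex x y)) - (2 * x) *\<^sub>R F (Complex x y)) \<partial>lborel) = 0" for y
      by (rule gauss_integration_by_parts) (intro exp_bounded_intros exp_bounded_slice b continuous_intros cC c dx)+
    moreover have "(\<integral>x. exp (- x\<^sup>2 - y\<^sup>2) *\<^sub>R ((A (Complex x y) + B (Complex x y)) - of_real (2 * Re (Complex x y)) * F (Complex x y)) \<partial>lborel)
       = exp (- y\<^sup>2) *\<^sub>R (\<integral>x. exp (- x\<^sup>2) *\<^sub>R ((A (Complex x y) + B (Complex x y)) - (2 * x) *\<^sub>R F (Complex x y)) \<partial>lborel)" for y
      by (subst integral_scaleR_right[symmetric]) (simp add: scaleR_conv_of_real exp_diff exp_minus field_simps)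
    ultimately show ?thesis
      by (subst plane_integral_iterated(2)) (auto intro!: exp_bounded_intros b continuous_intros c)
  qed
  have Y: "plane_integral (\<lambda>z. \<i> * (A z - B z) - of_real (2 * Im z) * F z) = 0"
  proof -
    have "(\<integral>y. exp (- y\<^sup>2) *\<^sub>R (\<i> * (A (Complex x y) - B (Complex x y)) - (2 * y) *\<^sub>R F (Complex x y)) \<partial>lborel) = 0" for x
      by (rule gauss_integration_by_parts) (intro exp_bounded_intros exp_bounded_slice b continuous_intros cC c dy)+
    moreover have "(\<integral>y. exp (- x\<^sup>2 - y\<^sup>2) *\<^sub>R (\<i> * (A (Complex x y) - B (Complex x y)) - of_real (2 * Im (Complex x y)) * F (Complex x y)) \<partial>lborel)
       = exp (- x\<^sup>2) *\<^sub>R (\<integral>y. exp (- y\<^sup>2) *\<^sub>R (\<i> * (A (Complex x y) - B (Complex x y)) - (2 * y) *\<^sub>R F (Complex x y)) \<partial>lborel)" for x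
      by (subst integral_scaleR_right[symmetric]) (simp add: scaleR_conv_of_real exp_diff exp_minus field_simps)
    ultimately show ?thesis
      by (subst plane_integral_iterated(1)) (auto intro!: exp_bounded_intros b continuous_intros c)
  qed
  \<comment> \<open>Adding \<i> times the second identity to the first cancels \<open>A\<close> and
    leaves twice \<open>B z - z * F z\<close>.\<close>
  have "0 = plane_integral (\<lambda>z. (A z + B z) - of_real (2 * Re z) * F z)
      + plane_integral (\<lambda>z. \<i> * (\<i> * (A z - B z) - of_real (2 * Im z) * F z))"
    unfolding plane_integral_mult X Y by simp
  also have "\<dots> = plane_integral (\<lambda>z. ((A z + B z) - of_real (2 * Re z) * F z) +
      \<i> * (\<i> * (A z - B z) - of_real (2 * Im z) * F z))"
    by (rule plane_integral_add[symmetric]; intro exp_bounded_intros b continuous_intros c)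
  also have "\<dots> = plane_integral (\<lambda>z. 2 * (B z - z * F z))"
  proof (rule arg_cong[where f = plane_integral], rule ext)
    fix z
    have z: "z * F z = of_real (Re z) * F z + \<i> * of_real (Im z) * F z"
      by (subst complex_eq[of z]) (simp add: algebra_simps)
    show "((A z + B z) - of_real (2 * Re z) * F z) + \<i> * (\<i> * (A z - B z) - of_real (2 * Im z) * F z) = 2 * (B z - z * F z)"
      unfolding z by (simp add: algebra_simps)
  qed
  also have "\<dots> = 2 * (plane_integral B - plane_integral (\<lambda>z. z * F z))"
    unfolding plane_integral_mult
    by (subst plane_integral_diff) (auto intro!: exp_bounded_intros b continuous_intros c)
  finally show ?thesis by simp
qed

lemma exp_bounded_ito_hermite [exp_bounded_intros]: "exp_bounded (ito_hermite m n)"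
proof (induction m arbitrary: n)
  case 0
  then show ?case unfolding ito_hermite_0_left[abs_def] by (intro exp_bounded_intros)
next
  case (Suc m)
  then show ?case unfolding ito_hermite_Suc[abs_def] by (intro exp_bounded_intros)
qed

lemma continuous_on_ito_hermite [continuous_intros]:
  "continuous_on S f \<Longrightarrow> continuous_on S (\<lambda>x. ito_hermite m n (f x))"
  unfolding ito_hermite_def ito_term_def by (intro continuous_intros)

lemma ito_hermite_has_derivative:
  "(ito_hermite m n has_derivative
     (\<lambda>h. of_nat m * ito_hermite (m - 1) n z * h + of_nat n * ito_hermite m (n - 1) z * cnj h)) (at z)"
proof (induction m arbitrary: n)
  case 0
  have "((\<lambda>z. cnj z ^ n) has_derivative (\<lambda>h. of_nat n * cnj h * cnj z ^ (n - 1))) (at z)"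
    by (auto intro!: derivative_eq_intros simp: mult_ac)
  then show ?case
    unfolding ito_hermite_0_left[abs_def] by (simp add: mult_ac)
next
  case (Suc m)
  have "((\<lambda>z. z * ito_hermite m n z - of_nat n * ito_hermite m (n - 1) z) has_derivative
     (\<lambda>h. (z * (of_nat m * ito_hermite (m - 1) n z * h + of_nat n * ito_hermite m (n - 1) z * cnj h) + h * ito_hermite m n z)
       - of_nat n * (of_nat m * ito_hermite (m - 1) (n - 1) z * h + of_nat (n - 1) * ito_hermite m (n - 1 - 1) z * cnj h))) (at z)"
    by (intro has_derivative_diff has_derivative_mult has_derivative_mult_right Suc.IH has_derivative_ident)
  moreover have "(z * (of_nat m * ito_hermite (m - 1) n z * h + of_nat n * ito_hermite m (n - 1) z * cnj h) + h * ito_hermite m n z)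
       - of_nat n * (of_nat m * ito_hermite (m - 1) (n - 1) z * h + of_nat (n - 1) * ito_hermite m (n - 1 - 1) z * cnj h)
     = of_nat (Suc m) * ito_hermite (Suc m - 1) n z * h + of_nat n * ito_hermite (Suc m) (n - 1) z * cnj h" for h
  proof -
    \<comment> \<open>The recurrence one step lower restores \<open>ito_hermite m n\<close>; for
      \<open>m = 0\<close> both sides are 0.\<close>
    have "of_nat m * (z * ito_hermite (m - 1) n z - of_nat n * ito_hermite (m - 1) (n - 1) z) = of_nat m * ito_hermite m n z"
      by (cases m) (simp_all add: ito_hermite_Suc)
    moreover have "(z * (a * y * h + b * w * c) + h * x) - b * (a * v * h + d * u * c) =
        (a * (z * y - b * v)) * h + x * h + b * (z * w - d * u) * c" for a b c d u v w x y :: complex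
      by (simp add: algebra_simps)
    ultimately show ?thesis
      unfolding ito_hermite_Suc[of m "n - 1"] by (simp add: distrib_right)
  qed
  ultimately show ?case
    unfolding ito_hermite_Suc[abs_def] by simp
qed

text \<open>Creation is adjoint to annihilation: after integration by parts the derivative of the
  first factor merges with \<open>z\<close> times it into \<open>ito_hermite (Suc j) k\<close>, and
  the derivative of the second factor remains.\<close>

lemma plane_integral_ito_hermite_Suc:
  "plane_integral (\<lambda>z. ito_hermite (Suc j) k z * ito_hermite l m z) =
     of_nat m * plane_integral (\<lambda>z. ito_hermite j k z * ito_hermite l (m - 1) z)"
proof -
  define A where "A z = ito_hermite j k z * (of_nat l * ito_hermite (l - 1) m z) + of_nat j * ito_hermite (j - 1) k z * ito_hermite l m z" for z
  define B where "B z = ito_hermite j k z * (of_nat m * ito_hermite l (m - 1) z) + of_nat k * ito_hermite j (k - 1) z * ito_hermite l m z" for z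
  have "wirtinger (\<lambda>z. ito_hermite j k z * ito_hermite l m z) A B"
    unfolding wirtinger_def
  proof (intro conjI allI)
    fix z
    show "((\<lambda>z. ito_hermite j k z * ito_hermite l m z) has_derivative (\<lambda>h. A z * h + B z * cnj h)) (at z)"
      by (rule has_derivative_eq_rhs[OF has_derivative_mult[OF ito_hermite_has_derivative ito_hermite_has_derivative]])
        (simp add: A_def B_def algebra_simps)
  qed (auto simp: A_def[abs_def] B_def[abs_def] intro!: exp_bounded_intros continuous_intros)
  then have "plane_integral (\<lambda>z. z * (ito_hermite j k z * ito_hermite l m z)) = plane_integral B"
    by (rule wirtinger_integration_by_parts)
  then have "0 = plane_integral (\<lambda>z. B z - z * (ito_hermite j k z * ito_hermite l m z))"
    unfolding B_def[abs_def]
    by (subst plane_integral_diff) (auto intro!: exp_bounded_intros continuous_intros)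
  also have "\<dots> = plane_integral (\<lambda>z. of_nat m * (ito_hermite j k z * ito_hermite l (m - 1) z) - ito_hermite (Suc j) k z * ito_hermite l m z)"
    by (simp add: B_def ito_hermite_Suc algebra_simps)
  also have "\<dots> = plane_integral (\<lambda>z. of_nat m * (ito_hermite j k z * ito_hermite l (m - 1) z)) - plane_integral (\<lambda>z. ito_hermite (Suc j) k z * ito_hermite l m z)"
    by (rule plane_integral_diff; intro exp_bounded_intros continuous_intros)
  finally show ?thesis by (simp add: plane_integral_mult)
qed

lemma plane_integral_1: "plane_integral (\<lambda>z. 1) = of_real pi"
proof -
  have "plane_integral (\<lambda>z. 1) = (\<integral>x. \<integral>y. complex_of_real (exp (- x\<^sup>2)) * complex_of_real (exp (- y\<^sup>2)) \<partial>lborel \<partial>lborel)"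
    by (subst plane_integral_iterated(1)) (auto intro!: exp_bounded_intros continuous_intros
        simp: scaleR_conv_of_real exp_diff exp_minus field_simps)
  also have "\<dots> = gauss_integral (\<lambda>t. 1) * gauss_integral (\<lambda>t. 1)"
    unfolding gauss_integral_def by (simp add: scaleR_conv_of_real)
  finally show ?thesis by (simp add: gauss_integral_1 flip: of_real_mult)
qed

text \<open>The indices \<open>j\<close> and \<open>m\<close> are lowered together. No conjugate
  appears because it is encoded by exchanged indices.\<close>

lemma ito_hermite_orthogonal:
  "plane_integral (\<lambda>z. ito_hermite j k z * ito_hermite k m z) = (if j = m then of_real (pi * fact j * fact k) else 0)"
proof (induction j arbitrary: m)
  case 0
  show ?case
  proof (cases m)
    case 0
    \<comment> \<open>The squared norm of \<open>z ^ k\<close>, by lowering on the other pair of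
      indices.\<close>
    have "plane_integral (\<lambda>z. ito_hermite k 0 z * ito_hermite 0 k z) = of_real (pi * fact k)"
    proof (induction k)
      case 0
      show ?case by (simp add: ito_hermite_0_right plane_integral_1)
    next
      case (Suc k)
      then show ?case
        unfolding plane_integral_ito_hermite_Suc[of k 0 0 "Suc k"] by (simp add: algebra_simps)
    qed
    with 0 show ?thesis by (simp add: mult.commute)
  next
    case (Suc i)
    \<comment> \<open>Conjugation brings the positive index to the front; lowering it then produces
      the factor 0.\<close>
    have "plane_integral (\<lambda>z. ito_hermite 0 k z * ito_hermite k m z)
        = cnj (plane_integral (\<lambda>z. ito_hermite (Suc i) k z * ito_hermite k 0 z))"
      unfolding plane_integral_cnj[symmetric] by (simp add: cnj_ito_hermite Suc mult.commute)
    then show ?thesis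
      using Suc by (simp add: plane_integral_ito_hermite_Suc)
  qed
next
  case (Suc j)
  show ?case
    unfolding plane_integral_ito_hermite_Suc Suc.IH by (cases m) (auto simp: algebra_simps)
qed

section \<open>Completeness of the Hermite functions\<close>

text \<open>Bounding the product by the sum of two squares doubles the exponent in
  \<open>exp (- t\<^sup>2 / 2)\<close>, which restores the full Gaussian.\<close>

lemma integrable_half_gauss_times:
  fixes F :: "real \<Rightarrow> 'b::{banach, second_countable_topology}" and \<phi> :: "real \<Rightarrow> real"
  assumes F: "exp_bounded F" and [measurable]: "F \<in> borel_measurable borel" "\<phi> \<in> borel_measurable borel"
    and \<phi>: "integrable lborel (\<lambda>t. (\<phi> t)\<^sup>2)"
  shows "integrable lborel (\<lambda>t. (exp (- t\<^sup>2 / 2) * \<phi> t) *\<^sub>R F t)"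
proof (rule Bochner_Integration.integrable_bound)
  show "integrable lborel (\<lambda>t. exp (- t\<^sup>2) *\<^sub>R (norm (F t))\<^sup>2 + (\<phi> t)\<^sup>2)"
    by (intro Bochner_Integration.integrable_add \<phi> integrable_gauss exp_bounded_intros F) measurable
  have "norm ((exp (- t\<^sup>2 / 2) * \<phi> t) *\<^sub>R F t) \<le> norm (exp (- t\<^sup>2) *\<^sub>R (norm (F t))\<^sup>2 + (\<phi> t)\<^sup>2)" for t
  proof -
    have "2 * (exp (- t\<^sup>2 / 2) * norm (F t)) * \<bar>\<phi> t\<bar> \<le> (exp (- t\<^sup>2 / 2) * norm (F t))\<^sup>2 + \<bar>\<phi> t\<bar>\<^sup>2"
      by (rule sum_squares_bound)
    moreover have "0 \<le> (exp (- t\<^sup>2 / 2) * norm (F t)) * \<bar>\<phi> t\<bar>"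
      by simp
    ultimately have "(exp (- t\<^sup>2 / 2) * norm (F t)) * \<bar>\<phi> t\<bar> \<le> (exp (- t\<^sup>2 / 2) * norm (F t))\<^sup>2 + \<bar>\<phi> t\<bar>\<^sup>2"
      by linarith
    also have "(exp (- t\<^sup>2 / 2) * norm (F t))\<^sup>2 = exp (- t\<^sup>2) * (norm (F t))\<^sup>2"
      by (simp add: power_mult_distrib flip: exp_double)
    finally show ?thesis by (simp add: abs_mult mult_ac)
  qed
  then show "AE t in lborel. norm ((exp (- t\<^sup>2 / 2) * \<phi> t) *\<^sub>R F t) \<le> norm (exp (- t\<^sup>2) *\<^sub>R (norm (F t))\<^sup>2 + (\<phi> t)\<^sup>2)"
    by simp
qed simp

text \<open>Positive and negative part of \<open>g\<close> have the same Fourier transform, hence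
  (at frequency 0) the same mass. Divided by that mass they are probability densities with equal
  characteristic functions, so Levy's uniqueness theorem applies.\<close>

lemma AE_eq_0_if_char_integral_eq_0:
  fixes g :: "real \<Rightarrow> real"
  assumes g: "integrable lborel g"
    and char0: "\<And>s. (\<integral>t. g t *\<^sub>R iexp (s * t) \<partial>lborel) = 0"
  shows "AE t in lborel. g t = 0"
proof -
  have [measurable]: "g \<in> borel_measurable borel"
    using g by (auto dest: borel_measurable_integrable)
  define p where "p t = max 0 (g t)" for t
  define m where "m t = max 0 (- g t)" for t
  have pm: "p t \<ge> 0" "m t \<ge> 0" "g t = p t - m t" for t
    by (auto simp: p_def m_def)
  have [measurable]: "p \<in> borel_measurable borel" "m \<in> borel_measurable borel"
    unfolding p_def[abs_def] m_def[abs_def] by measurable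
  have int: "integrable lborel p" "integrable lborel m"
    unfolding p_def[abs_def] m_def[abs_def] using g by (auto intro!: integrable_max)
  have int_iexp: "integrable lborel (\<lambda>t. f t *\<^sub>R iexp (s * t))" if "integrable lborel f" for f s
    by (rule Bochner_Integration.integrable_bound[OF that]) (use that in \<open>auto dest: borel_measurable_integrable\<close>)
  have eq: "(\<integral>t. p t *\<^sub>R iexp (s * t) \<partial>lborel) = (\<integral>t. m t *\<^sub>R iexp (s * t) \<partial>lborel)" for s
    using char0[of s] unfolding pm(3) scaleR_diff_left
    by (subst (asm) Bochner_Integration.integral_diff[OF int_iexp[OF int(1)] int_iexp[OF int(2)]]) simp
  define c where "c = (\<integral>t. p t \<partial>lborel)"
  have "complex_of_real c = of_real (\<integral>t. m t \<partial>lborel)"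
    using eq[of 0] unfolding c_def by (simp add: scaleR_conv_of_real)
  then have c2: "c = (\<integral>t. m t \<partial>lborel)" by (simp only: of_real_eq_iff)
  have "c \<ge> 0" unfolding c_def using pm by simp
  show ?thesis
  \<comment> \<open>Mass 0 cannot be normalised, but then both parts vanish almost
    everywhere.\<close>
  proof (cases "c = 0")
    case True
    then have "(\<integral>t. p t \<partial>lborel) = 0" "(\<integral>t. m t \<partial>lborel) = 0"
      using c2 by (simp_all add: c_def)
    then have "AE t in lborel. p t = 0" "AE t in lborel. m t = 0"
      using int pm by (simp_all add: integral_nonneg_eq_0_iff_AE)
    then show ?thesis
      by eventually_elim (simp add: pm(3))
  next
    case False
    then have c: "c > 0" using \<open>c \<ge> 0\<close> by simp
    have rd: "real_distribution (density lborel (\<lambda>t. ennreal (f t / c)))"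
      if f: "integrable lborel f" "\<And>t. f t \<ge> 0" "(\<integral>t. f t \<partial>lborel) = c" for f
    proof -
      have [measurable]: "f \<in> borel_measurable borel"
        using f(1) by (auto dest: borel_measurable_integrable)
      have "(\<integral>\<^sup>+t. ennreal (f t / c) \<partial>lborel) = ennreal (\<integral>t. f t / c \<partial>lborel)"
        by (rule nn_integral_eq_integral) (use f c in auto)
      also have "\<dots> = 1" using f(3) c by simp
      finally have "prob_space (density lborel (\<lambda>t. ennreal (f t / c)))"
        by (intro prob_spaceI) (simp add: emeasure_density)
      then show ?thesis
        by (simp add: real_distribution_def real_distribution_axioms_def)
    qed
    have ch: "char (density lborel (\<lambda>t. ennreal (f t / c))) s = (1 / of_real c) * (\<integral>t. f t *\<^sub>R iexp (s * t) \<partial>lborel)"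
      if f: "integrable lborel f" "\<And>t. f t \<ge> 0" for f s
    proof -
      have [measurable]: "f \<in> borel_measurable borel"
        using f(1) by (auto dest: borel_measurable_integrable)
      have "char (density lborel (\<lambda>t. ennreal (f t / c))) s = (\<integral>t. (f t / c) *\<^sub>R iexp (s * t) \<partial>lborel)"
        unfolding char_def by (subst integral_density) (use f c in auto)
      also have "\<dots> = (\<integral>t. (1 / of_real c) * (f t *\<^sub>R iexp (s * t)) \<partial>lborel)"
        by (simp add: scaleR_conv_of_real)
      finally show ?thesis by (simp only: integral_mult_right_zero)
    qed
    have "char (density lborel (\<lambda>t. ennreal (p t / c))) = char (density lborel (\<lambda>t. ennreal (m t / c)))"
      by (rule ext) (simp only: ch[OF int(1) pm(1)] ch[OF int(2) pm(2)] eq)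
    then have "density lborel (\<lambda>t. ennreal (p t / c)) = density lborel (\<lambda>t. ennreal (m t / c))"
      by (intro Levy_uniqueness rd int pm) (auto simp: c_def c2[unfolded c_def])
    then have "AE t in lborel. ennreal (p t / c) = ennreal (m t / c)"
      by (subst (asm) finite_density_unique) (use int pm c in \<open>auto simp: nn_integral_eq_integral\<close>)
    then show ?thesis
      by eventually_elim (use c pm in \<open>simp add: pm(3) divide_nonneg_pos\<close>)
  qed
qed

lemma hermite_complete_real:
  fixes \<phi> :: "real \<Rightarrow> real"
  assumes [measurable]: "\<phi> \<in> borel_measurable borel" and \<phi>: "integrable lborel (\<lambda>t. (\<phi> t)\<^sup>2)"
    and orth: "\<And>j. (\<integral>t. (exp (- t\<^sup>2 / 2) * \<phi> t) * hermite j t \<partial>lborel) = 0"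
  shows "AE t in lborel. \<phi> t = 0"
proof -
  define g where "g t = exp (- t\<^sup>2 / 2) * \<phi> t" for t
  have [measurable]: "g \<in> borel_measurable borel" unfolding g_def[abs_def] by measurable
  have [measurable]: "hermite j \<in> borel_measurable borel" for j
    by (rule borel_measurable_continuous_onI[OF continuous_hermite])
  have int: "integrable lborel (\<lambda>t. g t *\<^sub>R F t)"
    if "exp_bounded F" "F \<in> borel_measurable borel" for F :: "real \<Rightarrow> 'b::{banach, second_countable_topology}"
    unfolding g_def by (rule integrable_half_gauss_times) (use that \<phi> in auto)
  \<comment> \<open>Keeping a Hermite factor in the claim lets the induction absorb one power of
    \<open>t\<close> at a time through the three-term recurrence, so monomials never have to be
    expanded in Hermite polynomials.\<close>
  have moments: "(\<integral>t. g t * (t ^ n * hermite j t) \<partial>lborel) = 0" for n j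
  proof (induction n arbitrary: j)
    case 0
    then show ?case using orth by (simp add: g_def)
  next
    case (Suc n)
    have int': "integrable lborel (\<lambda>t. g t * (t ^ n * hermite i t))" for i
      using int[of "\<lambda>t. t ^ n * hermite i t"] by (simp add: exp_bounded_intros)
    have "(\<integral>t. g t * (t ^ Suc n * hermite j t) \<partial>lborel) =
        (\<integral>t. 1 / 2 * (g t * (t ^ n * hermite (Suc j) t)) + real j * (g t * (t ^ n * hermite (j - 1) t)) \<partial>lborel)"
      by (simp add: hermite_Suc algebra_simps)
    also have "\<dots> = 1 / 2 * (\<integral>t. g t * (t ^ n * hermite (Suc j) t) \<partial>lborel) + real j * (\<integral>t. g t * (t ^ n * hermite (j - 1) t) \<partial>lborel)"
      using int' by (subst Bochner_Integration.integral_add) auto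
    finally show ?case by (simp only: Suc.IH)
  qed
  have "(\<integral>t. g t *\<^sub>R iexp (s * t) \<partial>lborel) = 0" for s
  proof -
    let ?f = "\<lambda>N t. g t *\<^sub>R (\<Sum>n<N. (\<i> * of_real (s * t)) ^ n / fact n)"
    have "(\<integral>t. ?f N t \<partial>lborel) = 0" for N
    proof -
      have *: "g t *\<^sub>R ((\<i> * of_real (s * t)) ^ n / fact n) = ((\<i> * of_real s) ^ n / fact n) * of_real (g t * (t ^ n * hermite 0 t))" for n t
        by (simp add: scaleR_conv_of_real power_mult_distrib)
      have "integrable lborel (\<lambda>t. g t * (t ^ n * hermite 0 t))" for n
        using int[of "\<lambda>t. t ^ n * hermite 0 t"] by (simp add: exp_bounded_intros)
      then show ?thesis
        unfolding scaleR_sum_right *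
        by (subst Bochner_Integration.integral_sum) (auto simp: moments[of _ 0, simplified] simp del: of_real_mult of_real_power)
    qed
    moreover have "(\<lambda>N. \<integral>t. ?f N t \<partial>lborel) \<longlonglongrightarrow> (\<integral>t. g t *\<^sub>R iexp (s * t) \<partial>lborel)"
    proof (rule integral_dominated_convergence)
      \<comment> \<open>All partial sums of the exponential series are dominated by
        \<open>exp (\<bar>s\<bar> * \<bar>t\<bar>)\<close>, which the Gaussian inside
        \<open>g\<close> can afford.\<close>
      show "integrable lborel (\<lambda>t. norm (g t *\<^sub>R exp (\<bar>s\<bar> * norm t)))"
        by (intro integrable_norm int exp_boundedI[of _ 1 "\<bar>s\<bar>"]) auto
      show "AE t in lborel. (\<lambda>N. ?f N t) \<longlonglongrightarrow> g t *\<^sub>R iexp (s * t)"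
      proof (rule AE_I2)
        fix t
        have "(\<lambda>n. (\<i> * of_real (s * t)) ^ n / fact n) sums iexp (s * t)"
          using exp_converges[of "\<i> * of_real (s * t)"] by (simp add: scaleR_conv_of_real divide_inverse mult.commute)
        then show "(\<lambda>N. ?f N t) \<longlonglongrightarrow> g t *\<^sub>R iexp (s * t)"
          unfolding sums_def by (intro tendsto_scaleR tendsto_const)
      qed
      fix N
      show "AE t in lborel. norm (?f N t) \<le> norm (g t *\<^sub>R exp (\<bar>s\<bar> * norm t))"
      proof (rule AE_I2)
        fix t
        have "norm (\<Sum>n<N. (\<i> * of_real (s * t)) ^ n / fact n) \<le> (\<Sum>n<N. norm ((\<i> * complex_of_real (s * t)) ^ n / fact n))"
          by (rule norm_sum)
        also have "\<dots> = (\<Sum>n<N. (\<bar>s\<bar> * norm t) ^ n / fact n)"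
          by (simp add: norm_divide norm_power norm_mult)
        also have "\<dots> \<le> (\<Sum>n. (\<bar>s\<bar> * norm t) ^ n / fact n)"
          using summable_exp_generic[of "\<bar>s\<bar> * norm t"]
          by (intro sum_le_suminf) (auto simp: divide_inverse mult.commute)
        also have "\<dots> = exp (\<bar>s\<bar> * norm t)"
          by (simp add: exp_def divide_inverse mult.commute)
        finally show "norm (?f N t) \<le> norm (g t *\<^sub>R exp (\<bar>s\<bar> * norm t))"
          by (simp add: abs_mult mult_left_mono)
      qed
    qed measurable
    ultimately show ?thesis
      by (simp add: LIMSEQ_const_iff)
  qed
  moreover have "integrable lborel g"
    using int[of "\<lambda>t. 1 :: real"] by (simp add: exp_bounded_intros)
  ultimately have "AE t in lborel. g t = 0"
    by (intro AE_eq_0_if_char_integral_eq_0)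
  then show ?thesis
    by eventually_elim (simp add: g_def)
qed

definition hermite_function :: "nat \<Rightarrow> real \<Rightarrow> quat" where
  "hermite_function j t = of_real (exp (- t\<^sup>2 / 2) * hermite j t / sqrt (2 ^ j * fact j * sqrt pi))"

lemma qcnj_hermite_function: "qcnj (hermite_function j t) = hermite_function j t"
  unfolding hermite_function_def by (rule qcnj_simps)

lemma qL2_half_gauss:
  assumes "exp_bounded F" and [measurable]: "F \<in> borel_measurable borel"
  shows "qL2 lborel (\<lambda>t. exp (- t\<^sup>2 / 2) *\<^sub>R F t)"
proof -
  have "(norm (exp (- t\<^sup>2 / 2) *\<^sub>R F t))\<^sup>2 = exp (- t\<^sup>2) *\<^sub>R (norm (F t))\<^sup>2" for t
    by (simp add: power_mult_distrib flip: exp_double)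
  moreover have "integrable lborel (\<lambda>t. exp (- t\<^sup>2) *\<^sub>R (norm (F t))\<^sup>2)"
    by (intro integrable_gauss exp_bounded_intros assms) measurable
  ultimately show ?thesis by (simp add: qL2_def)
qed

lemma qL2_hermite_function: "qL2 lborel (hermite_function j)"
proof -
  have [measurable]: "hermite j \<in> borel_measurable borel"
    by (rule borel_measurable_continuous_onI[OF continuous_hermite])
  have "qL2 lborel (\<lambda>t. exp (- t\<^sup>2 / 2) *\<^sub>R (of_real (hermite j t) * of_real (1 / sqrt (2 ^ j * fact j * sqrt pi))))"
    by (intro qL2_half_gauss exp_bounded_intros) measurable
  then show ?thesis
    by (simp add: hermite_function_def[abs_def] scaleR_conv_of_real)
qed

lemma hermite_orthogonal:
  "(\<integral>t. exp (- t\<^sup>2) * (hermite m t * hermite n t) \<partial>lborel) = (if m = n then 2 ^ n * fact n * sqrt pi else 0)"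
proof -
  have "complex_of_real (\<integral>t. exp (- t\<^sup>2) * (hermite m t * hermite n t) \<partial>lborel)
      = gauss_integral (\<lambda>t. of_real (hermite m t) * of_real (hermite n t))"
    unfolding gauss_integral_def by (simp add: scaleR_conv_of_real flip: integral_complex_of_real)
  then show ?thesis
    unfolding hermite_orthogonal_complex by (simp split: if_splits flip: of_real_eq_iff[where 'a = complex])
qed

interpretation line: orthonormal_sequence lborel hermite_function
proof
  fix i j
  show "qL2 lborel (hermite_function j)" by (rule qL2_hermite_function)
  have *: "qcnj (hermite_function i t) * hermite_function j t =
      of_real (exp (- t\<^sup>2) * (hermite i t * hermite j t) * (1 / (sqrt (2 ^ i * fact i * sqrt pi) * sqrt (2 ^ j * fact j * sqrt pi))))" for t
  proof -
    have "exp (- t\<^sup>2) = exp (- t\<^sup>2 / 2) * exp (- t\<^sup>2 / 2)" by (simp flip: exp_add)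
    then show ?thesis
      unfolding qcnj_hermite_function unfolding hermite_function_def of_real_mult[symmetric] by (simp add: mult_ac)
  qed
  have "qinner lborel (hermite_function i) (hermite_function j) =
     of_real ((\<integral>t. exp (- t\<^sup>2) * (hermite i t * hermite j t) \<partial>lborel) * (1 / (sqrt (2 ^ i * fact i * sqrt pi) * sqrt (2 ^ j * fact j * sqrt pi))))"
  proof -
    have "integrable lborel (\<lambda>t. exp (- t\<^sup>2) *\<^sub>R (hermite i t * hermite j t))"
      by (intro integrable_gauss exp_bounded_intros borel_measurable_continuous_onI continuous_intros)
    then have "integrable lborel (\<lambda>t. exp (- t\<^sup>2) * (hermite i t * hermite j t))" by simp
    from integral_bounded_linear[OF bounded_linear_of_real integrable_mult_left[OF this]]
    show ?thesis unfolding qinner_def * integral_mult_left_zero .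
  qed
  then show "qinner lborel (hermite_function i) (hermite_function j) = (if i = j then 1 else 0)"
    unfolding hermite_orthogonal by (simp flip: of_real_mult)
qed

text \<open>Hermite functions are real, so taking a real component commutes with the inner product,
  and the real case settles the four components separately.\<close>

lemma hermite_function_complete:
  assumes g: "qL2 lborel g" and orth: "\<And>j. qinner lborel (hermite_function j) g = 0"
  shows "AE t in lborel. g t = 0"
proof -
  have [measurable]: "g \<in> borel_measurable borel" using g by (simp add: qL2_def)
  have "AE t in lborel. u (g t) = 0" if u: "bounded_linear u" "\<And>q. \<bar>u q\<bar> \<le> norm q" for u :: "quat \<Rightarrow> real"
  proof (rule hermite_complete_real)
    have [measurable]: "u \<in> borel_measurable borel"
      by (intro borel_measurable_continuous_onI linear_continuous_on u)
    show "(\<lambda>t. u (g t)) \<in> borel_measurable borel" by measurable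
    show "integrable lborel (\<lambda>t. (u (g t))\<^sup>2)"
    proof (rule Bochner_Integration.integrable_bound)
      show "integrable lborel (\<lambda>t. (norm (g t))\<^sup>2)" using g by (simp add: qL2_def)
      show "AE t in lborel. norm ((u (g t))\<^sup>2) \<le> norm ((norm (g t))\<^sup>2)"
        using power_mono[OF u(2) abs_ge_zero, of _ 2] by simp
    qed measurable
    fix j
    let ?c = "sqrt (2 ^ j * fact j * sqrt pi)"
    have "0 = u (?c *\<^sub>R qinner lborel (hermite_function j) g)"
      unfolding orth by (simp add: linear_simps[OF u(1)])
    also have "\<dots> = (\<integral>t. u (?c *\<^sub>R (qcnj (hermite_function j t) * g t)) \<partial>lborel)"
      unfolding qinner_def using integrable_qinner[OF qL2_hermite_function g, of j]
      by (subst integral_bounded_linear[OF u(1)]) auto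
    also have "(\<lambda>t. u (?c *\<^sub>R (qcnj (hermite_function j t) * g t))) = (\<lambda>t. (exp (- t\<^sup>2 / 2) * u (g t)) * hermite j t)"
    proof
      fix t
      have "?c *\<^sub>R (qcnj (hermite_function j t) * g t) = (exp (- t\<^sup>2 / 2) * hermite j t) *\<^sub>R g t"
        unfolding qcnj_hermite_function unfolding hermite_function_def scaleR_conv_of_real mult.assoc[symmetric] of_real_mult[symmetric]
        by simp
      then show "u (?c *\<^sub>R (qcnj (hermite_function j t) * g t)) = (exp (- t\<^sup>2 / 2) * u (g t)) * hermite j t"
        by (simp add: linear_simps[OF u(1)] mult_ac)
    qed
    finally show "(\<integral>t. (exp (- t\<^sup>2 / 2) * u (g t)) * hermite j t \<partial>lborel) = 0" by simp
  qed
  note * = this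
  have b: "\<bar>qRe q\<bar> \<le> norm q" "\<bar>qIm1 q\<bar> \<le> norm q" "\<bar>qIm2 q\<bar> \<le> norm q" "\<bar>qIm3 q\<bar> \<le> norm q" for q
    by (auto simp: norm_quat_def intro!: real_le_rsqrt)
  have l: "bounded_linear qRe" "bounded_linear qIm1" "bounded_linear qIm2" "bounded_linear qIm3"
    by (rule bounded_linear_intro[where K = 1]; use b in simp)+
  show ?thesis
    using *[OF l(1) b(1)] *[OF l(2) b(2)] *[OF l(3) b(3)] *[OF l(4) b(4)]
    by eventually_elim (simp add: quat_eq_iff)
qed

lemma hermite_expansion:
  assumes "qL2 lborel f"
  shows "(\<lambda>n. qsqnorm lborel (\<lambda>x. f x - line.partial_sum (\<lambda>j. qinner lborel (hermite_function j) f) n x)) \<longlonglongrightarrow> 0"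
  using hermite_function_complete assms by (rule line.expansion_if_complete)

section \<open>Slices and the transform\<close>

text \<open>For an imaginary unit \<open>J\<close> this is an isometric algebra homomorphism that
  respects conjugation; it carries the complex computations to the quaternions.\<close>

definition slice_embed :: "quat \<Rightarrow> complex \<Rightarrow> quat" where
  "slice_embed J z = of_real (Re z) + of_real (Im z) * J"

lemma imag_units_mult_self: "J \<in> imag_units \<Longrightarrow> J * J = - 1"
  by (simp add: imag_units_def power2_eq_square)

lemma norm_imag_unit: "J \<in> imag_units \<Longrightarrow> norm J = 1"
proof -
  assume "J \<in> imag_units"
  then have "(norm J)\<^sup>2 = 1"
    using norm_mult[of J J] by (simp add: imag_units_mult_self power2_eq_square)
  then show ?thesis by (metis norm_ge_zero one_power2 power2_eq_imp_eq zero_le_one)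
qed

lemma qcnj_imag_unit:
  assumes "J \<in> imag_units"
  shows "qcnj J = - J"
proof -
  have "qcnj J * J * J = J"
    unfolding qcnj_mult_self by (simp add: norm_imag_unit[OF assms])
  then have "- qcnj J = J" by (simp add: mult.assoc imag_units_mult_self[OF assms])
  then show ?thesis by (metis minus_minus)
qed

text \<open>A real quaternion lies on every slice; otherwise \<open>J\<close> is the normalised
  imaginary part. Pointwise identities in \<open>q\<close> can therefore be checked in the complex
  plane.\<close>

lemma slice_embed_cases:
  obtains J z where "J \<in> imag_units" "q = slice_embed J z"
proof (cases "qIm1 q = 0 \<and> qIm2 q = 0 \<and> qIm3 q = 0")
  case True
  show ?thesis
  proof (rule that)
    show "Quat 0 1 0 0 \<in> imag_units"
      by (simp add: imag_units_def power2_eq_square quat_eq_iff quat_sel_mult)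
    show "q = slice_embed (Quat 0 1 0 0) (of_real (qRe q))"
      using True by (simp add: slice_embed_def quat_eq_iff)
  qed
next
  case False
  define r where "r = sqrt ((qIm1 q)\<^sup>2 + (qIm2 q)\<^sup>2 + (qIm3 q)\<^sup>2)"
  have "(qIm1 q)\<^sup>2 + (qIm2 q)\<^sup>2 + (qIm3 q)\<^sup>2 > 0"
    using False by (auto simp: add_nonneg_pos add_pos_nonneg)
  then have r: "r > 0" "r\<^sup>2 = (qIm1 q)\<^sup>2 + (qIm2 q)\<^sup>2 + (qIm3 q)\<^sup>2"
    by (auto simp: r_def)
  show ?thesis
  proof (rule that)
    have "(qIm1 q)\<^sup>2 / r\<^sup>2 + (qIm2 q)\<^sup>2 / r\<^sup>2 + (qIm3 q)\<^sup>2 / r\<^sup>2 = 1"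
      unfolding add_divide_distrib[symmetric] r(2)[symmetric] using r(1) by simp
    then show "Quat 0 (qIm1 q / r) (qIm2 q / r) (qIm3 q / r) \<in> imag_units"
      by (simp add: imag_units_def quat_eq_iff power2_eq_square[of "Quat a b c d" for a b c d] quat_sel_mult)
        (simp add: power2_eq_square)
    show "q = slice_embed (Quat 0 (qIm1 q / r) (qIm2 q / r) (qIm3 q / r)) (Complex (qRe q) r)"
      using r(1) by (simp add: slice_embed_def quat_eq_iff quat_sel_mult)
  qed
qed

lemma slice_embed_scaleR: "slice_embed J (r *\<^sub>R z) = r *\<^sub>R slice_embed J z"
  by (simp add: slice_embed_def scaleR_conv_of_real algebra_simps)

lemma slice_embed_add: "slice_embed J (z + w) = slice_embed J z + slice_embed J w"
  by (simp add: slice_embed_def algebra_simps)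

lemma slice_embed_of_real [simp]: "slice_embed J (of_real r) = of_real r"
  by (simp add: slice_embed_def)

lemma slice_embed_1 [simp]: "slice_embed J 1 = 1"
  using slice_embed_of_real[of J 1] by simp

context
  fixes J assumes J: "J \<in> imag_units"
begin

lemma slice_embed_mult: "slice_embed J (z * w) = slice_embed J z * slice_embed J w"
  by (simp add: slice_embed_def of_real_def algebra_simps imag_units_mult_self[OF J])

lemma slice_embed_power: "slice_embed J (z ^ n) = slice_embed J z ^ n"
  by (induction n) (simp_all add: slice_embed_mult)

lemma qcnj_slice_embed: "qcnj (slice_embed J z) = slice_embed J (cnj z)"
  by (simp add: slice_embed_def qcnj_add qcnj_mult qcnj_imag_unit[OF J] of_real_def qcnj_scaleR)

lemma norm_slice_embed: "norm (slice_embed J z) = norm z"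
proof -
  have "of_real ((norm (slice_embed J z))\<^sup>2) = (of_real ((norm z)\<^sup>2) :: quat)"
    unfolding mult_qcnj[symmetric] qcnj_slice_embed slice_embed_mult[symmetric] complex_norm_square[symmetric]
    by (rule slice_embed_of_real)
  then show ?thesis by (simp only: of_real_eq_iff) simp
qed

lemma bounded_linear_slice_embed: "bounded_linear (slice_embed J)"
  by (rule bounded_linear_intro[where K = 1]) (simp_all add: slice_embed_add slice_embed_scaleR norm_slice_embed)

lemma exp_slice_embed: "exp (slice_embed J z) = slice_embed J (exp z)"
proof -
  have "(\<lambda>n. slice_embed J (z ^ n /\<^sub>R fact n)) sums slice_embed J (exp z)"
    by (rule bounded_linear.sums[OF bounded_linear_slice_embed exp_converges])
  then have "(\<lambda>n. slice_embed J z ^ n /\<^sub>R fact n) sums slice_embed J (exp z)"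
    by (simp only: slice_embed_scaleR slice_embed_power)
  with exp_converges show ?thesis by (rule sums_unique2)
qed

lemma slice_embed_sum: "slice_embed J (sum f A) = (\<Sum>x\<in>A. slice_embed J (f x))"
  by (rule bounded_linear.linear[OF bounded_linear_slice_embed, THEN linear_sum])

lemma quat_hermite_slice_embed: "quat_hermite m n (slice_embed J z) = slice_embed J (ito_hermite m n z)"
proof -
  have "ito_hermite m n z = (\<Sum>j\<le>min m n. (fact m * fact n * ((-1) ^ j / fact j) / (fact (m - j) * fact (n - j))) *\<^sub>R (z ^ (m - j) * cnj z ^ (n - j)))"
    unfolding ito_hermite_eq_sum[OF order_refl]
  proof (rule sum.cong[OF refl])
    fix j assume "j \<in> {..min m n}"
    then have choose: "of_nat (m choose j) = (fact m / (fact j * fact (m - j)) :: complex)"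
        "of_nat (n choose j) = (fact n / (fact j * fact (n - j)) :: complex)"
      by (auto intro: binomial_fact)
    show "ito_term m n z (cnj z) j = (fact m * fact n * ((-1) ^ j / fact j) / (fact (m - j) * fact (n - j))) *\<^sub>R (z ^ (m - j) * cnj z ^ (n - j))"
      unfolding ito_term_def choose by (simp add: scaleR_conv_of_real field_simps)
  qed
  then have "slice_embed J (ito_hermite m n z) = (\<Sum>j\<le>min m n. (fact m * fact n * ((-1) ^ j / fact j) / (fact (m - j) * fact (n - j))) *\<^sub>R
      (slice_embed J z ^ (m - j) * qcnj (slice_embed J z) ^ (n - j)))"
    by (simp only: slice_embed_sum slice_embed_scaleR slice_embed_mult slice_embed_power qcnj_slice_embed)
  then show ?thesis
    unfolding quat_hermite_def scaleR_sum_right scaleR_scaleR by (simp add: divide_inverse mult.assoc)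
qed

end

section \<open>The kernel and its Hermite coefficients\<close>

definition quat_kernel :: "nat \<Rightarrow> quat \<Rightarrow> real \<Rightarrow> quat" where
  "quat_kernel k q t = exp (- ((of_real t)\<^sup>2 + q\<^sup>2) / 2 + of_real (sqrt 2) * q * of_real t)
       * of_real (hermite k (qRe ((q + qcnj q) /\<^sub>R sqrt 2) - t))"

lemma transform_integrand_eq: "transform_integrand k \<phi> q t = quat_kernel k q t * \<phi> t"
  by (simp add: transform_integrand_def quat_kernel_def)

lemma quat_kernel_slice_embed:
  assumes J: "J \<in> imag_units"
  shows "quat_kernel k (slice_embed J z) t =
    exp (- t\<^sup>2 / 2) *\<^sub>R slice_embed J (exp (- (z\<^sup>2 / 2)) * shifted_kernel k z t)"
proof -
  have 1: "- (1 / 2) *\<^sub>R (slice_embed J z)\<^sup>2 = slice_embed J (- (z\<^sup>2 / 2))"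
  proof -
    have "- (1 / 2) *\<^sub>R (slice_embed J z)\<^sup>2 = slice_embed J (- (1 / 2) *\<^sub>R z\<^sup>2)"
      by (simp only: slice_embed_scaleR slice_embed_power[OF J])
    also have "- (1 / 2) *\<^sub>R z\<^sup>2 = - (z\<^sup>2 / 2)"
      by (simp add: scaleR_conv_of_real)
    finally show ?thesis .
  qed
  have 2: "t *\<^sub>R (sqrt 2 *\<^sub>R slice_embed J z) = slice_embed J (of_real (sqrt 2) * z * of_real t)"
  proof -
    have "t *\<^sub>R (sqrt 2 *\<^sub>R slice_embed J z) = slice_embed J (t *\<^sub>R (sqrt 2 *\<^sub>R z))"
      by (simp only: slice_embed_scaleR)
    also have "t *\<^sub>R (sqrt 2 *\<^sub>R z) = of_real (sqrt 2) * z * of_real t"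
      by (simp add: scaleR_conv_of_real)
    finally show ?thesis .
  qed
  have 3: "qRe ((slice_embed J z + qcnj (slice_embed J z)) /\<^sub>R sqrt 2) = sqrt 2 * Re z"
  proof -
    have "slice_embed J z + qcnj (slice_embed J z) = of_real (2 * Re z)"
      unfolding qcnj_slice_embed[OF J] slice_embed_add[symmetric] complex_add_cnj slice_embed_of_real ..
    then have "qRe ((slice_embed J z + qcnj (slice_embed J z)) /\<^sub>R sqrt 2) = 2 * Re z / sqrt 2"
      by (simp only: quat_sel_scaleR quat_of_real_sel divide_inverse mult.commute)
    then show ?thesis by (simp add: field_simps)
  qed
  show ?thesis
    unfolding quat_kernel_def exp_kernel_split 1 2 3 exp_slice_embed[OF J]
    by (simp add: slice_embed_mult[OF J] shifted_kernel_def mult.assoc)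
qed

text \<open>The conjugate appears because the transform at \<open>q\<close> is the inner product of
  this function with \<phi>.\<close>

lemma qL2_quat_kernel: "qL2 lborel (\<lambda>t. qcnj (quat_kernel k q t))"
proof -
  obtain J z where J: "J \<in> imag_units" and q: "q = slice_embed J z"
    by (rule slice_embed_cases)
  have "exp_bounded (\<lambda>t. exp (- (z\<^sup>2 / 2)) * shifted_kernel k z t)"
    by (intro exp_bounded_intros)
  then have 1: "exp_bounded (\<lambda>t. slice_embed J (exp (- (z\<^sup>2 / 2)) * shifted_kernel k z t))"
    by (simp add: exp_bounded_def norm_slice_embed[OF J])
  have "continuous_on UNIV (\<lambda>t. slice_embed J (exp (- (z\<^sup>2 / 2)) * shifted_kernel k z t))"
    by (intro bounded_linear.continuous_on[OF bounded_linear_slice_embed[OF J]] continuous_intros)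
  then have "(\<lambda>t. slice_embed J (exp (- (z\<^sup>2 / 2)) * shifted_kernel k z t)) \<in> borel_measurable borel"
    by (rule borel_measurable_continuous_onI)
  from qL2_half_gauss[OF 1 this] have "qL2 lborel (quat_kernel k q)"
    unfolding q quat_kernel_slice_embed[OF J, abs_def] .
  then show ?thesis by (auto simp: qL2_def)
qed

lemma integrable_transform_integrand:
  assumes "qL2 lborel \<phi>"
  shows "integrable lborel (transform_integrand k \<phi> q)"
  using integrable_qinner[OF qL2_quat_kernel assms] by (simp add: transform_integrand_eq[abs_def])

definition normalized_hermite :: "nat \<Rightarrow> nat \<Rightarrow> quat \<Rightarrow> quat" where
  "normalized_hermite k j q = quat_hermite j k q /\<^sub>R sqrt (pi * fact j * fact k)"

text \<open>The factors come from the transform, from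
  \<open>gauss_integral_hermite_shifted_kernel\<close> and from the normalisation of the Hermite
  functions. The exponent 3/4 is what turns \<open>pi\<close> to the power 1/2 - 1/4 into the power
  -1/2 on the right.\<close>

lemma transform_constant:
  "(1 / pi) powr (3 / 4) * (1 / sqrt (2 ^ k * fact k)) * (sqrt pi * sqrt 2 ^ (j + k) / sqrt (2 ^ j * fact j * sqrt pi))
     = 1 / sqrt (pi * fact j * fact k)"
proof -
  \<comment> \<open>The fourth root makes every power of \<open>pi\<close> involved an integral
    power.\<close>
  define p where "p = pi powr (1 / 4)"
  have p: "p > 0" by (simp add: p_def)
  have "p ^ 2 = pi powr (1 / 2)"
    unfolding p_def by (subst powr_realpow[symmetric]) (simp_all add: powr_powr)
  then have s: "sqrt pi = p ^ 2" by (simp add: powr_half_sqrt)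
  then have ss: "sqrt (sqrt pi) = p" using p by simp
  have "(1 / pi) powr (3 / 4) = 1 / (pi powr (3 / 4))"
    by (simp add: powr_divide)
  also have "pi powr (3 / 4) = p ^ 3"
    unfolding p_def by (subst powr_realpow[symmetric]) (simp_all add: powr_powr)
  finally have 3: "(1 / pi) powr (3 / 4) = 1 / p ^ 3" .
  show ?thesis
    unfolding 3 real_sqrt_mult ss s using p
    by (simp add: real_sqrt_power power_add field_simps power2_eq_square power3_eq_cube)
qed

lemma qinner_hermite_function_kernel:
  "qinner lborel (hermite_function j) (\<lambda>t. qcnj (quat_kernel k q t)) =
     (sqrt pi * sqrt 2 ^ (j + k) / sqrt (2 ^ j * fact j * sqrt pi)) *\<^sub>R qcnj (quat_hermite j k q)"
proof -
  obtain J z where J: "J \<in> imag_units" and q: "q = slice_embed J z"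
    by (rule slice_embed_cases)
  let ?c = "1 / sqrt (2 ^ j * fact j * sqrt pi)"
  let ?f = "\<lambda>t. of_real (hermite j t) * shifted_kernel k z t"
  have *: "qcnj (hermite_function j t) * qcnj (quat_kernel k q t)
      = ?c *\<^sub>R qcnj (slice_embed J (exp (- (z\<^sup>2 / 2)) * (exp (- t\<^sup>2) *\<^sub>R ?f t)))" for t
  proof -
    have "exp (- t\<^sup>2) = exp (- t\<^sup>2 / 2) * exp (- t\<^sup>2 / 2)" by (simp flip: exp_add)
    have "qcnj (hermite_function j t) * qcnj (quat_kernel k q t) =
       (exp (- t\<^sup>2 / 2) * hermite j t * ?c) *\<^sub>R (exp (- t\<^sup>2 / 2) *\<^sub>R qcnj (slice_embed J (exp (- (z\<^sup>2 / 2)) * shifted_kernel k z t)))"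
      unfolding q quat_kernel_slice_embed[OF J] qcnj_hermite_function qcnj_scaleR
      unfolding hermite_function_def by (simp add: scaleR_conv_of_real)
    also have "\<dots> = (?c * (exp (- t\<^sup>2) * hermite j t)) *\<^sub>R qcnj (slice_embed J (exp (- (z\<^sup>2 / 2)) * shifted_kernel k z t))"
      unfolding \<open>exp (- t\<^sup>2) = exp (- t\<^sup>2 / 2) * exp (- t\<^sup>2 / 2)\<close> by (simp add: mult_ac)
    also have "\<dots> = ?c *\<^sub>R qcnj (slice_embed J ((exp (- t\<^sup>2) * hermite j t) *\<^sub>R (exp (- (z\<^sup>2 / 2)) * shifted_kernel k z t)))"
      unfolding slice_embed_scaleR qcnj_scaleR by simp
    also have "(exp (- t\<^sup>2) * hermite j t) *\<^sub>R (exp (- (z\<^sup>2 / 2)) * shifted_kernel k z t) = exp (- (z\<^sup>2 / 2)) * (exp (- t\<^sup>2) *\<^sub>R ?f t)"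
      by (simp add: scaleR_conv_of_real mult_ac)
    finally show ?thesis .
  qed
  \<comment> \<open>The fixed factors, the embedding and the conjugation form one real-linear
    bounded map, which is pulled out of the integral in a single step.\<close>
  have bl: "bounded_linear (\<lambda>w. ?c *\<^sub>R qcnj (slice_embed J (exp (- (z\<^sup>2 / 2)) * w)))"
    by (intro bounded_linear_const_scaleR bounded_linear_compose[OF bounded_linear_qcnj]
        bounded_linear_compose[OF bounded_linear_slice_embed[OF J]] bounded_linear_mult_right)
  have int: "integrable lborel (\<lambda>t. exp (- t\<^sup>2) *\<^sub>R ?f t)"
    by (intro integrable_gauss exp_bounded_intros borel_measurable_continuous_onI continuous_intros)
  have "qinner lborel (hermite_function j) (\<lambda>t. qcnj (quat_kernel k q t)) =
      ?c *\<^sub>R qcnj (slice_embed J (exp (- (z\<^sup>2 / 2)) * gauss_integral ?f))"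
    unfolding qinner_def * gauss_integral_def by (rule integral_bounded_linear[OF bl int])
  also have "exp (- (z\<^sup>2 / 2)) * gauss_integral ?f = (sqrt pi * sqrt 2 ^ (j + k)) *\<^sub>R ito_hermite j k z"
    unfolding gauss_integral_hermite_shifted_kernel by (simp add: scaleR_conv_of_real exp_minus)
  finally show ?thesis
    unfolding q quat_hermite_slice_embed[OF J] by (simp add: slice_embed_scaleR qcnj_scaleR)
qed

text \<open>Parseval for the conjugated kernel, with \<open>q\<close> fixed: convergence in the mean
  on the line gives convergence at every single point \<open>q\<close>.\<close>

lemma transform_sums:
  assumes \<phi>: "qL2 lborel \<phi>"
  shows "(\<lambda>j. normalized_hermite k j q * qinner lborel (hermite_function j) \<phi>) sums
    (((1 / pi) powr (3 / 4) * (1 / sqrt (2 ^ k * fact k))) *\<^sub>R (\<integral>t. transform_integrand k \<phi> q t \<partial>lborel))"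
proof -
  let ?C = "(1 / pi) powr (3 / 4) * (1 / sqrt (2 ^ k * fact k))"
  let ?K = "\<lambda>t. qcnj (quat_kernel k q t)"
  have "(\<lambda>j. qcnj (qinner lborel (hermite_function j) ?K) * qinner lborel (hermite_function j) \<phi>) sums qinner lborel ?K \<phi>"
    by (rule line.Parseval_sums[OF qL2_quat_kernel hermite_expansion[OF qL2_quat_kernel] \<phi>])
  then have "(\<lambda>j. ?C *\<^sub>R (qcnj (qinner lborel (hermite_function j) ?K) * qinner lborel (hermite_function j) \<phi>)) sums (?C *\<^sub>R qinner lborel ?K \<phi>)"
    by (rule sums_scaleR_right)
  moreover have "?C *\<^sub>R (qcnj (qinner lborel (hermite_function j) ?K) * qinner lborel (hermite_function j) \<phi>)
      = normalized_hermite k j q * qinner lborel (hermite_function j) \<phi>" for j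
  proof -
    have "?C *\<^sub>R qcnj (qinner lborel (hermite_function j) ?K) = normalized_hermite k j q"
      unfolding qinner_hermite_function_kernel qcnj_scaleR scaleR_scaleR transform_constant normalized_hermite_def
      by (simp add: divide_inverse)
    then show ?thesis by (metis mult_scaleR_left)
  qed
  moreover have "qinner lborel ?K \<phi> = (\<integral>t. transform_integrand k \<phi> q t \<partial>lborel)"
    by (simp add: qinner_def transform_integrand_eq)
  ultimately show ?thesis by simp
qed

section \<open>The target space and its inner product on a slice\<close>

lemma SR2_iff:
  "f \<in> SR2 k \<longleftrightarrow> (\<exists>a. summable (\<lambda>j. (norm (a j))\<^sup>2) \<and> (\<forall>q. (\<lambda>j. normalized_hermite k j q * a j) sums f q))"
proof
  let ?r = "\<lambda>j. sqrt (pi * fact j * fact k)"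
  have r: "?r j > 0" "(?r j)\<^sup>2 = pi * fact j * fact k" for j
    by simp_all
  {
    assume "f \<in> SR2 k"
    then obtain c where c: "summable (\<lambda>j. fact j * (norm (c j))\<^sup>2)" "\<And>q. (\<lambda>j. quat_hermite j k q * c j) sums f q"
      by (auto simp: SR2_def)
    show "\<exists>a. summable (\<lambda>j. (norm (a j))\<^sup>2) \<and> (\<forall>q. (\<lambda>j. normalized_hermite k j q * a j) sums f q)"
    \<comment> \<open>The normaliser moves into the coefficients; its square contains
      \<open>fact j\<close>, which accounts for the weight in \<open>SR2\<close>.\<close>
    proof (intro exI[of _ "\<lambda>j. ?r j *\<^sub>R c j"] conjI allI)
      have "(norm (?r j *\<^sub>R c j))\<^sup>2 = (pi * fact k) * (fact j * (norm (c j))\<^sup>2)" for j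
        using r(2)[of j] by (simp add: power_mult_distrib mult_ac)
      then show "summable (\<lambda>j. (norm (?r j *\<^sub>R c j))\<^sup>2)"
        using summable_mult[OF c(1), of "pi * fact k"] by simp
      have "normalized_hermite k j q * (?r j *\<^sub>R c j) = quat_hermite j k q * c j" for j q
        using r(1)[of j] unfolding normalized_hermite_def by simp
      then show "(\<lambda>j. normalized_hermite k j q * (?r j *\<^sub>R c j)) sums f q" for q
        using c(2) by simp
    qed
  next
    assume "\<exists>a. summable (\<lambda>j. (norm (a j))\<^sup>2) \<and> (\<forall>q. (\<lambda>j. normalized_hermite k j q * a j) sums f q)"
    then obtain a where a: "summable (\<lambda>j. (norm (a j))\<^sup>2)" "\<And>q. (\<lambda>j. normalized_hermite k j q * a j) sums f q"
      by blast
    show "f \<in> SR2 k"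
      unfolding SR2_def mem_Collect_eq
    proof (intro exI[of _ "\<lambda>j. a j /\<^sub>R ?r j"] conjI allI)
      have "fact j * (norm (a j /\<^sub>R ?r j))\<^sup>2 = (1 / (pi * fact k)) * (norm (a j))\<^sup>2" for j
      proof -
        have "(norm (a j /\<^sub>R ?r j))\<^sup>2 = (norm (a j))\<^sup>2 / (?r j)\<^sup>2"
          unfolding norm_scaleR power_mult_distrib power2_abs power_inverse by (simp only: divide_inverse mult.commute)
        then show ?thesis unfolding r(2) by simp
      qed
      then show "summable (\<lambda>j. fact j * (norm (a j /\<^sub>R ?r j))\<^sup>2)"
        using summable_mult[OF a(1), of "1 / (pi * fact k)"] by simp
      have "quat_hermite j k q * (a j /\<^sub>R ?r j) = normalized_hermite k j q * a j" for j q
        unfolding normalized_hermite_def by simp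
      then show "(\<lambda>j. quat_hermite j k q * (a j /\<^sub>R ?r j)) sums f q" for q
        using a(2) by simp
    qed
  }
qed

text \<open>Each factor of the inner product takes the square root of the Gaussian weight, so that
  \<open>slice_inner\<close> becomes an unweighted \<open>qinner\<close>.\<close>

definition weighted_hermite :: "nat \<Rightarrow> nat \<Rightarrow> quat \<Rightarrow> quat" where
  "weighted_hermite k j q = exp (- (norm q)\<^sup>2 / 2) *\<^sub>R normalized_hermite k j q"

lemma continuous_on_qcnj [continuous_intros]: "continuous_on A f \<Longrightarrow> continuous_on A (\<lambda>x. qcnj (f x))"
  by (rule bounded_linear.continuous_on[OF bounded_linear_qcnj])

lemma weighted_hermite_measurable [measurable]: "weighted_hermite k j \<in> borel_measurable borel"
  unfolding weighted_hermite_def[abs_def] normalized_hermite_def[abs_def] quat_hermite_def[abs_def]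
  by (intro borel_measurable_continuous_onI continuous_intros) simp_all

lemma weighted_hermite_slice_embed:
  assumes J: "J \<in> imag_units"
  shows "weighted_hermite k j (slice_embed J z) =
    (exp (- (norm z)\<^sup>2 / 2) / sqrt (pi * fact j * fact k)) *\<^sub>R slice_embed J (ito_hermite j k z)"
  unfolding weighted_hermite_def normalized_hermite_def norm_slice_embed[OF J]
    quat_hermite_slice_embed[OF J] scaleR_scaleR divide_inverse ..

lemma slice_embed_measurable: "slice_embed J \<in> borel_measurable lborel"
  using slice_embedding_measurable[of J] by (simp add: slice_embed_def[abs_def])

lemma slice_measure_eq: "slice_measure J = distr lborel borel (slice_embed J)"
  by (simp add: slice_measure_def slice_embed_def[abs_def])

lemma orthonormal_weighted_hermite:
  assumes J: "J \<in> imag_units"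
  shows "orthonormal_sequence (slice_measure J) (weighted_hermite k)"
proof
  fix i j
  have half: "exp (- r\<^sup>2) = exp (- r\<^sup>2 / 2) * exp (- r\<^sup>2 / 2)" for r :: real
    by (simp flip: exp_add)
  have "integrable lborel (\<lambda>z. exp (- (norm z)\<^sup>2) *\<^sub>R ((1 / sqrt (pi * fact j * fact k))\<^sup>2 * (norm (ito_hermite j k z))\<^sup>2))"
    by (intro integrable_gauss_plane exp_bounded_intros borel_measurable_continuous_onI continuous_intros)
  also have "(\<lambda>z. exp (- (norm z)\<^sup>2) *\<^sub>R ((1 / sqrt (pi * fact j * fact k))\<^sup>2 * (norm (ito_hermite j k z))\<^sup>2))
      = (\<lambda>z. (norm (weighted_hermite k j (slice_embed J z)))\<^sup>2)"
    unfolding weighted_hermite_slice_embed[OF J] norm_scaleR norm_slice_embed[OF J] half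
    by (simp add: power_mult_distrib power_divide power2_eq_square[of "exp _"])
  finally show "qL2 (slice_measure J) (weighted_hermite k j)"
    unfolding qL2_def slice_measure_eq
    by (subst integrable_distr_eq[OF slice_embed_measurable]) auto
  let ?c = "\<lambda>j. 1 / sqrt (pi * fact j * fact k)"
  have *: "qcnj (weighted_hermite k i (slice_embed J z)) * weighted_hermite k j (slice_embed J z)
      = (?c i * ?c j) *\<^sub>R slice_embed J (exp (- (norm z)\<^sup>2) *\<^sub>R (ito_hermite j k z * ito_hermite k i z))" for z
  proof -
    have "qcnj (weighted_hermite k i (slice_embed J z)) * weighted_hermite k j (slice_embed J z) =
      (?c i * ?c j * exp (- (norm z)\<^sup>2)) *\<^sub>R (slice_embed J (ito_hermite k i z) * slice_embed J (ito_hermite j k z))"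
      unfolding weighted_hermite_slice_embed[OF J] qcnj_scaleR qcnj_slice_embed[OF J] cnj_ito_hermite half
      by simp
    then show ?thesis
      by (simp add: slice_embed_scaleR slice_embed_mult[OF J, symmetric] mult.commute[of "ito_hermite k i z"])
  qed
  have "qinner (slice_measure J) (weighted_hermite k i) (weighted_hermite k j) =
      (\<integral>z. (?c i * ?c j) *\<^sub>R slice_embed J (exp (- (norm z)\<^sup>2) *\<^sub>R (ito_hermite j k z * ito_hermite k i z)) \<partial>lborel)"
    unfolding qinner_def slice_measure_eq by (subst integral_distr[OF slice_embed_measurable]) (auto simp: *)
  also have "\<dots> = (?c i * ?c j) *\<^sub>R slice_embed J (plane_integral (\<lambda>z. ito_hermite j k z * ito_hermite k i z))"
    unfolding plane_integral_def
    by (rule integral_bounded_linear[OF bounded_linear_const_scaleR[OF bounded_linear_slice_embed[OF J]]])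
      (intro integrable_gauss_plane exp_bounded_intros borel_measurable_continuous_onI continuous_intros)
  also have "\<dots> = (if i = j then 1 else 0)"
  proof (cases "i = j")
    case True
    have "plane_integral (\<lambda>z. ito_hermite j k z * ito_hermite k i z) = of_real (pi * fact j * fact k)"
      unfolding True ito_hermite_orthogonal by (rule if_P[OF refl])
    then show ?thesis
      using True by (simp only: slice_embed_of_real) (simp add: of_real_def)
  next
    case False
    then show ?thesis
      unfolding ito_hermite_orthogonal using slice_embed_of_real[of J 0] by simp
  qed
  finally show "qinner (slice_measure J) (weighted_hermite k i) (weighted_hermite k j) = (if i = j then 1 else 0)" .
qed

text \<open>A pointwise convergent series with square summable coefficients also converges in the
  mean on the slice, which is all that Parseval asks for. The sum does not mention \<open>J\<close>,
  whence the independence of the slice.\<close>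

lemma slice_inner_sums:
  assumes J: "J \<in> imag_units"
    and a: "summable (\<lambda>j. (norm (a j))\<^sup>2)" "\<And>q. (\<lambda>j. normalized_hermite k j q * a j) sums f q"
    and b: "summable (\<lambda>j. (norm (b j))\<^sup>2)" "\<And>q. (\<lambda>j. normalized_hermite k j q * b j) sums g q"
  shows "(\<lambda>j. qcnj (a j) * b j) sums slice_inner J f g"
proof -
  interpret slice: orthonormal_sequence "slice_measure J" "weighted_hermite k"
    by (rule orthonormal_weighted_hermite[OF J])
  let ?w = "\<lambda>f q. exp (- (norm q)\<^sup>2 / 2) *\<^sub>R f q :: quat"
  have *: "qL2 (slice_measure J) (?w f)"
      "(\<lambda>n. qsqnorm (slice_measure J) (\<lambda>q. ?w f q - slice.partial_sum a n q)) \<longlonglongrightarrow> 0"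
    if a: "summable (\<lambda>j. (norm (a j))\<^sup>2)" "\<And>q. (\<lambda>j. normalized_hermite k j q * a j) sums f q" for a f
  proof -
    have lim: "(\<lambda>n. slice.partial_sum a n q) \<longlonglongrightarrow> ?w f q" for q
    proof -
      have "slice.partial_sum a n q = exp (- (norm q)\<^sup>2 / 2) *\<^sub>R (\<Sum>j<n. normalized_hermite k j q * a j)" for n
        by (simp add: slice.partial_sum_def weighted_hermite_def scaleR_sum_right)
      then show ?thesis
        using a(2)[of q] unfolding sums_def by (auto intro: tendsto_scaleR)
    qed
    have meas: "?w f \<in> borel_measurable (slice_measure J)"
      by (rule borel_measurable_LIMSEQ_metric[OF qL2_measurable[OF slice.qL2_partial_sum] lim])
    show "qL2 (slice_measure J) (?w f)"
      "(\<lambda>n. qsqnorm (slice_measure J) (\<lambda>q. ?w f q - slice.partial_sum a n q)) \<longlonglongrightarrow> 0"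
      using slice.qL2_limit_of_partial_sums[OF a(1) strict_mono_id meas] lim by auto
  qed
  have "(\<lambda>j. qcnj (a j) * qinner (slice_measure J) (weighted_hermite k j) (?w g)) sums qinner (slice_measure J) (?w f) (?w g)"
    by (rule slice.Parseval_sums[OF *[OF a] *(1)[OF b]])
  then have "(\<lambda>j. qcnj (a j) * b j) sums qinner (slice_measure J) (?w f) (?w g)"
    by (simp only: slice.coefficient_unique[OF *[OF b]])
  moreover have "qinner (slice_measure J) (?w f) (?w g) = slice_inner J f g"
  proof -
    have "exp (- r\<^sup>2) = exp (- r\<^sup>2 / 2) * exp (- r\<^sup>2 / 2)" for r :: real
      by (simp flip: exp_add)
    then show ?thesis
      unfolding qinner_def slice_inner_def by (simp add: qcnj_scaleR of_real_def)
  qed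
  ultimately show ?thesis by simp
qed

section \<open>Hermite coordinates and the isomorphism\<close>

lemma qL2_lborel_iff: "qL2 lborel \<phi> \<longleftrightarrow> square_integrable \<phi>"
  by (simp add: qL2_def square_integrable_def)

lift_definition hermite_coeff :: "L2_quat \<Rightarrow> nat \<Rightarrow> quat" is
  "\<lambda>\<phi> j. qinner lborel (hermite_function j) \<phi>"
proof (elim conjE, rule ext)
  fix j and f g :: "real \<Rightarrow> quat"
  assume "square_integrable f" "square_integrable g" and eq: "AE t in lborel. f t = g t"
  moreover have "hermite_function j \<in> borel_measurable lborel"
    by (rule qL2_measurable[OF qL2_hermite_function])
  moreover from eq have "AE t in lborel. qcnj (hermite_function j t) * f t = qcnj (hermite_function j t) * g t"
    by eventually_elim simp
  ultimately show "qinner lborel (hermite_function j) f = qinner lborel (hermite_function j) g"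
    unfolding qinner_def square_integrable_def by (intro integral_cong_AE) auto
qed

lemma hermite_coeff_add: "hermite_coeff (L2_add x y) j = hermite_coeff x j + hermite_coeff y j"
  by transfer (simp add: qinner_add_right qL2_hermite_function flip: qL2_lborel_iff)

lemma hermite_coeff_scale: "hermite_coeff (L2_scale x c) j = hermite_coeff x j * c"
  by transfer (simp add: qinner_scale_right qL2_hermite_function flip: qL2_lborel_iff)

lemma summable_hermite_coeff: "summable (\<lambda>j. (norm (hermite_coeff x j))\<^sup>2)"
  by transfer (simp add: line.Bessel_summable flip: qL2_lborel_iff)

lemma L2_inner_sums: "(\<lambda>j. qcnj (hermite_coeff x j) * hermite_coeff y j) sums L2_inner x y"
proof (transfer, elim conjE)
  fix f g :: "real \<Rightarrow> quat"
  assume "square_integrable f" "square_integrable g"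
  then have f: "qL2 lborel f" and g: "qL2 lborel g" by (simp_all add: qL2_lborel_iff)
  show "(\<lambda>j. qcnj (qinner lborel (hermite_function j) f) * qinner lborel (hermite_function j) g)
      sums (\<integral>t. qcnj (f t) * g t \<partial>lborel)"
    using line.Parseval_sums[OF f hermite_expansion[OF f] g] by (simp add: qinner_def)
qed

lemma segal_bargmann_sums: "(\<lambda>j. normalized_hermite k j q * hermite_coeff x j) sums segal_bargmann k x q"
  by transfer (rule transform_sums, simp add: qL2_lborel_iff)

lemma hermite_coeff_inject:
  assumes "hermite_coeff x = hermite_coeff y"
  shows "x = y"
  using assms
proof (transfer, intro conjI)
  fix f g :: "real \<Rightarrow> quat"
  assume "square_integrable f \<and> square_integrable f \<and> (AE t in lborel. f t = f t)"
    and "square_integrable g \<and> square_integrable g \<and> (AE t in lborel. g t = g t)"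
    and eq: "(\<lambda>j. qinner lborel (hermite_function j) f) = (\<lambda>j. qinner lborel (hermite_function j) g)"
  then have f: "qL2 lborel f" and g: "qL2 lborel g" by (simp_all add: qL2_lborel_iff)
  show "square_integrable f" "square_integrable g" using f g by (simp_all add: qL2_lborel_iff)
  have "AE t in lborel. f t - g t = 0"
    using fun_cong[OF eq] by (intro hermite_function_complete qL2_diff f g)
      (simp add: qinner_diff_right f g qL2_hermite_function)
  then show "AE t in lborel. f t = g t"
    by eventually_elim simp
qed

lemma hermite_coeff_surj:
  assumes "summable (\<lambda>j. (norm (a j))\<^sup>2)"
  obtains x where "hermite_coeff x = a"
proof -
  have "\<exists>x. hermite_coeff x = a"
    using assms
  proof transfer
    fix a :: "nat \<Rightarrow> quat"
    assume a: "summable (\<lambda>j. (norm (a j))\<^sup>2)"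
    obtain f where f: "qL2 lborel f" "(\<lambda>n. qsqnorm lborel (\<lambda>x. f x - line.partial_sum a n x)) \<longlonglongrightarrow> 0"
      using line.Riesz_Fischer[OF a] by blast
    then show "\<exists>f\<in>{f. square_integrable f \<and> square_integrable f \<and> (AE t in lborel. f t = f t)}.
        (\<lambda>j. qinner lborel (hermite_function j) f) = a"
      using line.coefficient_unique[OF f] by (auto simp: qL2_lborel_iff)
  qed
  with that show thesis by blast
qed

text \<open>A Bochner integral is 0 by convention when the integrand is not integrable; the first
  conjunct certifies that the transform is a genuine integral. The inner product formally depends on
  \<open>I\<close>, so the isomorphism is asserted for every slice.\<close>

theorem theorem4p4:
  fixes k :: nat
  shows "(\<forall>\<phi> q. square_integrable \<phi> \<longrightarrow> integrable lborel (transform_integrand k \<phi> q)) \<and>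
         (\<forall>I\<in>imag_units. hilbert_space_iso L2_space (SR2_space k I) (segal_bargmann k))"
proof (intro conjI allI impI ballI)
  fix \<phi> q assume "square_integrable \<phi>"
  then show "integrable lborel (transform_integrand k \<phi> q)"
    by (intro integrable_transform_integrand) (simp add: qL2_lborel_iff)
next
  fix I assume I: "I \<in> imag_units"
  \<comment> \<open>Both inner products are sums of one and the same series in the Hermite
    coefficients.\<close>
  have inner: "slice_inner I (segal_bargmann k x) (segal_bargmann k y) = L2_inner x y" for x y
    using slice_inner_sums[OF I summable_hermite_coeff segal_bargmann_sums summable_hermite_coeff segal_bargmann_sums]
      L2_inner_sums by (rule sums_unique2)
  have add: "segal_bargmann k (L2_add x y) = (\<lambda>q. segal_bargmann k x q + segal_bargmann k y q)" for x y
  proof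
    fix q
    show "segal_bargmann k (L2_add x y) q = segal_bargmann k x q + segal_bargmann k y q"
      using segal_bargmann_sums[of k q "L2_add x y"] sums_add[OF segal_bargmann_sums[of k q x] segal_bargmann_sums[of k q y]]
      by (intro sums_unique2) (auto simp: hermite_coeff_add algebra_simps)
  qed
  have scale: "segal_bargmann k (L2_scale x c) = (\<lambda>q. segal_bargmann k x q * c)" for x c
  proof
    fix q
    show "segal_bargmann k (L2_scale x c) q = segal_bargmann k x q * c"
      using segal_bargmann_sums[of k q "L2_scale x c"] sums_mult2[OF segal_bargmann_sums[of k q x], of c]
      by (intro sums_unique2) (auto simp: hermite_coeff_scale mult.assoc)
  qed
  \<comment> \<open>Every coefficient is an inner product with a fixed element, and
    \<open>inner\<close> reads inner products off the transforms.\<close>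
  have "inj (segal_bargmann k)"
  proof (rule injI)
    fix x y assume eq: "segal_bargmann k x = segal_bargmann k y"
    have "hermite_coeff x j = hermite_coeff y j" for j
    proof -
      have "summable (\<lambda>i. (norm (if i = j then 1 else 0 :: quat))\<^sup>2)"
        by (rule summable_finite[of "{j}"]) auto
      \<comment> \<open>This is the class of \<open>hermite_function j\<close>, found through its
        coefficients.\<close>
      then obtain e where e: "hermite_coeff e = (\<lambda>i. if i = j then 1 else 0)"
        by (rule hermite_coeff_surj)
      have "L2_inner e z = hermite_coeff z j" for z
      proof -
        have "(\<lambda>i. if i = j then hermite_coeff z i else 0) sums L2_inner e z"
          using L2_inner_sums[of e z] by (rule sums_cong[THEN iffD1, rotated]) (simp add: e)
        then show ?thesis using sums_single[of j "hermite_coeff z"] sums_unique2 by blast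
      qed
      moreover have "L2_inner e x = L2_inner e y"
        unfolding inner[symmetric] eq ..
      ultimately show ?thesis by simp
    qed
    then show "x = y" by (intro hermite_coeff_inject ext)
  qed
  moreover have "range (segal_bargmann k) = SR2 k"
  proof (intro equalityI subsetI)
    fix f assume "f \<in> range (segal_bargmann k)"
    then show "f \<in> SR2 k"
      unfolding SR2_iff using summable_hermite_coeff segal_bargmann_sums by blast
  next
    fix f assume "f \<in> SR2 k"
    then obtain a where a: "summable (\<lambda>j. (norm (a j))\<^sup>2)" "\<And>q. (\<lambda>j. normalized_hermite k j q * a j) sums f q"
      unfolding SR2_iff by blast
    obtain x where x: "hermite_coeff x = a" by (rule hermite_coeff_surj[OF a(1)])
    have "segal_bargmann k x = f"
      using segal_bargmann_sums[of k _ x] a(2) unfolding x by (intro ext) (rule sums_unique2)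
    then show "f \<in> range (segal_bargmann k)" by blast
  qed
  ultimately show "hilbert_space_iso L2_space (SR2_space k I) (segal_bargmann k)"
    by (simp add: hilbert_space_iso_def L2_space_def SR2_space_def bij_betw_def inner add scale)
qed

end
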